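(* Let $\Omega$ and $\{(\Omega_h,\mathcal T_h)\}_h$ be as in the context. Let $\mu^0=(\mu_e^0)_{e\in\mathcal E_h^\partial}$ be a family of real constants assigned to the boundary edges. Then there exists $p_h^0\in[S_h^1]^2$ such that $\operatorname{sCurl}p_h^0\in X(\mathcal T_h)\cap\ker(\operatorname{divdiv})$, $$(\operatorname{sCurl}p_h^0)_{nn}|_e=\mu_e^0,\qquad q_n(\operatorname{sCurl}p_h^0)|_e=0\qquad\text{for every }e\in\mathcal E_h^\partial,$$ and $$\|\operatorname{sCurl}p_h^0\|_{L^2(\Omega_h)}\le C\Bigl(\sum_{e\in\mathcal E_h^\partial}h_e|\mu_e^0|^2\Bigr)^{1/2}$$ with a constant $C$ independent of $h$ and $\mu^0$. Moreover, the map $\mu^0\mapsto p_h^0$ is linear.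
   Context: Geometry and meshes. $\Omega\subset\mathbb R^2$ is a bounded connected Lipschitz domain whose boundary has finitely many connected components, $\Gamma:=\partial\Omega=\bigcup_{i=0}^{H}\Gamma^{(i)}$. For every sufficiently small mesh size $h$ (statements are for $0<h\le h_0$ with $h_0$ sufficiently small), $\Omega_h$ is a bounded polygonal Lipschitz domain with boundary $\Gamma_h=\bigcup_{i=0}^{H}\Gamma_h^{(i)}$ and $\mathcal T_h$ is a conforming triangulation of $\Omega_h$. $\mathcal E_h^\partial$ and $\mathcal V_h^\partial$ are the sets of boundary edges and boundary vertices, $h_K:=\operatorname{diam}K$, $h_e:=|e|$, $h:=\max_{K}h_K$. Each $\Gamma^{(i)}$ is oriented so that $\Omega$ lies to its right, and $\Gamma_h^{(i)}$ is oriented as $\Gamma^{(i)}$; on $e\in\mathcal E_h^\partial$, $t=t_e$ and $n=n_e$ are the constant unit tangent and outward unit normal (so $n_e$ is $t_e$ rotated counterclockwise by $\pi/2$). Mesh assumption: $\{\mathcal T_h\}_h$ is uniformly shape regular and quasi-uniform, $h\to0$ and $\Gamma_h\to\Gamma$ in Hausdorff distance; on each component the vertices of $\Gamma_h^{(i)}$ lie on $\Gamma^{(i)}$ in the same cyclic order, with consecutive vertices joined by boundary edges (so $\mathcal V_h^\partial\subset\Gamma$). Notation. $\mathbb S$: symmetric $2\times2$ real matrices; $\operatorname{div}$ acts row-wise on tensors; $\operatorname{divdiv}N:=\operatorname{div}(\operatorname{div}N)$ (distributional); $H(\operatorname{divdiv},\omega;\mathbb S):=\{N\in L^2(\omega;\mathbb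 S):\operatorname{divdiv}N\in L^2(\omega)\}$. On a straight edge: $N_{nn}:=n^\top Nn$, $N_{nt}:=n^\top Nt$, $q_n(N):=n\cdot\operatorname{div}N+\partial_tN_{nt}$ (computed from the adjacent element). For $p=(p_1,p_2)^\top$, $\operatorname{Curl}p:=\begin{pmatrix}\partial_2p_1&-\partial_1p_1\\ \partial_2p_2&-\partial_1p_2\end{pmatrix}$ and $\operatorname{sCurl}p:=\frac12(\operatorname{Curl}p+(\operatorname{Curl}p)^\top)$. Spaces. $\operatorname{RT}^k(K):=\mathbb P_k(K;\mathbb R^2)+x\,\mathbb P_k(K)$, $X(K):=\operatorname{sym}(\operatorname{RT}^0(K)\otimes\operatorname{RT}^1(K))$, where $U\otimes V$ is the span of $\{\phi\psi^\top:\phi\in U,\psi\in V\}$ and $\operatorname{sym}Q:=(Q+Q^\top)/2$; $X(\mathcal T_h):=\{N_h\in H(\operatorname{divdiv},\Omega_h;\mathbb S):N_h|_K\in X(K)\ \forall K\in\mathcal T_h\}$; $S_h^1:=\{p_h\in C^0(\overline\Omega_h):p_h|_K\in\mathbb P_1(K)\ \forall K\in\mathcal T_h\}$. *)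

theory Defs
  imports "HOL-Analysis.Analysis"
begin

section \<open>Domains\<close>

text \<open>A Lipschitz domain is, near each boundary point \<open>z\<close> and in suitable orthonormal coordinates
  \<open>y\<close> centred at \<open>z\<close>, the strict epigraph of a Lipschitz function.\<close>

definition lipschitz_domain :: "(real^2) set \<Rightarrow> bool" where
  "lipschitz_domain D \<longleftrightarrow>
     open D \<and> connected D \<and> bounded D \<and> D \<noteq> {} \<and>
     (\<forall>z\<in>frontier D. \<exists>(R :: real^2 \<Rightarrow> real^2) (g :: real \<Rightarrow> real) L r.
        orthogonal_transformation R \<and> L-lipschitz_on UNIV g \<and> 0 < r \<and>
        (\<forall>y\<in>ball 0 r. z + R y \<in> D \<longleftrightarrow> g (y$1) < y$2))"

definition polygonal_lipschitz_domain :: "(real^2) set \<Rightarrow> bool" where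
  "polygonal_lipschitz_domain D \<longleftrightarrow>
     lipschitz_domain D \<and>
     (\<exists>S. finite S \<and> (\<forall>s\<in>S. \<exists>a b. s = closed_segment a b) \<and> frontier D = \<Union>S)"

definition hausdorff_dist :: "(real^2) set \<Rightarrow> (real^2) set \<Rightarrow> real" where
  "hausdorff_dist A B = max (SUP a\<in>A. infdist a B) (SUP b\<in>B. infdist b A)"

text \<open>Counterclockwise rotation by \<open>\<pi>/2\<close>.\<close>

definition rot :: "real^2 \<Rightarrow> real^2" where
  "rot v = vector [- v$2, v$1]"

text \<open>\<open>g\<close> traverses the closed curve \<open>G\<close> once, with \<open>D\<close> lying to its right: at almost every
  parameter the curve has a nonzero tangent \<open>v\<close>, and the normal \<open>- rot v\<close> to the right
  of \<open>v\<close> points into \<open>D\<close>. Boundary components of Lipschitz domains have such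
  parametrisations (for instance by a multiple of arc length).\<close>

definition right_oriented_param ::
    "(real^2) set \<Rightarrow> (real^2) set \<Rightarrow> (real \<Rightarrow> real^2) \<Rightarrow> bool" where
  "right_oriented_param D G g \<longleftrightarrow>
     simple_path g \<and> pathfinish g = pathstart g \<and> path_image g = G \<and>
     (\<exists>L. L-lipschitz_on {0..1} g) \<and>
     (AE s in lebesgue_on {0..1}. \<exists>v. v \<noteq> 0 \<and> (g has_vector_derivative v) (at s) \<and>
        (\<forall>\<^sub>F \<epsilon> in at_right 0. g s - \<epsilon> *\<^sub>R rot v \<in> D))"

section \<open>Meshes\<close>

text \<open>The elements are closed triangles; the predicate \<open>triangulation\<close> says that any two of them
  meet in a common (possibly empty) face.\<close>

definition conforming_triangulation :: "(real^2) set set \<Rightarrow> (real^2) set \<Rightarrow> bool" where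
  "conforming_triangulation T D \<longleftrightarrow>
     triangulation T \<and> (\<forall>K\<in>T. 2 simplex K) \<and> \<Union>T = closure D"

definition mesh_size :: "(real^2) set set \<Rightarrow> real" where
  "mesh_size T = Max (diameter ` T)"

definition inball_diameter :: "(real^2) set \<Rightarrow> real" where
  "inball_diameter K = Sup {2 * r | r. 0 \<le> r \<and> (\<exists>x. cball x r \<subseteq> K)}"

definition uniformly_shape_regular :: "real set \<Rightarrow> (real \<Rightarrow> (real^2) set set) \<Rightarrow> bool" where
  "uniformly_shape_regular J T \<longleftrightarrow>
     (\<exists>\<sigma>. \<forall>h\<in>J. \<forall>K\<in>T h. diameter K \<le> \<sigma> * inball_diameter K)"

definition quasi_uniform :: "real set \<Rightarrow> (real \<Rightarrow> (real^2) set set) \<Rightarrow> bool" where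
  "quasi_uniform J T \<longleftrightarrow>
     (\<exists>\<kappa>. \<forall>h\<in>J. \<forall>K\<in>T h. mesh_size (T h) \<le> \<kappa> * diameter K)"

definition bdry_edges :: "(real^2) set \<Rightarrow> (real^2) set set \<Rightarrow> (real^2) set set" where
  "bdry_edges D T = {e. e \<subseteq> frontier D \<and> (\<exists>K\<in>T. e edge_of K)}"

definition bdry_vertices :: "(real^2) set \<Rightarrow> (real^2) set set \<Rightarrow> (real^2) set" where
  "bdry_vertices D T = {v \<in> frontier D. \<exists>K\<in>T. v extreme_point_of K}"

text \<open>The element adjacent to a boundary edge. The remaining definitions below which
  refer to an edge are meaningful for boundary edges only.\<close>

definition adj_elem :: "(real^2) set set \<Rightarrow> (real^2) set \<Rightarrow> (real^2) set" where
  "adj_elem T e = (THE K. K \<in> T \<and> e edge_of K)"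

text \<open>The condition on \<open>n\<close> makes it orthogonal to \<open>e\<close>, since \<open>e\<close> is contained in the element.\<close>

definition edge_normal :: "(real^2) set set \<Rightarrow> (real^2) set \<Rightarrow> real^2" where
  "edge_normal T e = (THE n. norm n = 1 \<and> (\<forall>x\<in>e. \<forall>y\<in>adj_elem T e. n \<bullet> (y - x) \<le> 0))"

text \<open>Thus \<open>edge_normal T e = rot (edge_tangent T e)\<close>.\<close>

definition edge_tangent :: "(real^2) set set \<Rightarrow> (real^2) set \<Rightarrow> real^2" where
  "edge_tangent T e = - rot (edge_normal T e)"

text \<open>The mesh vertices on the boundary component \<open>G'\<close> of \<open>D\<close>, listed in the order in which the
  oriented closed curve \<open>g\<close> passes through them, are cyclically joined by
  the boundary edges in \<open>G'\<close>, and the tangents of these edges point in the direction of \<open>g\<close>.\<close>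

definition same_cyclic_order ::
    "(real^2) set \<Rightarrow> (real^2) set set \<Rightarrow> (real^2) set \<Rightarrow> (real \<Rightarrow> real^2) \<Rightarrow> bool" where
  "same_cyclic_order D T G' g \<longleftrightarrow>
     (\<exists>(m::nat) (s :: nat \<Rightarrow> real).
        3 \<le> m \<and> strict_mono_on {..<m} s \<and> s ` {..<m} \<subseteq> {0..<1} \<and>
        (let v = (\<lambda>j. g (s (j mod m))) in
          bdry_vertices D T \<inter> G' = v ` {..<m} \<and>
          {e \<in> bdry_edges D T. e \<subseteq> G'} = {closed_segment (v j) (v (Suc j)) | j. j < m} \<and>
          (\<forall>j<m. edge_tangent T (closed_segment (v j) (v (Suc j)))
                  = (v (Suc j) - v j) /\<^sub>R norm (v (Suc j) - v j))))"

section \<open>Differential operators\<close>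

definition partial_deriv :: "2 \<Rightarrow> (real^2 \<Rightarrow> real) \<Rightarrow> real^2 \<Rightarrow> real" where
  "partial_deriv j f x = frechet_derivative f (at x) (axis j 1)"

definition sym_part :: "real^2^2 \<Rightarrow> real^2^2" where
  "sym_part Q = (1/2) *\<^sub>R (Q + transpose Q)"

text \<open>In \<open>\<chi> i j\<close>, the index \<open>i\<close> is the row. For continuous piecewise affine functions these pointwise
  derivatives, defined off the mesh skeleton, are the weak derivatives.\<close>

definition Curl :: "(real^2 \<Rightarrow> real^2) \<Rightarrow> real^2 \<Rightarrow> real^2^2" where
  "Curl p x = (\<chi> i j. if j = 1 then partial_deriv 2 (\<lambda>y. p y $ i) x
                      else - partial_deriv 1 (\<lambda>y. p y $ i) x)"

definition sCurl :: "(real^2 \<Rightarrow> real^2) \<Rightarrow> real^2 \<Rightarrow> real^2^2" where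
  "sCurl p x = sym_part (Curl p x)"

definition row_div :: "(real^2 \<Rightarrow> real^2^2) \<Rightarrow> real^2 \<Rightarrow> real^2" where
  "row_div N x = (\<chi> i. \<Sum>j\<in>UNIV. partial_deriv j (\<lambda>y. N y $ i $ j) x)"

definition hessian :: "(real^2 \<Rightarrow> real) \<Rightarrow> real^2 \<Rightarrow> real^2^2" where
  "hessian f x = (\<chi> i j. partial_deriv i (partial_deriv j f) x)"

text \<open>Smoothness: all iterated partial derivatives are differentiable.\<close>

definition test_function :: "(real^2) set \<Rightarrow> (real^2 \<Rightarrow> real) \<Rightarrow> bool" where
  "test_function D f \<longleftrightarrow>
     (\<forall>js. foldr partial_deriv js f differentiable_on UNIV) \<and>
     compact (closure {x. f x \<noteq> 0}) \<and> closure {x. f x \<noteq> 0} \<subseteq> D"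

text \<open>The distributional identity \<open>divdiv N = g\<close> in \<open>D\<close>. The inner product of matrices is the
  Frobenius product.\<close>

definition has_divdiv ::
    "(real^2 \<Rightarrow> real^2^2) \<Rightarrow> (real^2 \<Rightarrow> real) \<Rightarrow> (real^2) set \<Rightarrow> bool" where
  "has_divdiv N g D \<longleftrightarrow>
     (\<forall>f. test_function D f \<longrightarrow>
        (\<integral>x. N x \<bullet> hessian f x \<partial>lebesgue_on D) = (\<integral>x. g x * f x \<partial>lebesgue_on D))"

definition L2_on :: "(real^2) set \<Rightarrow> (real^2 \<Rightarrow> 'b::euclidean_space) set" where
  "L2_on D = {f. f \<in> borel_measurable (lebesgue_on D) \<and>
                 integrable (lebesgue_on D) (\<lambda>x. (norm (f x))\<^sup>2)}"

definition L2_norm_on :: "(real^2) set \<Rightarrow> (real^2 \<Rightarrow> 'b::euclidean_space) \<Rightarrow> real" where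
  "L2_norm_on D f = sqrt (\<integral>x. (norm (f x))\<^sup>2 \<partial>lebesgue_on D)"

definition H_divdiv :: "(real^2) set \<Rightarrow> (real^2 \<Rightarrow> real^2^2) set" where
  "H_divdiv D = {N \<in> L2_on D. (AE x in lebesgue_on D. transpose (N x) = N x) \<and>
                              (\<exists>g\<in>L2_on D. has_divdiv N g D)}"

definition ker_divdiv :: "(real^2) set \<Rightarrow> (real^2 \<Rightarrow> real^2^2) set" where
  "ker_divdiv D = {N. has_divdiv N (\<lambda>_. 0) D}"

section \<open>Finite element spaces\<close>

text \<open>Polynomial spaces on an element are represented by polynomial functions on the whole plane.\<close>

definition polys :: "nat \<Rightarrow> (real^2 \<Rightarrow> real) set" where
  "polys k = {f. \<exists>c :: nat \<Rightarrow> nat \<Rightarrow> real.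
      \<forall>x. f x = (\<Sum>(i, j)\<in>{(i, j). i + j \<le> k}. c i j * (x$1) ^ i * (x$2) ^ j)}"

definition RT :: "nat \<Rightarrow> (real^2 \<Rightarrow> real^2) set" where
  "RT k = {\<lambda>x. p x + q x *\<^sub>R x | p q. (\<forall>i. (\<lambda>x. p x $ i) \<in> polys k) \<and> q \<in> polys k}"

definition outer_prod :: "real^2 \<Rightarrow> real^2 \<Rightarrow> real^2^2" where
  "outer_prod a b = (\<chi> i j. a$i * b$j)"

definition tensor_span ::
    "(real^2 \<Rightarrow> real^2) set \<Rightarrow> (real^2 \<Rightarrow> real^2) set \<Rightarrow> (real^2 \<Rightarrow> real^2^2) set" where
  "tensor_span U V = {\<lambda>x. \<Sum>l<n. c l *\<^sub>R outer_prod (\<phi> l x) (\<psi> l x) | (n::nat) c \<phi> \<psi>.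
                        \<forall>l<n. \<phi> l \<in> U \<and> \<psi> l \<in> V}"

definition X_elem :: "(real^2 \<Rightarrow> real^2^2) set" where
  "X_elem = (\<lambda>Q x. sym_part (Q x)) ` tensor_span (RT 0) (RT 1)"

text \<open>Elements of \<open>X_space\<close> are represented by functions which are polynomial in the interior of each
  element; the values on the mesh skeleton are irrelevant.\<close>

definition X_space :: "(real^2) set \<Rightarrow> (real^2) set set \<Rightarrow> (real^2 \<Rightarrow> real^2^2) set" where
  "X_space D T = {N \<in> H_divdiv D. \<forall>K\<in>T. \<exists>Q\<in>X_elem. \<forall>x\<in>interior K. N x = Q x}"

definition S1 :: "(real^2) set \<Rightarrow> (real^2) set set \<Rightarrow> (real^2 \<Rightarrow> real) set" where
  "S1 D T = {f. continuous_on (closure D) f \<and> (\<forall>K\<in>T. \<exists>q\<in>polys 1. \<forall>x\<in>K. f x = q x)}"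

definition S1_vec :: "(real^2) set \<Rightarrow> (real^2) set set \<Rightarrow> (real^2 \<Rightarrow> real^2) set" where
  "S1_vec D T = {p. \<forall>i. (\<lambda>x. p x $ i) \<in> S1 D T}"

section \<open>Traces on boundary edges\<close>

text \<open>Value at \<open>x\<close> on the edge \<open>e\<close>, taken from the adjacent element.\<close>

definition elem_trace ::
    "(real^2) set set \<Rightarrow> (real^2) set \<Rightarrow> (real^2 \<Rightarrow> real) \<Rightarrow> real^2 \<Rightarrow> real" where
  "elem_trace T e f x = Lim (at x within interior (adj_elem T e)) f"

definition trace_nn ::
    "(real^2) set set \<Rightarrow> (real^2) set \<Rightarrow> (real^2 \<Rightarrow> real^2^2) \<Rightarrow> real^2 \<Rightarrow> real" where
  "trace_nn T e N = elem_trace T e (\<lambda>y. edge_normal T e \<bullet> (N y *v edge_normal T e))"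

definition trace_qn ::
    "(real^2) set set \<Rightarrow> (real^2) set \<Rightarrow> (real^2 \<Rightarrow> real^2^2) \<Rightarrow> real^2 \<Rightarrow> real" where
  "trace_qn T e N =
     (let n = edge_normal T e; t = edge_tangent T e in
      elem_trace T e (\<lambda>y. n \<bullet> row_div N y
                          + frechet_derivative (\<lambda>z. n \<bullet> (N z *v t)) (at y) t))"

section \<open>Edge data\<close>

text \<open>Families of reals indexed by a set \<open>E\<close> of edges, represented by their extension by zero.\<close>

definition edge_data :: "(real^2) set set \<Rightarrow> ((real^2) set \<Rightarrow> real) set" where
  "edge_data E = {\<mu>. \<forall>e. e \<notin> E \<longrightarrow> \<mu> e = 0}"

text \<open>Linearity of a map from \<open>edge_data E\<close> to vector-valued functions on \<open>A\<close>.\<close>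

definition linear_on_edge_data ::
    "(real^2) set set \<Rightarrow> (real^2) set \<Rightarrow> (((real^2) set \<Rightarrow> real) \<Rightarrow> real^2 \<Rightarrow> real^2) \<Rightarrow> bool" where
  "linear_on_edge_data E A P \<longleftrightarrow>
     (\<forall>\<mu>\<in>edge_data E. \<forall>\<nu>\<in>edge_data E. \<forall>x\<in>A. P (\<lambda>e. \<mu> e + \<nu> e) x = P \<mu> x + P \<nu> x) \<and>
     (\<forall>c. \<forall>\<mu>\<in>edge_data E. \<forall>x\<in>A. P (\<lambda>e. c * \<mu> e) x = c *\<^sub>R P \<mu> x)"

end

theory Submission
  imports Defs
begin

text \<open>Let \<open>t\<close> be the unit tangent of a boundary edge and \<open>n = rot t\<close> its
  normal. For continuous, piecewise affine \<open>p\<close> the matrix \<open>sCurl p\<close> is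
  constant on each element, so that it belongs to \<open>X_elem\<close> and its trace
  \<open>q_n\<close> vanishes; it is in the kernel of \<open>divdiv\<close> because rotated
  gradients are orthogonal to gradients of functions with compact support
  (\<open>sCurl_interp_divdiv_free\<close>). Moreover \<open>Curl p\<close> maps \<open>n\<close>
  to minus the tangential derivative of \<open>p\<close>. The trace condition thus prescribes the
  normal components of the increments of \<open>p\<close> along the boundary edges, while their
  tangential components are free. It remains to choose these, and to extend \<open>p\<close> from
  the boundary to the interior vertices with an energy controlled by the square sum of the data.

  The increments along a closed boundary polygon must sum to zero. This is achieved with
  tangential slopes \<open>t \<bullet> a\<close>, where one vector \<open>a\<close> for each
  component solves a linear system. The system is uniformly coercive because a boundary component
  is not contained in a line (\<open>loop_not_in_line\<close>, \<open>polygon_coercive\<close>).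

  For the extension, each increment is multiplied by a scalar function on the boundary vertices
  that jumps by one across its edge and otherwise decreases slowly along the polygon; the slow
  parts cancel because the increments sum to zero (\<open>sawtooth_Suc\<close>). Boundary
  components of Lipschitz domains are chord-arc curves (\<open>chord_arc\<close>): the shorter arc
  between two points is at most a constant times their distance. Hence such a sawtooth function
  with jump at \<open>y\<close> varies by order one only near \<open>y\<close>, and McShane's
  formula with a suitable weight extends it to the plane with gradient at most a constant times
  \<open>1 / (\<bar>x - y\<bar> + h)\<close> at \<open>x\<close> (\<open>sawtooth_diff\<close>,
  \<open>cone_ext\<close>).

  By superposition the gradient of \<open>p\<close> at \<open>x\<close> is at most the integral of
  \<open>f y / (\<bar>x - y\<bar> + h)\<close> over boundary points \<open>y\<close>, where
  \<open>f\<close> is the size of the slopes. This kernel is bounded from \<open>L^2\<close> of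
  the curve to \<open>L^2\<close> of the domain: by the Cauchy-Schwarz inequality it suffices that
  \<open>\<bar>x - y\<bar> powr (-4/3)\<close> is integrable over the domain and \<open>\<bar>x -
  y\<bar> powr (-2/3)\<close> over the curve (\<open>sum_squares_schur\<close>,
  \<open>sum_separated_points\<close>, \<open>sum_inverse_dist\<close>), uniformly with respect to
  the other variable. All constants depend on \<open>\<Omega>\<close> and on the regularity of the
  mesh only, and every step is linear in the data.\<close>

section \<open>Sums of powers over separated points\<close>

text \<open>With \<open>x = (k + 1) powr (1/3)\<close> and \<open>y = k powr (1/3)\<close>, the
  factorisation \<open>x^3 - y^3 = (x - y) * (x^2 + x * y + y^2)\<close> gives \<open>1 \<le> 3 *
  x^2 * (x - y)\<close>.\<close>

lemma powr_two_thirds_telescope: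
  "(real k + 1) powr (-2/3) \<le> 3 * ((real k + 1) powr (1/3) - real k powr (1/3))"
proof -
  define x where "x = (real k + 1) powr (1/3)"
  define y where "y = real k powr (1/3)"
  have x0: "x > 0" and y0: "y \<ge> 0" by (auto simp: x_def y_def)
  have x3: "x^3 = real k + 1"
    by (simp add: x_def powr_realpow[symmetric] powr_powr)
  have y3: "y^3 = real k"
    by (cases "k = 0") (simp_all add: y_def powr_realpow[symmetric] powr_powr)
  have xy: "y \<le> x" unfolding x_def y_def by (rule powr_mono2) auto
  have "1 = (x - y) * (x\<^sup>2 + x*y + y\<^sup>2)"
    using x3 y3 by (simp add: power2_eq_square power3_eq_cube algebra_simps)
  also have "\<dots> \<le> (x - y) * (3 * x\<^sup>2)"
  proof (rule mult_left_mono)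
    have "x*y \<le> x*x" "y*y \<le> x*x" using xy x0 y0 by (auto intro: mult_mono)
    then show "x\<^sup>2 + x*y + y\<^sup>2 \<le> 3 * x\<^sup>2" by (simp add: power2_eq_square)
  qed (use xy in auto)
  finally have "1 / x\<^sup>2 \<le> 3 * (x - y)" using x0 by (simp add: field_simps)
  moreover have "(real k + 1) powr (-2/3) = 1 / x\<^sup>2"
  proof -
    have "x\<^sup>2 = (real k + 1) powr (2/3)"
      by (simp add: x_def power2_eq_square powr_add[symmetric])
    then show ?thesis by (simp add: powr_minus_divide)
  qed
  ultimately show ?thesis by (simp add: x_def y_def)
qed

lemma sum_powr_two_thirds:
  "(\<Sum>k<n. (real k + 1) powr (-2/3)) \<le> 3 * real n powr (1/3)"
proof (induction n)
  case (Suc n)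
  then show ?case using powr_two_thirds_telescope[of n] by (simp add: add.commute)
qed simp

lemma sum_abs_shift_le:
  fixes g :: "nat \<Rightarrow> real"
  assumes "\<And>k. g k \<ge> 0" "j0 < m"
  shows "(\<Sum>j<m. g (nat \<bar>int j - int j0\<bar>)) \<le> 2 * (\<Sum>k<m. g k)"
proof -
  have "(\<Sum>j<m. g (nat \<bar>int j - int j0\<bar>))
      = (\<Sum>j\<in>{..<j0}. g (nat \<bar>int j - int j0\<bar>)) + (\<Sum>j\<in>{j0..<m}. g (nat \<bar>int j - int j0\<bar>))"
    using assms(2) by (subst sum.union_disjoint[symmetric]) (auto intro!: sum.cong)
  also have "(\<Sum>j\<in>{..<j0}. g (nat \<bar>int j - int j0\<bar>)) = (\<Sum>k\<in>(\<lambda>j. j0 - j) ` {..<j0}. g k)"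
    by (subst sum.reindex) (auto simp: inj_on_def of_nat_diff intro!: sum.cong arg_cong[of _ _ g])
  also have "\<dots> \<le> (\<Sum>k<m. g k) "
    using assms by (intro sum_mono2) auto
  also have "(\<Sum>j\<in>{j0..<m}. g (nat \<bar>int j - int j0\<bar>)) = (\<Sum>k\<in>(\<lambda>j. j - j0) ` {j0..<m}. g k)"
    by (subst sum.reindex) (auto simp: inj_on_def intro!: sum.cong arg_cong[of _ _ g])
  also have "\<dots> \<le> (\<Sum>k<m. g k) "
    using assms by (intro sum_mono2) auto
  finally show ?thesis by simp
qed

lemma sum_abs_int_le:
  fixes g :: "nat \<Rightarrow> real"
  assumes "\<And>k. g k \<ge> 0"
  shows "(\<Sum>a\<in>{-int M..int M}. g (nat \<bar>a\<bar>)) \<le> 2 * (\<Sum>k<Suc M. g k)"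
proof -
  have "{-int M..int M} = (\<lambda>k. - int k) ` {0<..<Suc M} \<union> int ` {..<Suc M}"
  proof (intro equalityI subsetI)
    fix x assume "x \<in> {-int M..int M}"
    then show "x \<in> (\<lambda>k. - int k) ` {0<..<Suc M} \<union> int ` {..<Suc M}"
      by (cases "x \<ge> 0") (auto intro!: image_eqI[of _ _ "nat \<bar>x\<bar>"])
  qed auto
  then have "(\<Sum>a\<in>{-int M..int M}. g (nat \<bar>a\<bar>))
     = (\<Sum>a\<in>(\<lambda>k. - int k) ` {0<..<Suc M}. g (nat \<bar>a\<bar>)) + (\<Sum>a\<in>int ` {..<Suc M}. g (nat \<bar>a\<bar>))"
    by (simp only:) (rule sum.union_disjoint, auto)
  also have "(\<Sum>a\<in>(\<lambda>k. - int k) ` {0<..<Suc M}. g (nat \<bar>a\<bar>)) = (\<Sum>k\<in>{0<..<Suc M}. g k)"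
    by (subst sum.reindex) (auto simp: inj_on_def)
  also have "\<dots> \<le> (\<Sum>k<Suc M. g k)"
    using assms by (intro sum_mono2) auto
  also have "(\<Sum>a\<in>int ` {..<Suc M}. g (nat \<bar>a\<bar>)) = (\<Sum>k<Suc M. g k)"
    by (subst sum.reindex) auto
  finally show ?thesis by simp
qed

text \<open>A square of side \<open>r\<close> has diameter less than \<open>2 * r\<close>, so a grid
  of such squares has at most one of the points in each cell. The weight is at most the product of a
  power \<open>-2/3\<close> of either coordinate, hence the sum over the cells factors into two
  one-dimensional sums.\<close>

lemma sum_separated_points:
  fixes c :: "'i \<Rightarrow> real^2"
  assumes fin: "finite I" and r: "0 < r" "2*r \<le> h"
    and sep: "\<And>i j. i \<in> I \<Longrightarrow> j \<in> I \<Longrightarrow> i \<noteq> j \<Longrightarrow> 2*r \<le> dist (c i) (c j)"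
    and R: "\<And>i. i \<in> I \<Longrightarrow> dist (c i) y \<le> R"
  shows "(\<Sum>i\<in>I. r\<^sup>2 * (dist (c i) y + h) powr (-4/3)) \<le> 36 * (R + 3*r) powr (2/3)"
proof (cases "I = {}")
  case False
  then have R0: "R \<ge> 0" using R zero_le_dist order_trans by blast
  define a where "a = (\<lambda>k i. \<lfloor>(c i $ k - y $ k) / r\<rfloor>)"
  define M where "M = nat \<lceil>R/r\<rceil> + 1"
  define g where "g = (\<lambda>k::nat. (real k + 1) powr (-2/3))"
  have g0: "g k \<ge> 0" for k by (simp add: g_def)
  have inj: "inj_on (\<lambda>i. (a 1 i, a 2 i)) I"
  proof (rule inj_onI, rule ccontr)
    fix i j assume ij: "i \<in> I" "j \<in> I" "(a 1 i, a 2 i) = (a 1 j, a 2 j)" "i \<noteq> j"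
    have d: "\<bar>c i $ k - c j $ k\<bar> < r" if "a k i = a k j" for k
    proof -
      have "\<bar>(c i $ k - y $ k) / r - (c j $ k - y $ k) / r\<bar> < 1"
        using that unfolding a_def by linarith
      then show ?thesis using r by (simp add: diff_divide_distrib[symmetric] field_simps abs_if split: if_splits)
    qed
    have "(dist (c i) (c j))\<^sup>2 = (c i $ 1 - c j $ 1)\<^sup>2 + (c i $ 2 - c j $ 2)\<^sup>2"
      by (simp add: dist_norm norm_vec_def L2_set_def sum_2)
    also have "\<dots> \<le> r\<^sup>2 + r\<^sup>2"
      using d[of 1] d[of 2] ij(3) by (intro add_mono) (metis abs_le_square_iff abs_of_nonneg less_imp_le r(1) prod.inject)+
    finally have "(dist (c i) (c j))\<^sup>2 \<le> 2 * r\<^sup>2" by simp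
    moreover have "(2*r)\<^sup>2 \<le> (dist (c i) (c j))\<^sup>2"
      using sep[OF ij(1,2,4)] r by (intro power_mono) auto
    moreover have "r\<^sup>2 > 0" using r by simp
    ultimately show False by (simp add: power_mult_distrib)
  qed
  have bnd: "\<bar>a k i\<bar> \<le> int M" if "i \<in> I" for i k
  proof -
    have "\<bar>c i $ k - y $ k\<bar> \<le> R"
      using R[OF that] component_le_norm_cart[of "c i - y" k] by (simp add: dist_norm)
    then have "\<bar>(c i $ k - y $ k) / r\<bar> \<le> R / r"
      using r by (simp add: divide_right_mono abs_divide)
    then show ?thesis unfolding a_def M_def by linarith
  qed
  have low: "r * (real (nat \<bar>a k i\<bar>) + 1) \<le> dist (c i) y + h" for k i
  proof -
    have "real_of_int \<bar>a k i\<bar> \<le> \<bar>(c i $ k - y $ k) / r\<bar> + 1"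
      unfolding a_def by linarith
    then have "r * real_of_int \<bar>a k i\<bar> \<le> r * (\<bar>(c i $ k - y $ k) / r\<bar> + 1)"
      using r by (intro mult_left_mono) auto
    also have "\<dots> = \<bar>c i $ k - y $ k\<bar> + r" using r by (simp add: abs_divide field_simps)
    also have "\<dots> \<le> dist (c i) y + r"
      using component_le_norm_cart[of "c i - y" k] by (simp add: dist_norm)
    finally show ?thesis using r by (simp add: algebra_simps)
  qed
  have summand: "r\<^sup>2 * (dist (c i) y + h) powr (-4/3) \<le> r powr (2/3) * (g (nat \<bar>a 1 i\<bar>) * g (nat \<bar>a 2 i\<bar>))"
    if "i \<in> I" for i
  proof -
    let ?d = "dist (c i) y + h"
    have d0: "?d > 0" using r by (simp add: add_nonneg_pos)
    have l: "?d powr (-2/3) \<le> r powr (-2/3) * g (nat \<bar>a k i\<bar>)" for k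
    proof -
      have "?d powr (-2/3) \<le> (r * (real (nat \<bar>a k i\<bar>) + 1)) powr (-2/3)"
        using low[of k i] r by (intro powr_mono2') auto
      then show ?thesis using r by (simp add: g_def powr_mult)
    qed
    have "?d powr (-4/3) = ?d powr (-2/3) * ?d powr (-2/3)"
      by (simp add: powr_add[symmetric])
    also have "\<dots> \<le> (r powr (-2/3) * g (nat \<bar>a 1 i\<bar>)) * (r powr (-2/3) * g (nat \<bar>a 2 i\<bar>))"
      using l by (intro mult_mono) (auto simp: g0)
    also have "\<dots> = r powr (-4/3) * (g (nat \<bar>a 1 i\<bar>) * g (nat \<bar>a 2 i\<bar>))"
      by (simp add: powr_add[symmetric] mult_ac)
    finally have "r\<^sup>2 * ?d powr (-4/3) \<le> r\<^sup>2 * (r powr (-4/3) * (g (nat \<bar>a 1 i\<bar>) * g (nat \<bar>a 2 i\<bar>)))"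
      by (intro mult_left_mono) auto
    also have "r\<^sup>2 * (r powr (-4/3) * (g (nat \<bar>a 1 i\<bar>) * g (nat \<bar>a 2 i\<bar>)))
       = (r powr 2 * r powr (-4/3)) * (g (nat \<bar>a 1 i\<bar>) * g (nat \<bar>a 2 i\<bar>))"
      using r by (simp add: powr_numeral)
    also have "r powr 2 * r powr (-4/3) = r powr (2/3)" by (simp add: powr_add[symmetric])
    finally show ?thesis .
  qed
  let ?G = "\<lambda>p. g (nat \<bar>fst p\<bar>) * g (nat \<bar>snd p\<bar>)"
  let ?S = "{-int M..int M}"
  have "(\<Sum>i\<in>I. g (nat \<bar>a 1 i\<bar>) * g (nat \<bar>a 2 i\<bar>)) = (\<Sum>p\<in>(\<lambda>i. (a 1 i, a 2 i)) ` I. ?G p)"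
    using inj by (subst sum.reindex) auto
  also have "\<dots> \<le> (\<Sum>p\<in>?S \<times> ?S. ?G p)"
    using bnd by (intro sum_mono2) (auto simp: g0 abs_le_iff minus_le_iff)
  also have "\<dots> = (\<Sum>a\<in>?S. g (nat \<bar>a\<bar>)) * (\<Sum>a\<in>?S. g (nat \<bar>a\<bar>))"
    by (simp add: sum_product sum.cartesian_product case_prod_beta)
  also have "\<dots> \<le> (6 * real (Suc M) powr (1/3)) * (6 * real (Suc M) powr (1/3))"
  proof -
    have "(\<Sum>a\<in>?S. g (nat \<bar>a\<bar>)) \<le> 2 * (\<Sum>k<Suc M. g k)"
      by (rule sum_abs_int_le) (rule g0)
    also have "\<dots> \<le> 6 * real (Suc M) powr (1/3)"
      using sum_powr_two_thirds[of "Suc M"] unfolding g_def by linarith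
    finally have "(\<Sum>a\<in>?S. g (nat \<bar>a\<bar>)) \<le> 6 * real (Suc M) powr (1/3)" .
    then show ?thesis by (intro mult_mono) (auto intro!: sum_nonneg g0)
  qed
  also have "\<dots> = 36 * real (Suc M) powr (2/3)"
    by (simp add: powr_add[symmetric])
  finally have S: "(\<Sum>i\<in>I. g (nat \<bar>a 1 i\<bar>) * g (nat \<bar>a 2 i\<bar>)) \<le> 36 * real (Suc M) powr (2/3)" .
  have "(\<Sum>i\<in>I. r\<^sup>2 * (dist (c i) y + h) powr (-4/3))
     \<le> (\<Sum>i\<in>I. r powr (2/3) * (g (nat \<bar>a 1 i\<bar>) * g (nat \<bar>a 2 i\<bar>)))"
    by (rule sum_mono) (rule summand)
  also have "\<dots> \<le> r powr (2/3) * (36 * real (Suc M) powr (2/3))"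
    unfolding sum_distrib_left[symmetric] by (intro mult_left_mono S) auto
  also have "\<dots> = 36 * (r * real (Suc M)) powr (2/3)" using r by (simp add: powr_mult)
  also have "\<dots> \<le> 36 * (R + 3*r) powr (2/3)"
  proof -
    have "real (Suc M) \<le> R/r + 3" unfolding M_def using R0 r
      by (simp add: of_nat_nat) linarith
    then have "r * real (Suc M) \<le> r * (R/r + 3)" using r by (intro mult_left_mono) auto
    also have "\<dots> = R + 3*r" using r by (simp add: field_simps)
    finally show ?thesis using r by (intro mult_left_mono powr_mono2) auto
  qed
  finally show ?thesis .
qed simp

section \<open>Closed polygons and sawtooth functions\<close>

definition poly_len :: "(nat \<Rightarrow> real^2) \<Rightarrow> nat \<Rightarrow> real" where
  "poly_len v k = (\<Sum>i<k. dist (v i) (v (Suc i)))"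

lemma poly_len_0 [simp]: "poly_len v 0 = 0"
  and poly_len_Suc: "poly_len v (Suc k) = poly_len v k + dist (v k) (v (Suc k))"
  by (simp_all add: poly_len_def)

lemma poly_len_diff:
  assumes "k \<le> l"
  shows "poly_len v l - poly_len v k = (\<Sum>i\<in>{k..<l}. dist (v i) (v (Suc i)))"
proof -
  have "poly_len v k + (\<Sum>i\<in>{k..<l}. dist (v i) (v (Suc i))) = poly_len v l"
    unfolding poly_len_def lessThan_atLeast0 using assms by (intro sum.atLeastLessThan_concat) auto
  then show ?thesis by simp
qed

lemma poly_len_mono: "k \<le> l \<Longrightarrow> poly_len v k \<le> poly_len v l"
  using poly_len_diff[of k l v] by (metis diff_ge_0_iff_ge sum_nonneg zero_le_dist)

lemma poly_len_nonneg: "0 \<le> poly_len v k"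
  using poly_len_mono[of 0 k v] by simp

lemma dist_le_poly_len:
  assumes "k \<le> l" shows "dist (v k) (v l) \<le> poly_len v l - poly_len v k"
  using assms
proof (induction l rule: dec_induct)
  case (step n)
  then show ?case using dist_triangle[of "v k" "v (Suc n)" "v n"] by (simp add: poly_len_Suc)
qed simp

lemma poly_len_ge:
  assumes "k \<le> l" "\<And>i. k \<le> i \<Longrightarrow> i < l \<Longrightarrow> d \<le> dist (v i) (v (Suc i))"
  shows "d * real (l - k) \<le> poly_len v l - poly_len v k"
proof -
  have "d * real (l - k) = (\<Sum>i\<in>{k..<l}. d)" by simp
  also have "\<dots> \<le> (\<Sum>i\<in>{k..<l}. dist (v i) (v (Suc i)))" using assms by (intro sum_mono) auto
  finally show ?thesis using poly_len_diff[OF assms(1)] by simp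
qed

text \<open>As a function of the vertex \<open>k\<close> of a closed polygon this rises by one
  across edge \<open>j\<close>. Along the whole polygon it also falls by one, in proportion to arc
  length; thus it closes up without a second jump at the vertex \<open>0\<close>.\<close>

definition sawtooth :: "(nat \<Rightarrow> real^2) \<Rightarrow> nat \<Rightarrow> nat \<Rightarrow> nat \<Rightarrow> real" where
  "sawtooth v m j k = (if j < k then 1 else 0) - poly_len v k / poly_len v m"

text \<open>The two alternatives in \<open>chord_arc\<close> concern the two arcs into which the
  vertices \<open>k\<close> and \<open>l\<close> divide the polygon.\<close>

locale chord_arc_polygon =
  fixes v :: "nat \<Rightarrow> real^2" and m :: nat and A c h :: real
  assumes m: "0 < m" and closed: "v m = v 0" and A: "1 \<le> A" and c: "0 < c" "c \<le> 1" and h: "0 < h"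
    and edge_ge: "\<And>k. k < m \<Longrightarrow> c * h \<le> dist (v k) (v (Suc k))"
    and chord_arc: "\<And>k l. k < l \<Longrightarrow> l < m \<Longrightarrow>
       poly_len v l - poly_len v k \<le> A * dist (v k) (v l) \<or>
       poly_len v m - (poly_len v l - poly_len v k) \<le> A * dist (v k) (v l)"
begin

abbreviation "len \<equiv> poly_len v"

lemma ch: "0 < c * h" using c h by simp

lemma len_ge: "k \<le> l \<Longrightarrow> l \<le> m \<Longrightarrow> c * h * real (l - k) \<le> len l - len k"
  by (rule poly_len_ge) (auto intro: edge_ge)

lemma len_pos: "0 < len m"
proof -
  have "0 < c * h * real m" using ch m by simp
  with len_ge[of 0 m] show ?thesis by simp
qed

lemma dist_le_len: "k \<le> m \<Longrightarrow> l \<le> m \<Longrightarrow> dist (v k) (v l) \<le> len m"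
proof (induction k l rule: linorder_wlog)
  case (le a b)
  then show ?case using dist_le_poly_len[of a b v] poly_len_mono[of b m v] poly_len_nonneg[of v a] by linarith
qed (simp add: dist_commute)

lemma sawtooth_bound: "k \<le> m \<Longrightarrow> \<bar>sawtooth v m j k\<bar> \<le> 1"
proof -
  assume "k \<le> m"
  then have "0 \<le> len k / len m" "len k / len m \<le> 1"
    using len_pos poly_len_nonneg[of v k] poly_len_mono[of k m v] by auto
  then show ?thesis by (auto simp: sawtooth_def)
qed

text \<open>The second term on the right does not involve \<open>j\<close>. It therefore cancels in
  linear combinations over \<open>j\<close> whose coefficients sum to zero.\<close>

lemma sawtooth_Suc:
  assumes "k < m" "j < m"
  shows "sawtooth v m j (Suc k mod m) - sawtooth v m j k = (if k = j then 1 else 0) - dist (v k) (v (Suc k)) / len m"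
proof (cases "Suc k = m")
  case True
  have "len k = len m - dist (v k) (v (Suc k))" using poly_len_Suc[of v k] True by simp
  then show ?thesis using assms True len_pos by (auto simp: sawtooth_def diff_divide_distrib)
next
  case False
  then have "Suc k mod m = Suc k" using assms by simp
  then show ?thesis by (auto simp: sawtooth_def poly_len_Suc add_divide_distrib)
qed

text \<open>The two summands serve the two cases in the proof of
  \<open>sawtooth_diff\<close>.\<close>

definition saw_const :: real where
  "saw_const = 2 * (2 + A + A / c) + A * (2 + 1 / c)"

lemma saw_const_ge: "2 * (2 + A + A / c) \<le> saw_const" "A * (2 + 1 / c) \<le> saw_const" "0 < saw_const"
  using A c by (auto simp: saw_const_def add_pos_pos)

text \<open>If the shorter arc between the vertices \<open>k\<close> and \<open>l\<close> avoids
  edge \<open>j\<close>, the difference is the length of this arc divided by the length of the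
  polygon. If the arc contains edge \<open>j\<close>, then the distance of the two vertices
  dominates their distances to \<open>v j\<close> and also \<open>h\<close>, so that the fraction is
  bounded below while the difference is at most two.\<close>

lemma sawtooth_diff:
  assumes k: "k < m" and l: "l < m" and j: "j < m"
  shows "\<bar>sawtooth v m j k - sawtooth v m j l\<bar>
     \<le> saw_const * (dist (v k) (v l) / (dist (v k) (v l) + dist (v l) (v j) + h))"
proof (cases "k = l")
  case False
  define d where "d = dist (v k) (v l)"
  define L where "L = len m"
  define q where "q = \<bar>len l - len k\<bar>"
  have L0: "L > 0" using len_pos by (simp add: L_def)
  have q_ge: "c * h \<le> q" "c * h \<le> L - q"
  proof -
    have *: "c * h \<le> len b - len a \<and> c * h \<le> len m - (len b - len a)" if "a < b" "b < m" for a b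
    proof
      have "c * h * 1 \<le> c * h * real (b - a)" using that ch by (intro mult_left_mono) auto
      then show "c * h \<le> len b - len a" using len_ge[of a b] that by simp
      have "c * h * 1 \<le> c * h * real (m - b)" using that ch by (intro mult_left_mono) auto
      then show "c * h \<le> len m - (len b - len a)"
        using len_ge[of b m] that poly_len_nonneg[of v a] by simp
    qed
    consider "k < l" | "l < k" using False by linarith
    then show "c * h \<le> q" "c * h \<le> L - q"
      using *[of k l] *[of l k] k l poly_len_mono[of k l v] poly_len_mono[of l k v]
      by (cases; simp add: q_def L_def abs_if)+
  qed
  have d_le: "d \<le> L" using dist_le_len k l by (simp add: d_def L_def)
  have y_le: "dist (v l) (v j) \<le> L" using dist_le_len j l by (simp add: L_def)
  have h_le: "h \<le> L / c"
    using q_ge ch c by (simp add: field_simps)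
  have ca: "q \<le> A * d \<or> L - q \<le> A * d"
  proof -
    consider "k < l" | "l < k" using False by linarith
    then show ?thesis
      using chord_arc[of k l] chord_arc[of l k] k l poly_len_mono[of k l v] poly_len_mono[of l k v]
      by cases (auto simp: q_def d_def L_def dist_commute)
  qed
  have d0: "d > 0"
  proof (rule ccontr)
    assume "\<not> d > 0"
    then have "d = 0" by (simp add: d_def)
    then show False using ca q_ge ch by auto
  qed
  define Y where "Y = dist (v l) (v j)"
  have D0: "d + Y + h > 0" using d0 h by (simp add: Y_def add_pos_nonneg)
  \<comment> \<open>The short arc avoids edge \<open>j\<close>.\<close>
  have near: ?thesis if "\<bar>sawtooth v m j k - sawtooth v m j l\<bar> * L \<le> A * d"
  proof -
    have "d + Y + h \<le> L * (2 + 1 / c)" using d_le y_le h_le by (simp add: Y_def algebra_simps)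
    then have "A * d * (d + Y + h) \<le> A * d * (L * (2 + 1 / c))"
      using d0 A by (intro mult_left_mono) auto
    also have "\<dots> = (A * (2 + 1 / c)) * (d * L)" by (simp add: algebra_simps)
    also have "\<dots> \<le> saw_const * (d * L)" using saw_const_ge(2) d0 L0 by (intro mult_right_mono) auto
    finally have "A * d * (d + Y + h) \<le> saw_const * d * L" by simp
    moreover have "\<bar>sawtooth v m j k - sawtooth v m j l\<bar> * L * (d + Y + h) \<le> A * d * (d + Y + h)"
      using that D0 by (intro mult_right_mono) auto
    ultimately have "(\<bar>sawtooth v m j k - sawtooth v m j l\<bar> * (d + Y + h)) * L \<le> (saw_const * d) * L"
      by (simp add: mult_ac)
    then have "\<bar>sawtooth v m j k - sawtooth v m j l\<bar> * (d + Y + h) \<le> saw_const * d"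
      using L0 by simp
    then show ?thesis using D0 by (simp add: d_def Y_def pos_le_divide_eq)
  qed
  \<comment> \<open>The short arc contains edge \<open>j\<close>, so that both ends are close to \<open>v j\<close>.\<close>
  have far: ?thesis if "Y \<le> (1 + A) * d" "c * h \<le> A * d"
  proof -
    have "h \<le> A / c * d" using that(2) c by (simp add: field_simps)
    then have "d + Y + h \<le> (2 + A + A / c) * d" using that(1) by (simp add: algebra_simps)
    then have "2 * (d + Y + h) \<le> (2 * (2 + A + A / c)) * d"
      unfolding mult.assoc by (intro mult_left_mono) auto
    also have "\<dots> \<le> saw_const * d" using d0 by (intro mult_right_mono saw_const_ge(1)) auto
    finally have "2 * (d + Y + h) \<le> saw_const * d" .
    then have "2 \<le> saw_const * (d / (d + Y + h))" using D0 by (simp add: pos_le_divide_eq)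
    moreover have "\<bar>sawtooth v m j k - sawtooth v m j l\<bar> \<le> 2"
      using sawtooth_bound[of k j] sawtooth_bound[of l j] k l by linarith
    ultimately show ?thesis by (simp add: d_def Y_def)
  qed
  have saw: "\<bar>sawtooth v m j k - sawtooth v m j l\<bar> * L = 
     (if (j < k) = (j < l) then q else L - q)"
  proof -
    have "(sawtooth v m j k - sawtooth v m j l) * L = ((if j < k then 1 else 0) - (if j < l then 1 else 0)) * L + (len l - len k)"
      using L0 by (simp add: sawtooth_def L_def left_diff_distrib)
    moreover have "\<bar>sawtooth v m j k - sawtooth v m j l\<bar> * L = \<bar>(sawtooth v m j k - sawtooth v m j l) * L\<bar>"
      using L0 by (simp add: abs_mult)
    moreover have "\<bar>L + (len l - len k)\<bar> = L - q" if "j < k" "\<not> j < l"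
      using that poly_len_mono[of l k v] poly_len_mono[of k m v] poly_len_nonneg[of v l] k by (simp add: q_def L_def)
    moreover have "\<bar>- L + (len l - len k)\<bar> = L - q" if "j < l" "\<not> j < k"
      using that poly_len_mono[of k l v] poly_len_mono[of l m v] poly_len_nonneg[of v k] l by (simp add: q_def L_def)
    ultimately show ?thesis by (auto simp: q_def)
  qed
  have tri: "Y \<le> dist (v k) (v j) + d"
    using dist_triangle[of "v l" "v j" "v k"] by (simp add: Y_def d_def dist_commute)
  show ?thesis
  proof (cases "q \<le> A * d")
    case True
    show ?thesis
    proof (cases "(j < k) = (j < l)")
      case True
      then show ?thesis using near saw \<open>q \<le> A * d\<close> by simp
    next
      case False
      have "Y \<le> q \<or> dist (v k) (v j) \<le> q"
      proof (cases "j < k")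
        case True
        then have "l \<le> j" using False by auto
        then have "Y \<le> len k - len l"
          using dist_le_poly_len[of l j v] poly_len_mono[of j k v] True by (simp add: Y_def)
        then show ?thesis unfolding q_def by (intro disjI1) linarith
      next
        case nk: False
        then have "j < l" "k \<le> j" using False by auto
        then have "dist (v k) (v j) \<le> len l - len k"
          using dist_le_poly_len[of k j v] poly_len_mono[of j l v] by simp
        then show ?thesis unfolding q_def by (intro disjI2) linarith
      qed
      then have "Y \<le> q + d" using tri d0 by linarith
      then show ?thesis using far True q_ge by (simp add: algebra_simps)
    qed
  next
    case nq: False
    then have cq: "L - q \<le> A * d" using ca by auto
    show ?thesis
    proof (cases "(j < k) = (j < l)")
      case False
      then show ?thesis using near saw cq by simp
    next
      case True
      have "Y \<le> L - q \<or> dist (v k) (v j) \<le> L - q"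
      proof (cases "j < k")
        case jk: True
        then have jl: "j < l" using True by auto
        show ?thesis
        proof (cases "k \<le> l")
          case True
          then show ?thesis using dist_le_poly_len[of j k v] jk poly_len_mono[of l m v] poly_len_mono[of k l v] l poly_len_nonneg[of v j]
            by (simp add: Y_def q_def L_def dist_commute)
        next
          case False
          then show ?thesis using dist_le_poly_len[of j l v] jl poly_len_mono[of k m v] poly_len_mono[of l k v] k poly_len_nonneg[of v j]
            by (simp add: Y_def q_def L_def dist_commute)
        qed
      next
        case jk: False
        then have jl: "\<not> j < l" using True by auto
        show ?thesis
        proof (cases "k \<le> l")
          case True
          then show ?thesis using dist_le_poly_len[of l j v] jl poly_len_mono[of j m v] poly_len_mono[of k l v] j poly_len_nonneg[of v k]
            by (simp add: Y_def q_def L_def dist_commute)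
        next
          case False
          then show ?thesis using dist_le_poly_len[of k j v] jk poly_len_mono[of j m v] poly_len_mono[of l k v] j poly_len_nonneg[of v l]
            by (simp add: Y_def q_def L_def dist_commute)
        qed
      qed
      then have "Y \<le> L - q + d" using tri d0 by linarith
      then show ?thesis using far cq q_ge by (simp add: algebra_simps)
    qed
  qed
qed simp

text \<open>Let \<open>v j0\<close> be nearest to \<open>x\<close>. Then \<open>v j\<close> is at
  least half as far from \<open>x\<close> as from \<open>v j0\<close>, and by the chord-arc property
  the latter distance dominates \<open>h\<close> times the cyclic distance of the indices
  \<open>j\<close> and \<open>j0\<close>. What remains is twice a sum of powers \<open>-2/3\<close>
  for either direction around the polygon.\<close>

lemma sum_inverse_dist:
  "(\<Sum>j<m. h * (dist x (v j) + h) powr (-2/3)) \<le> 12 * (2 * A / c) powr (2/3) * (len m / c) powr (1/3)"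
proof -
  obtain j0 where j0: "j0 < m" "\<And>j. j < m \<Longrightarrow> dist x (v j0) \<le> dist x (v j)"
  proof -
    let ?S = "(\<lambda>j. dist x (v j)) ` {..<m}"
    have "Min ?S \<in> ?S" using m by (intro Min_in) auto
    then obtain j0 where "j0 < m" "dist x (v j0) = Min ?S" by auto
    then show ?thesis using that[of j0] by simp
  qed
  define g where "g = (\<lambda>k::nat. (real k + 1) powr (-2/3))"
  define \<delta> where "\<delta> = (\<lambda>j. nat \<bar>int j - int j0\<bar>)"
  \<comment> \<open>The factor 2 comes from the choice of \<open>j0\<close>, the factor \<open>A\<close> from the chord-arc property.\<close>
  define b where "b = c * h / (2 * A)"
  have b0: "b > 0" using ch A by (simp add: b_def)
  have b_le: "b \<le> h" using A c h by (simp add: b_def field_simps mult_mono)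
  have low: "b * (real (\<delta> j) + 1) \<le> dist x (v j) + h \<or> b * (real (m - \<delta> j) + 1) \<le> dist x (v j) + h"
    if j: "j < m" for j
  proof -
    define D where "D = dist x (v j)"
    define a b' where "a = min j j0" and "b' = max j j0"
    have ab: "a \<le> b'" "b' < m" using j j0 by (auto simp: a_def b'_def)
    have \<delta>: "\<delta> j = b' - a" by (auto simp: \<delta>_def a_def b'_def min_def max_def)
    have dd: "dist (v a) (v b') \<le> 2 * D"
      using dist_triangle2[of "v j" "v j0" x] j0(2)[OF j]
      by (auto simp: a_def b'_def D_def min_def max_def dist_commute)
    have ca: "len b' - len a \<le> A * (2 * D) \<or> len m - (len b' - len a) \<le> A * (2 * D)"
    proof (cases "a = b'")
      case True
      then show ?thesis using A by (simp add: D_def)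
    next
      case False
      then have "len b' - len a \<le> A * dist (v a) (v b') \<or> len m - (len b' - len a) \<le> A * dist (v a) (v b')"
        using chord_arc[of a b'] ab by simp
      moreover have "A * dist (v a) (v b') \<le> A * (2 * D)" using dd A by (intro mult_left_mono) auto
      ultimately show ?thesis by linarith
    qed
    have 1: "c * h * real (\<delta> j) \<le> len b' - len a" using len_ge[of a b'] ab \<delta> by simp
    have 2: "c * h * real (m - \<delta> j) \<le> len m - (len b' - len a)"
    proof -
      have "m - \<delta> j = (m - b') + (a - 0)" using ab \<delta> by simp
      then have "c * h * real (m - \<delta> j) = c * h * real (m - b') + c * h * real (a - 0)"
        by (simp only: of_nat_add distrib_left)
      then show ?thesis using len_ge[of b' m] len_ge[of 0 a] ab by simp
    qed
    have *: "b * (real n + 1) \<le> D + h" if "c * h * real n \<le> A * (2 * D)" for n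
    proof -
      have "b * real n \<le> D" using that A by (simp add: b_def field_simps)
      then show ?thesis using b_le by (simp add: algebra_simps)
    qed
    show ?thesis using ca 1 2 *[of "\<delta> j"] *[of "m - \<delta> j"] unfolding D_def by linarith
  qed
  have summand: "(dist x (v j) + h) powr (-2/3) \<le> b powr (-2/3) * (g (\<delta> j) + g (m - \<delta> j))" if j: "j < m" for j
  proof -
    have *: "(dist x (v j) + h) powr (-2/3) \<le> b powr (-2/3) * g n" if "b * (real n + 1) \<le> dist x (v j) + h" for n
    proof -
      have "(dist x (v j) + h) powr (-2/3) \<le> (b * (real n + 1)) powr (-2/3)"
        using that b0 by (intro powr_mono2') auto
      then show ?thesis using b0 by (simp add: g_def powr_mult)
    qed
    have "0 \<le> b powr (-2/3) * g n" for n by (simp add: g_def)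
    then show ?thesis using low[OF j] *[of "\<delta> j"] *[of "m - \<delta> j"]
      by (smt (verit) distrib_left)
  qed
  have S1: "(\<Sum>j<m. g (\<delta> j)) \<le> 6 * real m powr (1/3)"
  proof -
    have "(\<Sum>j<m. g (\<delta> j)) \<le> 2 * (\<Sum>k<m. g k)"
      unfolding \<delta>_def by (rule sum_abs_shift_le) (auto simp: g_def j0)
    then show ?thesis using sum_powr_two_thirds[of m] unfolding g_def by linarith
  qed
  have S2: "(\<Sum>j<m. g (m - \<delta> j)) \<le> 6 * real m powr (1/3)"
  proof -
    have "(\<Sum>j<m. g (m - \<delta> j)) \<le> 2 * (\<Sum>k<m. g (m - k))"
      unfolding \<delta>_def by (rule sum_abs_shift_le[where g = "\<lambda>k. g (m - k)"]) (auto simp: g_def j0)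
    also have "(\<Sum>k<m. g (m - k)) = (\<Sum>k<m. g (Suc k))"
      by (subst sum.nat_diff_reindex[symmetric]) (auto intro!: sum.cong simp: Suc_diff_Suc)
    also have "\<dots> \<le> (\<Sum>k<m. g k)"
      by (intro sum_mono) (auto simp: g_def intro!: powr_mono2')
    finally show ?thesis using sum_powr_two_thirds[of m] unfolding g_def by linarith
  qed
  have "(\<Sum>j<m. h * (dist x (v j) + h) powr (-2/3)) \<le> (\<Sum>j<m. h * (b powr (-2/3) * (g (\<delta> j) + g (m - \<delta> j))))"
    using summand h by (intro sum_mono mult_left_mono) auto
  also have "\<dots> = h * b powr (-2/3) * ((\<Sum>j<m. g (\<delta> j)) + (\<Sum>j<m. g (m - \<delta> j)))"
    by (simp only: sum.distrib[symmetric] sum_distrib_left mult.assoc)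
  also have "\<dots> \<le> h * b powr (-2/3) * (12 * real m powr (1/3))"
    using S1 S2 h by (intro mult_left_mono) auto
  also have "\<dots> \<le> h * b powr (-2/3) * (12 * (len m / (c * h)) powr (1/3))"
  proof -
    have "real m \<le> len m / (c * h)" using len_ge[of 0 m] ch by (simp add: field_simps)
    then show ?thesis using h by (intro mult_left_mono powr_mono2) auto
  qed
  also have "\<dots> = 12 * (2 * A / c) powr (2/3) * (len m / c) powr (1/3)"
  proof -
    have bb: "b = inverse (2 * A / c) * h" using A c by (simp add: b_def field_simps)
    have l: "len m / (c * h) = (len m / c) * inverse h" by (simp add: field_simps)
    have "b powr (-2/3) = (2 * A / c) powr (2/3) * h powr (-2/3)"
      unfolding bb using A c h by (subst powr_mult) (auto simp: powr_minus inverse_powr[symmetric])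
    moreover have "(len m / (c * h)) powr (1/3) = (len m / c) powr (1/3) * h powr (-1/3)"
      unfolding l using len_pos c h by (subst powr_mult) (auto simp: powr_minus inverse_powr[symmetric])
    moreover have "h * (h powr (-2/3) * h powr (-1/3)) = 1"
    proof -
      have "h powr (-2/3) * h powr (-1/3) = h powr (-1)" by (simp add: powr_add[symmetric])
      then show ?thesis using h by (simp add: powr_minus)
    qed
    ultimately show ?thesis by (simp add: mult_ac) 
  qed
  finally show ?thesis .
qed

end

text \<open>McShane's extension formula \<open>inf (f b + M * dist x b)\<close>, in which the
  distance is replaced by a bounded function of it. The slope of the replacement at \<open>x\<close>
  is at most \<open>1 / (dist x y + h)\<close> whatever \<open>b\<close> is, so the extension may
  vary by order one near \<open>y\<close> and is flat far from \<open>y\<close>.\<close>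

definition cone_ext :: "real \<Rightarrow> real \<Rightarrow> (real^2) set \<Rightarrow> (real^2 \<Rightarrow> real) \<Rightarrow> real^2 \<Rightarrow> real^2 \<Rightarrow> real" where
  "cone_ext M h B f y x = Min ((\<lambda>b. f b + M * (dist x b / (dist x b + dist b y + h))) ` B)"

lemma cone_ext_eq:
  assumes "finite B" "a \<in> B" "0 < h"
    and "\<And>b. b \<in> B \<Longrightarrow> f a \<le> f b + M * (dist a b / (dist a b + dist b y + h))"
  shows "cone_ext M h B f y a = f a"
  unfolding cone_ext_def
proof (rule Min_eqI)
  show "f a \<in> (\<lambda>b. f b + M * (dist a b / (dist a b + dist b y + h))) ` B"
    using assms(2) by (intro image_eqI[of _ _ a]) auto
qed (use assms in auto)

text \<open>The function \<open>s / (s + k)\<close> of \<open>s = dist x b\<close>, where \<open>k =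
  dist b y + h\<close>, has slope at most \<open>1 / (s + k)\<close>, and \<open>s + k \<ge> dist x
  y + h\<close> by the triangle inequality.\<close>

lemma cone_profile_diff:
  fixes x x' b y :: "real^2"
  assumes "0 < h"
  shows "dist x' b / (dist x' b + dist b y + h) \<le> dist x b / (dist x b + dist b y + h) + dist x x' / (dist x y + h)"
proof -
  define t t' k where "t = dist x b" and "t' = dist x' b" and "k = dist b y + h"
  have k: "k > 0" "t \<ge> 0" "t' \<ge> 0" using assms by (auto simp: k_def t_def t'_def add_nonneg_pos)
  have tt: "t' - t \<le> dist x x'"
    using dist_triangle3[of x' b x] by (simp add: t_def t'_def dist_commute)
  have tk: "dist x y + h \<le> t + k" using dist_triangle[of x y b] by (simp add: t_def k_def)
  have xy: "dist x y + h > 0" using assms by (simp add: add_nonneg_pos)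
  have "t' / (t' + k) - t / (t + k) = (k / (t' + k)) * ((t' - t) / (t + k))"
    using k by (simp add: field_simps add_nonneg_pos add_pos_nonneg divide_simps) (simp add: algebra_simps add_nonneg_eq_0_iff)?
  also have "\<dots> \<le> 1 * (dist x x' / (dist x y + h))"
  proof (cases "t' \<ge> t")
    case True
    then show ?thesis using k tt tk xy
      by (intro mult_mono frac_le) (auto simp: divide_simps)
  next
    case False
    then have "(k / (t' + k)) * ((t' - t) / (t + k)) \<le> 0"
      using k by (intro mult_nonneg_nonpos divide_nonpos_pos) auto
    also have "0 \<le> 1 * (dist x x' / (dist x y + h))" using xy by simp
    finally show ?thesis .
  qed
  finally show ?thesis by (simp add: t_def t'_def k_def add.assoc)
qed

lemma cone_ext_diff:
  assumes "finite B" "B \<noteq> {}" "0 < h" "0 \<le> M"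
  shows "cone_ext M h B f y x' \<le> cone_ext M h B f y x + M * (dist x x' / (dist x y + h))"
proof -
  let ?F = "\<lambda>x b. f b + M * (dist x b / (dist x b + dist b y + h))"
  obtain b where b: "b \<in> B" "cone_ext M h B f y x = ?F x b"
  proof -
    have "cone_ext M h B f y x \<in> ?F x ` B" unfolding cone_ext_def using assms by (intro Min_in) auto
    then show ?thesis using that by auto
  qed
  have "cone_ext M h B f y x' \<le> ?F x' b"
    unfolding cone_ext_def using b assms by (intro Min_le) auto
  also have "\<dots> \<le> f b + M * (dist x b / (dist x b + dist b y + h) + dist x x' / (dist x y + h))"
    using cone_profile_diff[OF assms(3)] assms(4) by (intro add_left_mono mult_left_mono) auto
  finally show ?thesis using b by (simp add: distrib_left)
qed

section \<open>Lipschitz boundaries are chord-arc curves\<close>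

text \<open>A chart describes \<open>D\<close> itself. Its points below the graph are outside the
  closure of \<open>D\<close> because they form an open set disjoint from \<open>D\<close>; points
  of the graph are limits of points above it.\<close>

lemma epigraph_chart:
  assumes D: "lipschitz_domain D" and z: "z \<in> frontier D"
  obtains R R' :: "real^2 \<Rightarrow> real^2" and g L r
  where "linear R" "linear R'" "\<And>x. R (R' x) = x" "\<And>x. R' (R x) = x" "\<And>x. norm (R x) = norm x"
    "\<And>x. norm (R' x) = norm x" "L-lipschitz_on UNIV g" "0 < r" "g 0 = 0"
    "\<And>y. y \<in> ball 0 r \<Longrightarrow> z + R y \<in> frontier D \<longleftrightarrow> y$2 = g (y$1)"
    "\<And>y. y \<in> ball 0 r \<Longrightarrow> y$2 < g (y$1) \<Longrightarrow> z + R y \<notin> closure D"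
proof -
  have opn: "open D" using D by (simp add: lipschitz_domain_def)
  obtain R :: "real^2 \<Rightarrow> real^2" and g :: "real \<Rightarrow> real" and L r
    where R: "orthogonal_transformation R" and g: "L-lipschitz_on UNIV g" and r: "0 < r"
      and epi: "\<And>y. y \<in> ball 0 r \<Longrightarrow> z + R y \<in> D \<longleftrightarrow> g (y$1) < y$2"
    using D z unfolding lipschitz_domain_def by metis
  define R' where "R' = inv R"
  have lin: "linear R" and nR: "norm (R x) = norm x" for x
    using R by (auto simp: orthogonal_transformation)
  have bij: "bij R" using R by (rule orthogonal_transformation_bij)
  have RR': "R (R' x) = x" "R' (R x) = x" for x
    using bij by (simp_all add: R'_def bij_is_surj surj_f_inv_f bij_is_inj)
  have lin': "linear R'" using lin bij unfolding R'_def
    by (metis R orthogonal_transformation_inv orthogonal_transformation_linear)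
  have nR': "norm (R' x) = norm x" for x using nR[of "R' x"] RR' by simp
  have cg: "continuous_on UNIV g" using g by (rule lipschitz_on_continuous_on)
  have cR': "continuous_on UNIV R'" using lin' by (rule linear_continuous_on_compose[OF continuous_on_id, simplified])
  have cR: "continuous_on UNIV R" using lin by (rule linear_continuous_on_compose[OF continuous_on_id, simplified])
  have fr: "frontier D = closure D - D" using opn by (simp add: frontier_def interior_open)
  have below: "z + R y \<notin> closure D" if y: "y \<in> ball 0 r" "y$2 < g (y$1)" for y
  proof -
    let ?W = "{x. norm (R' (x - z)) < r \<and> (R' (x - z))$2 < g ((R' (x - z))$1)}"
    have c: "continuous_on UNIV (\<lambda>x. R' (x - z))"
      by (rule continuous_on_compose2[OF cR']) (auto intro!: continuous_intros)
    have "open ?W"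
      by (intro open_Collect_conj open_Collect_less continuous_intros c continuous_on_compose2[OF cg]) auto
    moreover have "?W \<inter> D = {}"
    proof (intro equals0I)
      fix x assume "x \<in> ?W \<inter> D"
      then have "z + R (R' (x - z)) \<in> D" "R' (x - z) \<in> ball 0 r" "(R' (x - z))$2 < g ((R' (x - z))$1)"
        by (auto simp: RR')
      then show False using epi by fastforce
    qed
    ultimately have "?W \<inter> closure D = {}" by (simp add: open_Int_closure_eq_empty)
    moreover have "z + R y \<in> ?W" using y by (simp add: RR')
    ultimately show ?thesis by blast
  qed
  have iff: "z + R y \<in> frontier D \<longleftrightarrow> y$2 = g (y$1)" if y: "y \<in> ball 0 r" for y
  proof
    assume "z + R y \<in> frontier D"
    then show "y$2 = g (y$1)" using below[OF y] epi[OF y] fr by fastforce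
  next
    assume eq: "y$2 = g (y$1)"
    have "\<exists>x\<in>D. dist x (z + R y) < e" if "e > 0" for e
    proof -
      define d where "d = min (e/2) ((r - norm y)/2)"
      have d: "d > 0" "d < e" "norm y + d < r" using that y by (auto simp: d_def min_def field_simps)
      let ?y = "y + axis 2 d"
      have nd: "norm (axis 2 d :: real^2) = d" using d by (simp add: norm_vec_def L2_set_def sum_2 axis_def)
      have yb: "?y \<in> ball 0 r" using norm_triangle_ineq[of y "axis 2 d"] d nd by simp
      have "z + R ?y \<in> D" using epi[OF yb] eq d by (simp add: axis_def)
      moreover have "dist (z + R ?y) (z + R y) < e"
        using nR[of "axis 2 d"] nd d by (simp add: dist_norm linear_add[OF lin])
      ultimately show ?thesis by blast
    qed
    then have "z + R y \<in> closure D" by (simp add: closure_approachable)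
    moreover have "z + R y \<notin> D" using epi[OF y] eq by simp
    ultimately show "z + R y \<in> frontier D" using fr by simp
  qed
  have "g 0 = 0" using iff[of 0] z r by (simp add: linear_0[OF lin])
  with that[OF lin lin' RR' nR nR' g r _ iff below] show thesis by blast
qed

text \<open>Below the graph, the exterior of \<open>D\<close> comes arbitrarily close to each
  boundary point; in particular \<open>D\<close> has no slits.\<close>

lemma frontier_Int_interior_closure:
  assumes D: "lipschitz_domain D"
  shows "frontier D \<inter> interior (closure D) = {}"
proof (intro equals0I)
  fix z assume z: "z \<in> frontier D \<inter> interior (closure D)"
  then have zf: "z \<in> frontier D" by auto
  obtain R R' g L r where ch: "linear R" "\<And>x. norm (R x) = norm x" "0 < r" "g 0 = 0"
    "\<And>y::real^2. y \<in> ball 0 r \<Longrightarrow> y$2 < g (y$1) \<Longrightarrow> z + R y \<notin> closure D"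
    by (rule epigraph_chart[OF D zf]) metis
  from z obtain e where e: "e > 0" "ball z e \<subseteq> closure D" by (auto simp: mem_interior)
  define d where "d = min (e/2) (r/2)"
  have d: "d > 0" "d < e" "d < r" using e ch by (auto simp: d_def)
  let ?y = "axis 2 (-d) :: real^2"
  have n: "norm ?y = d" using d by (simp add: norm_vec_def L2_set_def sum_2 axis_def)
  have "z + R ?y \<notin> closure D" using n d ch by (intro ch(5)) (auto simp: axis_def)
  moreover have "z + R ?y \<in> ball z e" using n d ch(2)[of ?y] by (simp add: dist_norm)
  ultimately show False using e by blast
qed

text \<open>\<open>S\<close> is the part of the graph between \<open>a\<close> and \<open>b\<close>,
  and \<open>u\<close> is the coordinate along the axis over which the boundary is a graph.\<close>

lemma frontier_local_graph:
  assumes D: "lipschitz_domain D" and z: "z \<in> frontier D"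
  obtains \<rho> M where "0 < \<rho>" "1 \<le> M"
    "\<And>a b. a \<in> frontier D \<inter> ball z \<rho> \<Longrightarrow> b \<in> frontier D \<inter> ball z \<rho> \<Longrightarrow>
       \<exists>S u. S \<subseteq> frontier D \<and> connected S \<and> a \<in> S \<and> b \<in> S \<and>
         (\<forall>x y. \<bar>u x - u y\<bar> \<le> dist x y) \<and> (\<forall>x\<in>S. \<forall>y\<in>S. dist x y \<le> M * \<bar>u x - u y\<bar>)"
proof -
  obtain R R' g L r where lin: "linear R" "linear R'" and RR': "\<And>x::real^2. R (R' x) = x" "\<And>x::real^2. R' (R x) = x"
    and n: "\<And>x. norm (R x) = norm x" "\<And>x. norm (R' x) = norm x"
    and g: "L-lipschitz_on UNIV g" and r: "0 < r" and g0: "g 0 = 0"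
    and iff: "\<And>y. y \<in> ball 0 r \<Longrightarrow> z + R y \<in> frontier D \<longleftrightarrow> y$2 = g (y$1)"
    by (rule epigraph_chart[OF D z]) metis
  have L: "L \<ge> 0" using g by (rule lipschitz_on_nonneg)
  have gL: "\<bar>g s - g t\<bar> \<le> L * \<bar>s - t\<bar>" for s t
    using lipschitz_onD[OF g, of s t] by (simp add: dist_real_def)
  define \<rho> where "\<rho> = r / (1 + L)"
  have \<rho>: "\<rho> > 0" "(1 + L) * \<rho> = r" "\<rho> \<le> r" using r L by (auto simp: \<rho>_def field_simps)
  define u where "u = (\<lambda>x. (R' (x - z)) $ 1)"
  define G where "G = (\<lambda>s. z + R (vector [s, g s]))"
  have uG: "u (G s) = s" for s by (simp add: u_def G_def RR')
  have nv: "norm (vector [s, t] :: real^2) \<le> \<bar>s\<bar> + \<bar>t\<bar>" for s t :: real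
    using norm_le_l1_cart[of "vector [s,t] :: real^2"] by (simp add: sum_2)
  have dG: "dist (G s) (G t) \<le> (1 + L) * \<bar>s - t\<bar>" for s t
  proof -
    have "G s - G t = R (vector [s - t, g s - g t])"
    proof -
      have "G s - G t = R (vector [s, g s] - vector [t, g t])" by (simp add: G_def linear_diff[OF lin(1)])
      also have "vector [s, g s] - vector [t, g t] = (vector [s - t, g s - g t] :: real^2)"
        by (simp add: vec_eq_iff forall_2)
      finally show ?thesis .
    qed
    then have "dist (G s) (G t) = norm (vector [s - t, g s - g t] :: real^2)" by (simp add: dist_norm n)
    also have "\<dots> \<le> \<bar>s - t\<bar> + \<bar>g s - g t\<bar>" by (rule nv)
    also have "\<dots> \<le> (1 + L) * \<bar>s - t\<bar>" using gL[of s t] by (simp add: algebra_simps)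
    finally show ?thesis .
  qed
  have u1: "\<bar>u x - u y\<bar> \<le> dist x y" for x y
  proof -
    have "u x - u y = (R' (x - y)) $ 1" by (simp add: u_def linear_diff[OF lin(2)] algebra_simps)
    then show ?thesis using component_le_norm_cart[of "R' (x - y)" 1] by (simp add: n dist_norm)
  qed
  have Gfr: "G s \<in> frontier D" if "\<bar>s\<bar> < \<rho>" for s
  proof -
    have "norm (vector [s, g s] :: real^2) \<le> (1 + L) * \<bar>s\<bar>"
      using nv[of s "g s"] gL[of s 0] g0 by (simp add: algebra_simps)
    also have "\<dots> < (1 + L) * \<rho>" using that L by (intro mult_strict_left_mono) auto
    finally show ?thesis unfolding G_def using \<rho>(2) by (subst iff) auto
  qed
  have pt: "x = G (u x) \<and> \<bar>u x\<bar> < \<rho>" if x: "x \<in> frontier D \<inter> ball z \<rho>" for x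
  proof
    let ?y = "R' (x - z)"
    have "norm ?y < \<rho>" using x by (simp add: n dist_norm norm_minus_commute)
    then have yb: "?y \<in> ball 0 r" using \<rho> by simp
    have "z + R ?y \<in> frontier D" using x by (simp add: RR')
    then have "?y$2 = g (?y$1)" using iff[OF yb] by simp
    then have "?y = vector [u x, g (u x)]" by (simp add: u_def vec_eq_iff forall_2)
    then have "G (u x) = z + R ?y" by (simp add: G_def)
    then show "x = G (u x)" by (simp add: RR')
    show "\<bar>u x\<bar> < \<rho>" using component_le_norm_cart[of ?y 1] \<open>norm ?y < \<rho>\<close> by (simp add: u_def)
  qed
  show thesis
  proof (rule that[of \<rho> "1 + L"])
    fix a b assume ab: "a \<in> frontier D \<inter> ball z \<rho>" "b \<in> frontier D \<inter> ball z \<rho>"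
    let ?S = "G ` closed_segment (u a) (u b)"
    have "?S \<subseteq> frontier D"
    proof (rule image_subsetI)
      fix s assume "s \<in> closed_segment (u a) (u b)"
      then have "\<bar>s\<bar> < \<rho>" using pt[OF ab(1)] pt[OF ab(2)]
        by (auto simp: closed_segment_eq_real_ivl split: if_splits)
      then show "G s \<in> frontier D" by (rule Gfr)
    qed
    moreover have "connected ?S"
    proof (rule connected_continuous_image)
      have "(1 + L)-lipschitz_on UNIV G"
        using L dG by (intro lipschitz_onI) (auto simp: dist_real_def)
      then show "continuous_on (closed_segment (u a) (u b)) G"
        using lipschitz_on_continuous_on continuous_on_subset by blast
    qed (rule connected_segment)
    moreover have "a \<in> ?S" "b \<in> ?S" using pt[OF ab(1)] pt[OF ab(2)] by (metis imageI ends_in_segment)+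
    moreover have "\<forall>x\<in>?S. \<forall>y\<in>?S. dist x y \<le> (1 + L) * \<bar>u x - u y\<bar>"
      using dG by (auto simp: uG)
    ultimately show "\<exists>S u. S \<subseteq> frontier D \<and> connected S \<and> a \<in> S \<and> b \<in> S \<and>
         (\<forall>x y. \<bar>u x - u y\<bar> \<le> dist x y) \<and> (\<forall>x\<in>S. \<forall>y\<in>S. dist x y \<le> (1 + L) * \<bar>u x - u y\<bar>)"
      using u1 by blast
  qed (use \<rho> L in auto)
qed

text \<open>Two turns around a loop, on \<open>{0..2}\<close>. Both arcs between two points of the
  loop are then images of intervals.\<close>

definition wrap :: "(real \<Rightarrow> real^2) \<Rightarrow> real \<Rightarrow> real^2" where
  "wrap g x = (if x \<le> 1 then g x else g (x - 1))"

text \<open>A bound for the length of an arc, stated in terms of the inscribed polygons of which the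
  length is the supremum.\<close>

definition arc_le :: "(real \<Rightarrow> real^2) \<Rightarrow> real \<Rightarrow> real \<Rightarrow> real \<Rightarrow> bool" where
  "arc_le w B s t \<longleftrightarrow> (\<forall>S k l. k \<le> l \<longrightarrow> (\<forall>i. k \<le> i \<and> i < l \<longrightarrow> S i \<le> S (Suc i)) \<longrightarrow> S k = s \<longrightarrow> S l = t \<longrightarrow>
      (\<Sum>i\<in>{k..<l::nat}. dist (w (S i)) (w (S (Suc i)))) \<le> B)"

lemma arc_le_mono:
  assumes "arc_le w B s t" "B \<le> B'" shows "arc_le w B' s t"
  unfolding arc_le_def
proof (intro allI impI)
  fix S and k l :: nat
  assume "k \<le> l" "\<forall>i. k \<le> i \<and> i < l \<longrightarrow> S i \<le> S (Suc i)" "S k = s" "S l = t"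
  then have "(\<Sum>i\<in>{k..<l}. dist (w (S i)) (w (S (Suc i)))) \<le> B"
    using assms(1) unfolding arc_le_def by blast
  then show "(\<Sum>i\<in>{k..<l}. dist (w (S i)) (w (S (Suc i)))) \<le> B'" using assms(2) by simp
qed

lemma chain_mono:
  fixes S :: "nat \<Rightarrow> real"
  assumes "\<And>i. k \<le> i \<Longrightarrow> i < l \<Longrightarrow> S i \<le> S (Suc i)" "k \<le> i" "i \<le> j" "j \<le> l"
  shows "S i \<le> S j"
  using assms(3,4)
proof (induction j rule: dec_induct)
  case (step n)
  then show ?case using assms(1)[of n] assms(2) by simp
qed simp

lemma arc_le_lipschitz:
  assumes "\<Lambda>-lipschitz_on {s..t} w"
  shows "arc_le w (\<Lambda> * (t - s)) s t"
  unfolding arc_le_def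
proof (intro allI impI)
  fix S and k l :: nat
  assume kl: "k \<le> l" and inc: "\<forall>i. k \<le> i \<and> i < l \<longrightarrow> S i \<le> S (Suc i)" and e: "S k = s" "S l = t"
  have inc': "\<And>i. k \<le> i \<Longrightarrow> i < l \<Longrightarrow> S i \<le> S (Suc i)" using inc by blast
  have rng: "S i \<in> {s..t}" if "k \<le> i" "i \<le> l" for i
    using chain_mono[of k l S k i] chain_mono[of k l S i l] inc' that e by auto
  have "(\<Sum>i\<in>{k..<l}. dist (w (S i)) (w (S (Suc i)))) \<le> (\<Sum>i\<in>{k..<l}. \<Lambda> * (S (Suc i) - S i))"
  proof (rule sum_mono)
    fix i assume "i \<in> {k..<l}"
    then show "dist (w (S i)) (w (S (Suc i))) \<le> \<Lambda> * (S (Suc i) - S i)"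
      using lipschitz_onD[OF assms rng rng, of i "Suc i"] inc'[of i] by (simp add: dist_real_def)
  qed
  also have "\<dots> = \<Lambda> * (\<Sum>i\<in>{k..<l}. S (Suc i) - S i)" by (simp add: sum_distrib_left)
  also have "(\<Sum>i\<in>{k..<l}. S (Suc i) - S i) = t - s" using sum_Suc_diff'[OF kl, of S] e by simp
  finally show "(\<Sum>i\<in>{k..<l}. dist (w (S i)) (w (S (Suc i)))) \<le> \<Lambda> * (t - s)" .
qed

text \<open>Along the arc the coordinate \<open>u\<close> is continuous and injective, hence
  monotone. The lengths of the chords are controlled by the increments of \<open>u\<close>, which
  telescope.\<close>

lemma arc_le_graph:
  fixes u :: "real^2 \<Rightarrow> real"
  assumes w: "continuous_on {s..t} w" "inj_on w {s..t}" and S: "w ` {s..t} \<subseteq> S" and M: "0 \<le> M"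
    and u: "\<And>x y. \<bar>u x - u y\<bar> \<le> dist x y" "\<And>x y. x \<in> S \<Longrightarrow> y \<in> S \<Longrightarrow> dist x y \<le> M * \<bar>u x - u y\<bar>"
  shows "arc_le w (M * dist (w s) (w t)) s t"
  unfolding arc_le_def
proof (intro allI impI)
  fix T and k l :: nat
  assume kl: "k \<le> l" and inc: "\<forall>i. k \<le> i \<and> i < l \<longrightarrow> T i \<le> T (Suc i)" and e: "T k = s" "T l = t"
  have inc': "\<And>i. k \<le> i \<Longrightarrow> i < l \<Longrightarrow> T i \<le> T (Suc i)" using inc by blast
  have rng: "T i \<in> {s..t}" if "k \<le> i" "i \<le> l" for i
    using chain_mono[of k l T k i] chain_mono[of k l T i l] inc' that e by auto
  have T_le: "T i \<le> T j" if "k \<le> i" "i \<le> j" "j \<le> l" for i j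
    using chain_mono[where S = T and k = k and l = l, OF inc'] that by blast
  let ?f = "\<lambda>x. u (w x)"
  have "1-lipschitz_on UNIV u" using u(1) by (intro lipschitz_onI) (auto simp: dist_real_def)
  then have "continuous_on UNIV u" by (rule lipschitz_on_continuous_on)
  then have cf: "continuous_on {s..t} ?f" by (rule continuous_on_compose2[OF _ w(1)]) auto
  have inj: "inj_on ?f {s..t}"
  proof (rule inj_onI)
    fix x y assume "x \<in> {s..t}" "y \<in> {s..t}" "?f x = ?f y"
    then have "dist (w x) (w y) \<le> M * 0" using u(2)[of "w x" "w y"] S by (simp add: image_subset_iff)
    then have "w x = w y" by simp
    then show "x = y" using w(2) \<open>x \<in> _\<close> \<open>y \<in> _\<close> by (simp add: inj_on_eq_iff)
  qed
  have mono: "strict_mono_on {s..t} ?f \<or> strict_antimono_on {s..t} ?f"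
    using injective_eq_monotone_map[of "{s..t}" ?f] cf inj by (simp add: is_interval_cc)
  have tele: "(\<Sum>i\<in>{k..<l}. \<bar>?f (T i) - ?f (T (Suc i))\<bar>) = \<bar>?f (T l) - ?f (T k)\<bar>"
  proof (cases "strict_mono_on {s..t} ?f")
    case True
    have le: "?f (T i) \<le> ?f (T j)" if "k \<le> i" "i \<le> j" "j \<le> l" for i j
      using that by (intro mono_onD[OF strict_mono_on_imp_mono_on[OF True]] rng T_le) auto
    have "(\<Sum>i\<in>{k..<l}. \<bar>?f (T i) - ?f (T (Suc i))\<bar>) = (\<Sum>i\<in>{k..<l}. ?f (T (Suc i)) - ?f (T i))"
    proof (rule sum.cong[OF refl])
      fix i assume "i \<in> {k..<l}"
      then show "\<bar>?f (T i) - ?f (T (Suc i))\<bar> = ?f (T (Suc i)) - ?f (T i)" using le[of i "Suc i"] by simp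
    qed
    then show ?thesis using sum_Suc_diff'[OF kl, of "\<lambda>i. ?f (T i)"] le[of k l] kl by simp
  next
    case False
    then have am: "strict_antimono_on {s..t} ?f" using mono by blast
    have le: "?f (T j) \<le> ?f (T i)" if "k \<le> i" "i \<le> j" "j \<le> l" for i j
    proof (cases "T i = T j")
      case False
      then have "T i < T j" using T_le[OF that] by simp
      then show ?thesis using am rng[of i] rng[of j] that by (auto simp: monotone_on_def less_imp_le)
    qed simp
    have "(\<Sum>i\<in>{k..<l}. \<bar>?f (T i) - ?f (T (Suc i))\<bar>) = (\<Sum>i\<in>{k..<l}. - (?f (T (Suc i)) - ?f (T i)))"
    proof (rule sum.cong[OF refl])
      fix i assume "i \<in> {k..<l}"
      then show "\<bar>?f (T i) - ?f (T (Suc i))\<bar> = - (?f (T (Suc i)) - ?f (T i))" using le[of i "Suc i"] by simp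
    qed
    then show ?thesis using sum_Suc_diff'[OF kl, of "\<lambda>i. ?f (T i)"] le[of k l] kl
      by (simp only: sum_negf) simp
  qed
  have "(\<Sum>i\<in>{k..<l}. dist (w (T i)) (w (T (Suc i)))) \<le> (\<Sum>i\<in>{k..<l}. M * \<bar>?f (T i) - ?f (T (Suc i))\<bar>)"
    using rng S by (intro sum_mono u(2)) auto
  also have "\<dots> = M * \<bar>?f (T l) - ?f (T k)\<bar>" by (simp add: tele sum_distrib_left[symmetric])
  also have "\<dots> \<le> M * dist (w s) (w t)"
    using u(1)[of "w (T l)" "w (T k)"] M e by (intro mult_left_mono) (auto simp: dist_commute)
  finally show "(\<Sum>i\<in>{k..<l}. dist (w (T i)) (w (T (Suc i)))) \<le> M * dist (w s) (w t)" .
qed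

locale simple_loop =
  fixes g :: "real \<Rightarrow> real^2" and \<Lambda> :: real
  assumes simple: "simple_path g" and loop: "pathfinish g = pathstart g"
    and lip: "\<Lambda>-lipschitz_on {0..1} g"
begin

lemma g01: "g 1 = g 0" using loop by (simp add: pathfinish_def pathstart_def)

lemma wrap_lipschitz: "\<Lambda>-lipschitz_on {0..2} (wrap g)"
proof -
  have "\<Lambda>-lipschitz_on {1..2} (\<lambda>x. g (x - 1))"
  proof (rule lipschitz_onI)
    fix x y :: real assume "x \<in> {1..2}" "y \<in> {1..2}"
    then show "dist (g (x - 1)) (g (y - 1)) \<le> \<Lambda> * dist x y"
      using lipschitz_onD[OF lip, of "x - 1" "y - 1"] by (simp add: dist_real_def)
  qed (rule lipschitz_on_nonneg[OF lip])
  from lipschitz_on_concat[OF lip this] show ?thesis by (simp add: wrap_def[abs_def] g01)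
qed

lemma wrap_continuous: "continuous_on {0..2} (wrap g)"
  by (rule lipschitz_on_continuous_on[OF wrap_lipschitz])

lemma wrap_shift: "0 \<le> s \<Longrightarrow> s \<le> 1 \<Longrightarrow> wrap g (s + 1) = wrap g s"
  by (auto simp: wrap_def g01)

lemma wrap_inj:
  assumes "0 \<le> x" "x \<le> 2" "0 \<le> y" "y \<le> 2" "\<bar>x - y\<bar> < 1" "wrap g x = wrap g y"
  shows "x = y"
proof -
  have lf: "\<And>x y. x \<in> {0..1} \<Longrightarrow> y \<in> {0..1} \<Longrightarrow> g x = g y \<Longrightarrow> x = y \<or> x = 0 \<and> y = 1 \<or> x = 1 \<and> y = 0"
    using simple unfolding simple_path_def loop_free_def by blast
  consider "x \<le> 1" "y \<le> 1" | "x \<le> 1" "1 < y" | "1 < x" "y \<le> 1" | "1 < x" "1 < y" by linarith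
  then show ?thesis
  proof cases
    case 1 then show ?thesis using lf[of x y] assms by (auto simp: wrap_def)
  next
    case 2 then show ?thesis using lf[of x "y - 1"] assms by (auto simp: wrap_def)
  next
    case 3 then show ?thesis using lf[of "x - 1" y] assms by (auto simp: wrap_def)
  next
    case 4 then show ?thesis using lf[of "x - 1" "y - 1"] assms by (auto simp: wrap_def)
  qed
qed

lemma wrap_image:
  assumes "0 \<le> s" "s \<le> 1" shows "wrap g ` {s..s+1} = path_image g"
proof
  show "wrap g ` {s..s+1} \<subseteq> path_image g"
    using assms by (auto simp: wrap_def path_image_def)
  show "path_image g \<subseteq> wrap g ` {s..s+1}"
  proof
    fix p assume "p \<in> path_image g"
    then obtain x where x: "0 \<le> x" "x \<le> 1" "p = g x" by (auto simp: path_image_def)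
    then have w: "wrap g x = p" by (simp add: wrap_def)
    then show "p \<in> wrap g ` {s..s+1}"
    proof (cases "x \<ge> s")
      case True then show ?thesis using x w assms by (intro image_eqI[of _ _ x]) auto
    next
      case False then show ?thesis using x w assms wrap_shift[of x] by (intro image_eqI[of _ _ "x + 1"]) auto
    qed
  qed
qed

text \<open>If \<open>S\<close> missed a point \<open>p\<close> of one arc and a point
  \<open>q\<close> of the other, then removing \<open>p\<close> and \<open>q\<close> would divide
  the loop into two parts, relatively closed in \<open>S\<close>, one of which contains \<open>wrap
  g s\<close> and the other \<open>wrap g t\<close>.\<close>

lemma arc_dichotomy:
  assumes st: "0 \<le> s" "s \<le> 1" "s < t" "t < s + 1"
    and S: "connected S" "S \<subseteq> path_image g" "wrap g s \<in> S" "wrap g t \<in> S"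
  shows "wrap g ` {s..t} \<subseteq> S \<or> wrap g ` {t..s+1} \<subseteq> S"
proof (rule ccontr)
  assume "\<not> ?thesis"
  then obtain p q where p: "p \<in> {s..t}" "wrap g p \<notin> S" and q: "q \<in> {t..s+1}" "wrap g q \<notin> S" by blast
  have "p \<noteq> s" using p S(3) by auto
  moreover have "p \<noteq> t" using p S(4) by auto
  moreover have "q \<noteq> t" using q S(4) by auto
  moreover have "q \<noteq> s + 1" using q S(3) wrap_shift[OF st(1,2)] by auto
  ultimately have pq: "s < p" "p < t" "t < q" "q < s + 1" using p q by auto
  define F1 where "F1 = wrap g ` {p..q}"
  define F2 where "F2 = wrap g ` {q..s+1} \<union> wrap g ` {s..p}"
  have cl: "closed (wrap g ` {a..b})" if "0 \<le> a" "b \<le> 2" for a b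
    using continuous_on_subset[OF wrap_continuous, of "{a..b}"] that
    by (intro compact_imp_closed compact_continuous_image) auto
  have "closed F1" unfolding F1_def using st pq by (intro cl) auto
  moreover have "closed F2" unfolding F2_def using st pq by (intro closed_Un cl) auto
  moreover have "S \<subseteq> F1 \<union> F2"
  proof -
    have "{p..q} \<union> ({q..s+1} \<union> {s..p}) = {s..s+1}" using pq by auto
    then have "F1 \<union> F2 = path_image g"
      unfolding F1_def F2_def image_Un[symmetric] wrap_image[OF st(1,2), symmetric] by (rule arg_cong)
    then show ?thesis using S by simp
  qed
  moreover have "F1 \<inter> F2 \<inter> S = {}"
  proof (intro equals0I)
    fix a assume a: "a \<in> F1 \<inter> F2 \<inter> S"
    then obtain x y where x: "x \<in> {p..q}" "a = wrap g x" and y: "y \<in> {q..s+1} \<union> {s..p}" "a = wrap g y"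
      by (auto simp: F1_def F2_def)
    have "x = y" using x y st pq by (intro wrap_inj) auto
    then have "x = p \<or> x = q" using x y by auto
    then show False using a x p q by auto
  qed
  moreover have "F1 \<inter> S \<noteq> {}"
  proof -
    have "wrap g t \<in> F1" unfolding F1_def using pq by (intro imageI) simp
    then show ?thesis using S(4) by blast
  qed
  moreover have "F2 \<inter> S \<noteq> {}"
  proof -
    have "wrap g s \<in> F2" unfolding F2_def using pq by (intro UnI2 imageI) simp
    then show ?thesis using S(3) by blast
  qed
  ultimately show False using S(1) unfolding connected_closed by blast
qed

text \<open>Two points that are close to each other lie in a common chart. The graph between them is
  connected, so by \<open>arc_dichotomy\<close> it contains one of the two arcs, whose length is
  then controlled by the Lipschitz constant of the chart. For points whose distance exceeds a
  Lebesgue number of the covering by charts, the total length of the loop suffices.\<close>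

theorem chord_arc:
  assumes D: "lipschitz_domain D" and comp: "path_image g \<in> components (frontier D)"
  shows "\<exists>A\<ge>1. \<forall>s t. 0 \<le> s \<longrightarrow> s \<le> 1 \<longrightarrow> s < t \<longrightarrow> t < s + 1 \<longrightarrow>
     arc_le (wrap g) (A * dist (wrap g s) (wrap g t)) s t \<or>
     arc_le (wrap g) (A * dist (wrap g s) (wrap g t)) t (s + 1)"
proof -
  let ?G = "path_image g" let ?w = "wrap g"
  have Gsub: "?G \<subseteq> frontier D" using comp by (rule in_components_subset)
  define local_graph where "local_graph z \<rho> M \<longleftrightarrow>
    (\<forall>a b. a \<in> frontier D \<inter> ball z \<rho> \<longrightarrow> b \<in> frontier D \<inter> ball z \<rho> \<longrightarrow>
       (\<exists>S u. S \<subseteq> frontier D \<and> connected S \<and> a \<in> S \<and> b \<in> S \<and>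
         (\<forall>x y. \<bar>u x - u y\<bar> \<le> dist x y) \<and> (\<forall>x\<in>S. \<forall>y\<in>S. dist x y \<le> M * \<bar>u x - u y\<bar>)))"
    for z \<rho> M
  have "\<exists>\<rho> M. 0 < \<rho> \<and> 1 \<le> M \<and> local_graph z \<rho> M" if "z \<in> ?G" for z
  proof -
    have zf: "z \<in> frontier D" using Gsub that by auto
    show ?thesis unfolding local_graph_def by (rule frontier_local_graph[OF D zf]) blast
  qed
  then obtain \<rho> M where \<rho>: "\<And>z. z \<in> ?G \<Longrightarrow> 0 < \<rho> z" and M1: "\<And>z. z \<in> ?G \<Longrightarrow> 1 \<le> M z"
    and graph: "\<And>z. z \<in> ?G \<Longrightarrow> local_graph z (\<rho> z) (M z)"
    by metis
  have cpt: "compact ?G" using simple by (intro compact_path_image simple_path_imp_path)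
  have cov: "?G \<subseteq> (\<Union>z\<in>?G. ball z (\<rho> z))" using \<rho> by (meson UN_I centre_in_ball subsetI)
  obtain Z where Z: "finite Z" "Z \<subseteq> ?G" "?G \<subseteq> (\<Union>z\<in>Z. ball z (\<rho> z))"
  proof (rule compactE_image[OF cpt _ cov])
    fix Z assume "Z \<subseteq> ?G" "finite Z" "?G \<subseteq> (\<Union>z\<in>Z. ball z (\<rho> z))"
    then show thesis by (intro that)
  qed (rule open_ball)
  obtain \<epsilon> where \<epsilon>: "0 < \<epsilon>" "\<And>x. x \<in> ?G \<Longrightarrow> \<exists>B\<in>(\<lambda>z. ball z (\<rho> z)) ` Z. ball x \<epsilon> \<subseteq> B"
  proof (rule Heine_Borel_lemma[OF cpt Z(3)])
    show "open B" if "B \<in> (\<lambda>z. ball z (\<rho> z)) ` Z" for B using that by auto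
  qed (rule that)
  have \<Lambda>0: "\<Lambda> \<ge> 0" by (rule lipschitz_on_nonneg[OF lip])
  define A where "A = 1 + \<Lambda> / \<epsilon> + (\<Sum>z\<in>Z. M z)"
  have sM: "0 \<le> (\<Sum>z\<in>Z. M z)" using M1 Z(2) by (intro sum_nonneg) (meson order_trans subsetD zero_le_one)
  have A1: "1 \<le> A" using \<Lambda>0 \<epsilon> sM by (simp add: A_def)
  have A\<Lambda>: "\<Lambda> \<le> A * \<epsilon>"
  proof -
    have "\<Lambda> / \<epsilon> \<le> A" using sM by (simp add: A_def)
    then show ?thesis using \<epsilon> by (simp add: field_simps)
  qed
  have AM: "M z \<le> A" if "z \<in> Z" for z
  proof -
    have "M z \<le> (\<Sum>z\<in>Z. M z)"
      using that Z M1 by (intro member_le_sum) (auto intro: order_trans[OF zero_le_one])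
    then show ?thesis using \<Lambda>0 \<epsilon>(1) unfolding A_def by (smt (verit) divide_nonneg_pos)
  qed
  have "arc_le ?w (A * dist (?w s) (?w t)) s t \<or> arc_le ?w (A * dist (?w s) (?w t)) t (s + 1)"
    if st: "0 \<le> s" "s \<le> 1" "s < t" "t < s + 1" for s t
  proof -
    have inG: "?w s \<in> ?G" "?w t \<in> ?G" using wrap_image[OF st(1,2)] st by (auto simp flip: wrap_image[OF st(1,2)])
    show ?thesis
    proof (cases "dist (?w s) (?w t) < \<epsilon>")
      case True
      obtain z where z: "z \<in> Z" "ball (?w s) \<epsilon> \<subseteq> ball z (\<rho> z)" using \<epsilon>(2)[OF inG(1)] by (elim bexE imageE) simp
      have "?w s \<in> ball (?w s) \<epsilon>" "?w t \<in> ball (?w s) \<epsilon>" using True \<epsilon>(1) by simp_all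
      then have "?w s \<in> frontier D \<inter> ball z (\<rho> z)" "?w t \<in> frontier D \<inter> ball z (\<rho> z)"
        using z(2) inG Gsub by blast+
      note near = this
      have zG: "z \<in> ?G" using z Z by blast
      obtain S and u :: "real^2 \<Rightarrow> real" where "S \<subseteq> frontier D \<and> connected S \<and> ?w s \<in> S \<and> ?w t \<in> S \<and>
         (\<forall>x y. \<bar>u x - u y\<bar> \<le> dist x y) \<and> (\<forall>x\<in>S. \<forall>y\<in>S. dist x y \<le> M z * \<bar>u x - u y\<bar>)"
        using graph[OF zG, unfolded local_graph_def, rule_format, OF near] by (elim exE)
      then have S: "S \<subseteq> frontier D" "connected S" "?w s \<in> S" "?w t \<in> S"
        and u: "\<And>x y. \<bar>u x - u y\<bar> \<le> dist x y" "\<And>x y. x \<in> S \<Longrightarrow> y \<in> S \<Longrightarrow> dist x y \<le> M z * \<bar>u x - u y\<bar>"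
        by simp_all
      have u': "dist x y \<le> A * \<bar>u x - u y\<bar>" if "x \<in> S" "y \<in> S" for x y
        using u(2)[OF that] AM[OF z(1)] by (meson abs_ge_zero mult_right_mono order_trans)
      have SG: "S \<subseteq> ?G"
        using S inG comp by (intro components_maximal[of ?G "frontier D"]) auto
      have wc: "continuous_on {a..b} ?w" "inj_on ?w {a..b}" if "0 \<le> a" "b \<le> 2" "b - a < 1" for a b
        using continuous_on_subset[OF wrap_continuous, of "{a..b}"] that
        by (auto intro!: inj_onI wrap_inj)
      from arc_dichotomy[OF st S(2) SG S(3,4)] show ?thesis
      proof
        assume "?w ` {s..t} \<subseteq> S"
        from arc_le_graph[OF wc this _ u(1) u'] st A1 show ?thesis by auto
      next
        assume "?w ` {t..s+1} \<subseteq> S"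
        from arc_le_graph[OF wc this _ u(1) u'] st A1 show ?thesis
          by (auto simp: wrap_shift dist_commute)
      qed
    next
      case False
      have "\<Lambda>-lipschitz_on {s..t} ?w" using wrap_lipschitz st by (rule_tac lipschitz_on_subset) auto
      then have 1: "arc_le ?w (\<Lambda> * (t - s)) s t" by (rule arc_le_lipschitz)
      have "\<Lambda> * (t - s) \<le> \<Lambda> * 1" using st \<Lambda>0 by (intro mult_left_mono) auto
      also have "\<dots> \<le> A * \<epsilon>" using A\<Lambda> by simp
      also have "\<dots> \<le> A * dist (?w s) (?w t)" using False A1 by (intro mult_left_mono) auto
      finally show ?thesis using arc_le_mono[OF 1] by blast
    qed
  qed
  then show ?thesis using A1 by blast
qed

end

section \<open>Triangulations and piecewise affine interpolation\<close>

definition verts :: "(real^2) set \<Rightarrow> (real^2) set" where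
  "verts K = {v. v extreme_point_of K}"

definition affine_fun :: "real \<Rightarrow> (real^2 \<Rightarrow> real) \<Rightarrow> real^2 \<Rightarrow> real" where
  "affine_fun c g x = c + g x"

lemma triangle_verts:
  assumes "2 simplex K"
  shows "finite (verts K)" "card (verts K) = 3" "\<not> affine_dependent (verts K)" "K = convex hull (verts K)"
    "affine hull (verts K) = UNIV"
proof -
  obtain C where C: "\<not> affine_dependent C" "int (card C) = 2 + 1" "K = convex hull C"
    using assms unfolding simplex_def by blast
  have "verts K = C"
    using extreme_point_of_convex_hull_affine_independent[OF C(1)] C(3) by (auto simp: verts_def)
  then show "finite (verts K)" "card (verts K) = 3" "\<not> affine_dependent (verts K)" "K = convex hull (verts K)"
    "affine hull (verts K) = UNIV"
    using C aff_independent_finite[OF C(1)] affine_independent_span_eq[OF C(1)] by auto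
qed

lemma verts_subset: "verts K \<subseteq> K"
  by (auto simp: verts_def extreme_point_of_def)

lemma affine_interpolant:
  fixes f :: "real^2 \<Rightarrow> real"
  assumes "2 simplex K"
  obtains c g where "linear g" "\<And>v. v \<in> verts K \<Longrightarrow> affine_fun c g v = f v"
proof -
  note V = triangle_verts[OF assms]
  then obtain a where a: "a \<in> verts K" by fastforce
  let ?B = "(\<lambda>x. -a + x) ` (verts K - {a})"
  have "independent ?B" using affine_dependent_iff_dependent2[OF a] V(3) by simp
  then obtain g where g: "linear g" "\<And>x. x \<in> ?B \<Longrightarrow> g x = f (a + x) - f a"
    using linear_independent_extend[of ?B "\<lambda>x. f (a + x) - f a"] by blast
  have "affine_fun (f a - g a) g v = f v" if "v \<in> verts K" for v
  proof (cases "v = a")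
    case False
    then have "g (-a + v) = f v - f a" using g(2)[of "-a + v"] that by auto
    moreover have "g (-a + v) = g v - g a" using linear_diff[OF g(1), of v a] by simp
    ultimately show ?thesis by (simp add: affine_fun_def)
  qed (simp add: affine_fun_def)
  with that g(1) show thesis by blast
qed

lemma affine_fun_comb:
  assumes "linear g" "sum u V = 1"
  shows "affine_fun c g (\<Sum>v\<in>V. u v *\<^sub>R v) = (\<Sum>v\<in>V. u v * affine_fun c g v)"
proof -
  have "(\<Sum>v\<in>V. u v * affine_fun c g v) = (\<Sum>v\<in>V. u v) * c + (\<Sum>v\<in>V. u v * g v)"
    by (simp add: affine_fun_def distrib_left sum.distrib sum_distrib_right)
  then show ?thesis using assms by (simp add: affine_fun_def linear_sum linear_scale)
qed

lemma affine_fun_diff: "linear g \<Longrightarrow> affine_fun c g x - affine_fun c g y = g (x - y)"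
  by (simp add: affine_fun_def linear_diff)

lemma convex_affine_fun_band:
  assumes "linear g" shows "convex {x. \<bar>affine_fun c g x - d\<bar> \<le> B}"
proof -
  have "{x. \<bar>affine_fun c g x - d\<bar> \<le> B} = g -` {d - c - B..d - c + B}"
    by (auto simp: affine_fun_def abs_le_iff)
  then show ?thesis using convex_linear_vimage[OF assms] by simp
qed

text \<open>Points at which an affine function deviates by at most \<open>B\<close> from a given
  value form a convex set. The estimate thus extends from the vertices to the triangle, in one
  argument at a time.\<close>

lemma affine_fun_osc:
  assumes K: "2 simplex K" and g: "linear g"
    and B: "\<And>v w. v \<in> verts K \<Longrightarrow> w \<in> verts K \<Longrightarrow> \<bar>affine_fun c g v - affine_fun c g w\<bar> \<le> B"
    and x: "x \<in> K" and y: "y \<in> K"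
  shows "\<bar>affine_fun c g x - affine_fun c g y\<bar> \<le> B"
proof -
  have hull: "K \<subseteq> {x. \<bar>affine_fun c g x - d\<bar> \<le> B}"
    if "\<And>v. v \<in> verts K \<Longrightarrow> \<bar>affine_fun c g v - d\<bar> \<le> B" for d
  proof -
    have "convex hull (verts K) \<subseteq> {x. \<bar>affine_fun c g x - d\<bar> \<le> B}"
      by (rule hull_minimal) (use that convex_affine_fun_band[OF g] in auto)
    then show ?thesis using triangle_verts(4)[OF K] by simp
  qed
  have 1: "\<bar>affine_fun c g x - affine_fun c g w\<bar> \<le> B" if "w \<in> verts K" for w
    using hull[of "affine_fun c g w"] B that x by auto
  have "\<bar>affine_fun c g w - affine_fun c g x\<bar> \<le> B" if "w \<in> verts K" for w
    using 1[OF that] by (simp add: abs_minus_commute)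
  then have "\<bar>affine_fun c g y - affine_fun c g x\<bar> \<le> B" using hull[of "affine_fun c g x"] y by auto
  then show ?thesis by (simp add: abs_minus_commute)
qed

text \<open>The two ends of a diameter of the inscribed ball in direction \<open>t\<close> differ by
  \<open>2 * r * g t\<close> in value.\<close>

lemma affine_fun_gradient:
  assumes K: "2 simplex K" and g: "linear g" and r: "0 < r" "cball z r \<subseteq> K"
    and B: "\<And>v w. v \<in> verts K \<Longrightarrow> w \<in> verts K \<Longrightarrow> \<bar>affine_fun c g v - affine_fun c g w\<bar> \<le> B"
    and t: "norm t = 1"
  shows "2 * r * \<bar>g t\<bar> \<le> B"
proof -
  have "z + r *\<^sub>R t \<in> K" "z - r *\<^sub>R t \<in> K" using r t by (auto simp: dist_norm intro!: subsetD[OF r(2)])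
  then have "\<bar>affine_fun c g (z + r *\<^sub>R t) - affine_fun c g (z - r *\<^sub>R t)\<bar> \<le> B"
    using affine_fun_osc[OF K g B] by blast
  also have "affine_fun c g (z + r *\<^sub>R t) - affine_fun c g (z - r *\<^sub>R t) = 2 * r * g t"
    using linear_scale[OF g, of "2 * r" t] by (simp add: affine_fun_diff[OF g] algebra_simps scaleR_2[symmetric])
  finally show ?thesis using r by (simp add: abs_mult)
qed

lemma linear_axis:
  assumes "linear g"
  shows "g (t :: real^2) = t$1 * g (axis 1 1) + t$2 * (g (axis 2 1) :: real)"
proof -
  have "t = t$1 *\<^sub>R axis 1 1 + t$2 *\<^sub>R axis 2 1" by (simp add: vec_eq_iff forall_2 axis_def)
  from arg_cong[OF this, of g] show ?thesis by (simp add: linear_add[OF assms] linear_scale[OF assms])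
qed

lemma affine_fun_polys:
  assumes "linear g" shows "affine_fun c g \<in> polys 1"
proof -
  have S: "{(i, j). i + j \<le> (1::nat)} = {(0,0), (1,0), (0,1)}" by auto
  define coef where "coef = (\<lambda>i j. if i = 0 \<and> j = 0 then c else if i = (1::nat) \<and> j = (0::nat) then g (axis 1 1) else g (axis 2 1))"
  have eq: "affine_fun c g x = (\<Sum>(i, j)\<in>{(i, j). i + j \<le> 1}. coef i j * (x$1) ^ i * (x$2) ^ j)" for x
    unfolding S by (simp add: affine_fun_def linear_axis[OF assms, of x] coef_def)
  show ?thesis unfolding polys_def by (intro CollectI exI[of _ coef] allI eq)
qed

text \<open>The barycentric coordinate of \<open>w\<close> increases from zero to one along the
  edge, and \<open>affine_fun_gradient\<close> bounds its rate of change.\<close>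

lemma edge_ge_inball:
  assumes K: "2 simplex K" and r: "0 < r" "cball z r \<subseteq> K" and v: "v \<in> verts K" "w \<in> verts K" "v \<noteq> w"
  shows "2 * r \<le> dist v w"
proof -
  obtain c g where g: "linear g" and val: "\<And>x. x \<in> verts K \<Longrightarrow> affine_fun c g x = (if x = w then 1 else 0)"
    by (rule affine_interpolant[OF K, of "\<lambda>x. if x = w then 1 else 0"]) blast
  define t where "t = (w - v) /\<^sub>R norm (w - v)"
  have n: "norm (w - v) > 0" using v by simp
  have t: "norm t = 1" using n by (simp add: t_def)
  have "g (w - v) = 1" using affine_fun_diff[OF g, of c w v] val v by simp
  then have gt: "g t = 1 / norm (w - v)"
    by (simp add: t_def linear_scale[OF g] divide_inverse)
  have "2 * r * \<bar>g t\<bar> \<le> 1" using affine_fun_gradient[OF K g r _ t, of c 1] val by simp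
  then show ?thesis using n gt by (simp add: dist_norm norm_minus_commute field_simps)
qed

lemma affine_fun_determined:
  assumes K: "2 simplex K" and g: "linear g" "linear g'"
    and eq: "\<And>v. v \<in> verts K \<Longrightarrow> affine_fun c g v = affine_fun c' g' v"
  shows "affine_fun c g x = affine_fun c' g' x"
proof -
  note V = triangle_verts[OF K]
  have "x \<in> affine hull (verts K)" using V(5) by simp
  then obtain u where "sum u (verts K) = 1" "x = (\<Sum>v\<in>verts K. u v *\<^sub>R v)"
    using affine_hull_finite[OF V(1)] by auto
  then show ?thesis using affine_fun_comb g eq by simp
qed

lemma edge_of_triangle:
  assumes K: "2 simplex K" and e: "closed_segment a b edge_of K"
  obtains c0 where "verts K = {a, b, c0}" "a \<noteq> b" "c0 \<noteq> a" "c0 \<noteq> b"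
proof -
  have f: "closed_segment a b face_of K" and d: "aff_dim (closed_segment a b) = 1"
    using e by (auto simp: edge_of_def)
  have ab: "a \<noteq> b" using d by auto
  have "a \<in> verts K" "b \<in> verts K"
    using extreme_point_of_face[OF f] extreme_point_of_segment unfolding verts_def by blast+
  moreover have "card (verts K - {a, b}) = 1"
    using triangle_verts[OF K] calculation ab by (simp add: card_Diff_subset)
  then obtain c0 where "verts K - {a, b} = {c0}" by (meson card_1_singletonE)
  ultimately show thesis using that[of c0] ab by auto
qed

text \<open>The function vanishing at \<open>a\<close> and \<open>b\<close> is a positive multiple
  of the barycentric coordinate of \<open>c0\<close>. Near an inner point of the edge the other two
  barycentric coordinates are positive, so its sign alone decides membership.\<close>

lemma halfball_subset_triangle:
  assumes K: "2 simplex K" and V: "verts K = {a, b, c0}" "a \<noteq> b" "c0 \<noteq> a" "c0 \<noteq> b"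
    and g: "linear g" "affine_fun c g a = 0" "affine_fun c g b = 0" "affine_fun c g c0 > 0"
    and p: "p \<in> open_segment a b"
  obtains \<epsilon> where "0 < \<epsilon>" "\<And>x. x \<in> ball p \<epsilon> \<Longrightarrow> 0 \<le> affine_fun c g x \<Longrightarrow> x \<in> K"
proof -
  note VV = triangle_verts[OF K]
  have "\<exists>ca ga. linear ga \<and> (\<forall>v\<in>verts K. affine_fun ca ga v = (if v = w then 1 else 0))" for w
    by (rule affine_interpolant[OF K, of "\<lambda>v. if v = w then 1 else 0"]) blast
  then obtain ca ga where la: "\<And>w. linear (ga w)"
    and va: "\<And>w v. v \<in> verts K \<Longrightarrow> affine_fun (ca w) (ga w) v = (if v = w then 1 else 0)"
    by metis
  obtain s where s: "0 < s" "s < 1" "p = (1 - s) *\<^sub>R a + s *\<^sub>R b" using p by (auto simp: in_segment)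
  have pos: "0 < affine_fun (ca w) (ga w) p" if "w = a \<or> w = b" for w
  proof -
    have "affine_fun (ca w) (ga w) p = (1 - s) * affine_fun (ca w) (ga w) a + s * affine_fun (ca w) (ga w) b"
      unfolding s(3) affine_fun_def linear_scale[OF la] linear_add[OF la] by (simp add: algebra_simps)
    then show ?thesis using va[of a w] va[of b w] V that s by auto
  qed
  have opn: "open {x. 0 < affine_fun (ca w) (ga w) x}" for w
    unfolding affine_fun_def by (intro open_Collect_less continuous_intros linear_continuous_on_compose[OF continuous_on_id la, simplified])
  have "open ({x. 0 < affine_fun (ca a) (ga a) x} \<inter> {x. 0 < affine_fun (ca b) (ga b) x})"
    by (intro open_Int opn)
  moreover have "p \<in> {x. 0 < affine_fun (ca a) (ga a) x} \<inter> {x. 0 < affine_fun (ca b) (ga b) x}"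
    using pos[of a] pos[of b] by simp
  ultimately obtain \<epsilon> where \<epsilon>: "0 < \<epsilon>"
    "ball (p) \<epsilon> \<subseteq> {x. 0 < affine_fun (ca a) (ga a) x} \<inter> {x. 0 < affine_fun (ca b) (ga b) x}"
    by (metis openE)
  have "x \<in> K" if x: "x \<in> ball (p) \<epsilon>" "0 \<le> affine_fun c g x" for x
  proof -
    have "x \<in> affine hull (verts K)" using VV(5) by simp
    then obtain u where u: "sum u (verts K) = 1" "x = (\<Sum>v\<in>verts K. u v *\<^sub>R v)"
      using affine_hull_finite[OF VV(1)] by auto
    have lam: "affine_fun c' g' x = u a * affine_fun c' g' a + u b * affine_fun c' g' b + u c0 * affine_fun c' g' c0"
      if "linear g'" for c' g'
      using affine_fun_comb[OF that u(1), of c'] u(2) V by simp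
    have "affine_fun (ca a) (ga a) x = u a" "affine_fun (ca b) (ga b) x = u b"
      using lam[OF la] va V by simp_all
    then have "0 \<le> u a" "0 \<le> u b" using \<epsilon>(2) x(1) by (auto simp: less_imp_le)
    moreover have "0 \<le> u c0" using lam[OF g(1), of c] g x(2) by (simp add: zero_le_mult_iff)
    ultimately have "\<forall>v\<in>verts K. 0 \<le> u v" using V by auto
    then have "x \<in> convex hull (verts K)" using u convex_hull_finite[OF VV(1)] by auto
    then show ?thesis using VV(4) by simp
  qed
  with that \<epsilon>(1) show thesis by blast
qed

locale mesh =
  fixes D :: "(real^2) set" and T :: "(real^2) set set"
  assumes D: "lipschitz_domain D" and T: "conforming_triangulation T D"
begin

lemma finite_T: "finite T" and simplex_T: "K \<in> T \<Longrightarrow> 2 simplex K" and Union_T: "\<Union>T = closure D"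
  and face_T: "K \<in> T \<Longrightarrow> K' \<in> T \<Longrightarrow> K \<inter> K' face_of K"
  using T by (auto simp: conforming_triangulation_def triangulation_def)

lemma face_T': "K \<in> T \<Longrightarrow> K' \<in> T \<Longrightarrow> K \<inter> K' face_of K'"
  using face_T[of K' K] by (simp add: Int_commute)

lemma open_D: "open D" and bounded_D: "bounded D"
  using D by (auto simp: lipschitz_domain_def)

lemma convex_T: "K \<in> T \<Longrightarrow> convex K" and compact_T: "K \<in> T \<Longrightarrow> compact K" and closed_T: "K \<in> T \<Longrightarrow> closed K"
  using simplex_T convex_simplex compact_simplex closed_simplex by blast+

text \<open>The intersection of two elements is a face of both, and a face that contains an interior
  point is the whole triangle.\<close>

lemma interior_disjoint:
  assumes "K \<in> T" "K' \<in> T" "interior K \<inter> interior K' \<noteq> {}"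
  shows "K = K'"
proof -
  have *: "K \<subseteq> K'" if K: "K \<in> T" "K' \<in> T" "interior K \<inter> interior K' \<noteq> {}" for K K'
  proof -
    have "interior K \<subseteq> rel_interior K" by (rule interior_subset_rel_interior)
    then have "(K \<inter> K') \<inter> rel_interior K \<noteq> {}" using K(3) interior_subset by blast
    then have "K \<subseteq> K \<inter> K'" using subset_of_face_of[OF face_T[OF K(1,2)] subset_refl] by blast
    then show ?thesis by blast
  qed
  from *[of K K'] *[of K' K] assms show ?thesis by blast
qed

lemma inballs_separated:
  assumes "K \<in> T" "K' \<in> T" "K \<noteq> K'" "cball x r \<subseteq> K" "cball y r \<subseteq> K'"
  shows "2 * r \<le> dist x y"
proof (rule ccontr)
  assume "\<not> ?thesis"
  then have "midpoint x y \<in> ball x r" "midpoint x y \<in> ball y r"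
    by (auto simp: dist_midpoint)
  moreover have "ball x r \<subseteq> interior K" "ball y r \<subseteq> interior K'"
    using assms(4,5) ball_subset_cball by (meson interior_maximal open_ball order_trans)+
  ultimately show False using interior_disjoint[OF assms(1,2)] assms(3) by blast
qed

text \<open>Two triangles with a common edge lie on the same side of it or on opposite sides. In the
  first case their interiors meet, so they coincide. In the second case they cover a neighbourhood
  of \<open>p\<close>, which is impossible at a boundary point of a Lipschitz domain.\<close>

lemma boundary_edge_unique:
  assumes K: "K1 \<in> T" "K2 \<in> T" and e: "closed_segment a b edge_of K1" "closed_segment a b edge_of K2"
    and p: "p \<in> open_segment a b" "p \<in> frontier D"
  shows "K1 = K2"
proof -
  note S = simplex_T[OF K(1)] simplex_T[OF K(2)]
  obtain c1 where c1: "verts K1 = {a, b, c1}" "a \<noteq> b" "c1 \<noteq> a" "c1 \<noteq> b"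
    by (rule edge_of_triangle[OF S(1) e(1)])
  obtain c2 where c2: "verts K2 = {a, b, c2}" "a \<noteq> b" "c2 \<noteq> a" "c2 \<noteq> b"
    by (rule edge_of_triangle[OF S(2) e(2)])
  obtain d1 g1 where g1: "linear g1" "\<And>v. v \<in> verts K1 \<Longrightarrow> affine_fun d1 g1 v = (if v = c1 then 1 else 0)"
    by (rule affine_interpolant[OF S(1), of "\<lambda>v. if v = c1 then 1 else 0"]) blast
  obtain d2 g2 where g2: "linear g2" "\<And>v. v \<in> verts K2 \<Longrightarrow> affine_fun d2 g2 v = (if v = c2 then 1 else 0)"
    by (rule affine_interpolant[OF S(2), of "\<lambda>v. if v = c2 then 1 else 0"]) blast
  have v1: "affine_fun d1 g1 a = 0" "affine_fun d1 g1 b = 0" "affine_fun d1 g1 c1 = 1"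
    using g1(2) c1 by auto
  have v2: "affine_fun d2 g2 a = 0" "affine_fun d2 g2 b = 0" "affine_fun d2 g2 c2 = 1"
    using g2(2) c2 by auto
  define \<kappa> where "\<kappa> = affine_fun d2 g2 c1"
  have scale: "affine_fun d2 g2 x = \<kappa> * affine_fun d1 g1 x" for x
  proof -
    have g': "linear (\<lambda>x. \<kappa> *\<^sub>R g1 x)" by (rule linear_compose_scale_right[OF g1(1)])
    have kk: "affine_fun (\<kappa> * d1) (\<lambda>x. \<kappa> *\<^sub>R g1 x) x = \<kappa> * affine_fun d1 g1 x" for x
      by (simp add: affine_fun_def distrib_left)
    have "affine_fun d2 g2 v = affine_fun (\<kappa> * d1) (\<lambda>x. \<kappa> *\<^sub>R g1 x) v" if "v \<in> verts K1" for v
      using that v1 v2 unfolding kk c1(1) by (elim insertE) (simp_all add: \<kappa>_def)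
    from affine_fun_determined[OF S(1) g2(1) g' this] show ?thesis unfolding kk .
  qed
  obtain \<epsilon>1 where \<epsilon>1: "0 < \<epsilon>1" "\<And>x. x \<in> ball (p) \<epsilon>1 \<Longrightarrow> 0 \<le> affine_fun d1 g1 x \<Longrightarrow> x \<in> K1"
    by (rule halfball_subset_triangle[OF S(1) c1 g1(1) v1(1,2) _ p(1)]) (use v1 in auto)
  obtain \<epsilon>2 where \<epsilon>2: "0 < \<epsilon>2" "\<And>x. x \<in> ball (p) \<epsilon>2 \<Longrightarrow> 0 \<le> affine_fun d2 g2 x \<Longrightarrow> x \<in> K2"
    by (rule halfball_subset_triangle[OF S(2) c2 g2(1) v2(1,2) _ p(1)]) (use v2 in auto)
  define \<epsilon> where "\<epsilon> = min \<epsilon>1 \<epsilon>2"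
  have \<epsilon>: "0 < \<epsilon>" "ball (p) \<epsilon> \<subseteq> ball (p) \<epsilon>1" "ball (p) \<epsilon> \<subseteq> ball (p) \<epsilon>2"
    using \<epsilon>1 \<epsilon>2 by (auto simp: \<epsilon>_def)
  show ?thesis
  proof (cases "\<kappa> > 0")
    case True
    obtain s where ps: "p = (1 - s) *\<^sub>R a + s *\<^sub>R b" using p(1) by (auto simp: in_segment)
    have "affine_fun d1 g1 p = (1 - s) * affine_fun d1 g1 a + s * affine_fun d1 g1 b"
      unfolding ps affine_fun_def linear_scale[OF g1(1)] linear_add[OF g1(1)] by (simp add: algebra_simps)
    then have m0: "affine_fun d1 g1 p = 0" using v1 by simp
    let ?W = "ball (p) \<epsilon> \<inter> {x. 0 < affine_fun d1 g1 x}"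
    have "open ?W" unfolding affine_fun_def
      by (intro open_Int open_ball open_Collect_less continuous_intros linear_continuous_on_compose[OF continuous_on_id g1(1), simplified])
    moreover have "?W \<subseteq> K1" using \<epsilon>1(2) \<epsilon> by (auto simp: subset_iff)
    moreover have "?W \<subseteq> K2" using \<epsilon>2(2) \<epsilon> True by (auto simp: subset_iff scale)
    moreover have "?W \<noteq> {}"
    proof -
      define N where "N = norm (c1 - a) + 1"
      define s where "s = \<epsilon> / 2 / N"
      have n0: "0 < N" by (simp add: N_def add_nonneg_pos)
      have s: "s > 0" using \<epsilon> n0 by (simp add: s_def)
      have "s * norm (c1 - a) \<le> s * N" using s by (intro mult_left_mono) (auto simp: N_def)
      also have "\<dots> = \<epsilon> / 2" using n0 by (simp add: s_def)
      finally have "s * norm (c1 - a) < \<epsilon>" using \<epsilon>(1) by simp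
      then have "p + s *\<^sub>R (c1 - a) \<in> ball (p) \<epsilon>" using s by (simp add: dist_norm)
      moreover have "affine_fun d1 g1 (p + s *\<^sub>R (c1 - a)) = s"
      proof -
        have "g1 (c1 - a) = 1" using affine_fun_diff[OF g1(1), of d1 c1 a] v1 by simp
        then show ?thesis using m0 by (simp add: affine_fun_def linear_add[OF g1(1)] linear_scale[OF g1(1)])
      qed
      ultimately show ?thesis using s by auto
    qed
    ultimately have "?W \<subseteq> interior K1" "?W \<subseteq> interior K2" "?W \<noteq> {}"
      using interior_maximal[of ?W K1] interior_maximal[of ?W K2] by blast+
    then have "interior K1 \<inter> interior K2 \<noteq> {}" by blast
    then show ?thesis using interior_disjoint K by blast
  next
    case False
    have "ball (p) \<epsilon> \<subseteq> closure D"
    proof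
      fix x assume x: "x \<in> ball (p) \<epsilon>"
      show "x \<in> closure D"
      proof (cases "0 \<le> affine_fun d1 g1 x")
        case True
        then have "x \<in> K1" using \<epsilon>1(2) \<epsilon> x by blast
        then show ?thesis using K Union_T by blast
      next
        case nn: False
        then have "0 \<le> affine_fun d2 g2 x" using False by (simp add: scale mult_nonpos_nonpos)
        then have "x \<in> K2" using \<epsilon>2(2) \<epsilon> x by blast
        then show ?thesis using K Union_T by blast
      qed
    qed
    then have "p \<in> interior (closure D)" using \<epsilon>(1) by (auto simp: mem_interior)
    then show ?thesis using p(2) frontier_Int_interior_closure[OF D] by blast
  qed
qed

lemma adj_elem_props:
  assumes "closed_segment a b \<in> bdry_edges D T"
  shows "adj_elem T (closed_segment a b) \<in> T" "closed_segment a b edge_of adj_elem T (closed_segment a b)"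
proof -
  have fr: "closed_segment a b \<subseteq> frontier D" and ex: "\<exists>K\<in>T. closed_segment a b edge_of K"
    using assms by (auto simp: bdry_edges_def)
  then have "a \<noteq> b" by (auto simp: edge_of_def)
  then have mid: "midpoint a b \<in> open_segment a b" by simp
  then have "midpoint a b \<in> frontier D" using fr segment_open_subset_closed by blast
  then have "\<exists>!K. K \<in> T \<and> closed_segment a b edge_of K"
    using ex boundary_edge_unique[OF _ _ _ _ mid] by blast
  from theI'[OF this] show "adj_elem T (closed_segment a b) \<in> T" "closed_segment a b edge_of adj_elem T (closed_segment a b)"
    unfolding adj_elem_def by auto
qed

lemma edge_is_segment:
  assumes "K \<in> T" "e edge_of K"
  obtains a b where "e = closed_segment a b" "a \<noteq> b"
proof -
  have f: "e face_of K" and d: "aff_dim e = 1" using assms by (auto simp: edge_of_def)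
  have "compact e" "convex e"
    using face_of_imp_compact[OF convex_T[OF assms(1)] compact_T[OF assms(1)] f] face_of_imp_convex[OF f] by auto
  moreover have "collinear e" "e \<noteq> {}" using d by (auto simp: collinear_aff_dim)
  ultimately obtain a b where ab: "e = closed_segment a b" by (metis compact_convex_collinear_segment)
  with d have "a \<noteq> b" by auto
  with ab that show thesis by blast
qed

lemma interior_subset_D: "K \<in> T \<Longrightarrow> interior K \<subseteq> D"
proof -
  assume K: "K \<in> T"
  have "interior K \<subseteq> interior (closure D)" using K Union_T by (intro interior_mono) auto
  moreover have "interior K \<subseteq> closure D" using K Union_T interior_subset by blast
  ultimately show ?thesis using frontier_Int_interior_closure[OF D] open_D
    by (auto simp: frontier_def interior_open)
qed

lemma edge_transfer:
  assumes K: "K \<in> T" "K' \<in> T" and e: "closed_segment a b edge_of K" and x: "x \<in> open_segment a b" "x \<in> K'"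
  shows "closed_segment a b edge_of K'"
proof -
  have ab: "a \<noteq> b" using x by auto
  have f: "closed_segment a b face_of K" using e by (simp add: edge_of_def)
  have "x \<in> rel_interior (closed_segment a b)" using x ab by (simp add: rel_interior_closed_segment)
  then have "closed_segment a b \<subseteq> K \<inter> K'"
    using x f face_of_imp_subset[OF f] segment_open_subset_closed[of a b]
    by (intro subset_of_face_of[OF face_T[OF K]]) auto
  then have "closed_segment a b face_of K \<inter> K'" using face_of_subset[OF f] by blast
  then have "closed_segment a b face_of K'" using face_of_trans face_T'[OF K] by blast
  then show ?thesis using e by (simp add: edge_of_def)
qed

text \<open>No other element contains an inner point of the edge, since by
  \<open>edge_transfer\<close> it would have the same edge, contrary to
  \<open>boundary_edge_unique\<close>. Hence the closure of \<open>D\<close> agrees with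
  \<open>K\<close> near all inner points of the edge, and these are boundary points along with
  \<open>x\<close>.\<close>

lemma boundary_edge_of_point:
  assumes K: "K \<in> T" and e: "closed_segment a b edge_of K" and x: "x \<in> open_segment a b" "x \<in> frontier D"
  shows "closed_segment a b \<subseteq> frontier D"
proof -
  have only: "K' = K" if "K' \<in> T" "y \<in> K'" "y \<in> open_segment a b" for K' y
    using boundary_edge_unique[OF that(1) K edge_transfer[OF K that(1) e that(3,2)] e x] .
  have "open_segment a b \<subseteq> frontier D"
  proof
    fix y assume y: "y \<in> open_segment a b"
    have f: "closed_segment a b face_of K" using e by (simp add: edge_of_def)
    have yK: "y \<in> K" using y segment_open_subset_closed[of a b] face_of_imp_subset[OF f] by blast
    have "closed (\<Union>(T - {K}))" using finite_T closed_T by (intro closed_Union) auto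
    then have o: "open (- \<Union>(T - {K}))" by (simp add: open_Compl)
    have yo: "y \<in> - \<Union>(T - {K})" using only y by blast
    have "y \<notin> D"
    proof
      assume "y \<in> D"
      let ?W = "D \<inter> - \<Union>(T - {K})"
      have "?W \<subseteq> K" using Union_T closure_subset[of D] by blast
      moreover have "open ?W" using o open_D by auto
      ultimately have "y \<in> interior K" using \<open>y \<in> D\<close> yo by (meson IntI interior_maximal subsetD)
      moreover have "closed_segment a b \<noteq> K"
      proof
        assume "closed_segment a b = K"
        then show False using e aff_dim_simplex[OF simplex_T[OF K]] by (simp add: edge_of_def)
      qed
      ultimately show False
        using face_of_disjoint_interior[OF f] y segment_open_subset_closed[of a b] by blast
    qed
    moreover have "y \<in> closure D" using yK K Union_T by blast
    ultimately show "y \<in> frontier D" using open_D by (simp add: frontier_def interior_open)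
  qed
  then have "closure (open_segment a b) \<subseteq> frontier D" by (rule closure_minimal) simp
  then show ?thesis using x by (auto simp: closure_open_segment split: if_splits)
qed

text \<open>Convergence in Hausdorff distance concerns the boundary as a set of points. This lemma
  makes it available for boundary vertices.\<close>

lemma boundary_vertex_near:
  assumes x: "x \<in> frontier D"
  obtains K v where "K \<in> T" "x \<in> K" "v \<in> verts K" "v \<in> frontier D"
proof -
  have "x \<in> \<Union>T" using x Union_T by (auto simp: frontier_def)
  then obtain K where K: "K \<in> T" "x \<in> K" by blast
  note S = simplex_T[OF K(1)]
  have ni: "x \<notin> interior K" using interior_subset_D[OF K(1)] x open_D by (auto simp: frontier_def interior_open)
  have "aff_dim K = 2" using aff_dim_simplex[OF S] .
  then have full: "affine hull K = UNIV" using aff_dim_eq_full[of K] by simp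
  then have "rel_interior K = interior K" by (rule rel_interior_interior)
  then have "x \<in> rel_frontier K" using K ni closed_T[OF K(1)] by (simp add: rel_frontier_def)
  then obtain F where F: "F facet_of K" "x \<in> F"
    using rel_frontier_of_polyhedron[OF simplex_imp_polyhedron[OF S]] by auto
  then have Fe: "F edge_of K" using \<open>aff_dim K = 2\<close> by (simp add: facet_of_def edge_of_def)
  obtain a b where ab: "F = closed_segment a b" "a \<noteq> b" by (rule edge_is_segment[OF K(1) Fe])
  have av: "a \<in> verts K" "b \<in> verts K"
    using edge_of_triangle[OF S] Fe ab by (metis insertI1 insertI2)+
  show thesis
  proof (cases "x = a \<or> x = b")
    case True
    then show thesis using that[OF K, of x] av x by auto
  next
    case False
    then have "x \<in> open_segment a b" using F ab by (simp add: open_segment_def)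
    then have "closed_segment a b \<subseteq> frontier D" using boundary_edge_of_point[OF K(1) _ _ x] Fe ab by blast
    then show thesis using that[OF K av(1)] by auto
  qed
qed

text \<open>Piecewise affine interpolation of the vertex values \<open>w\<close>. Choosing an
  element and barycentric coordinates in it makes linearity in \<open>w\<close> immediate, at every
  point of the plane; \<open>interp_eq\<close> shows that the choices do not matter on the
  mesh.\<close>

definition interp :: "(real^2 \<Rightarrow> real) \<Rightarrow> real^2 \<Rightarrow> real" where
  "interp w x = (let K = SOME K. K \<in> T \<and> x \<in> K;
      u = SOME u. (\<forall>v\<in>verts K. 0 \<le> u v) \<and> sum u (verts K) = 1 \<and> (\<Sum>v\<in>verts K. u v *\<^sub>R v) = x
    in \<Sum>v\<in>verts K. u v * w v)"

text \<open>Two elements meet in a common face, whose extreme points are vertices of both. The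
  affine interpolants on the two elements agree there, hence on the face, which is the convex hull
  of its extreme points.\<close>

lemma interp_eq:
  assumes K: "K \<in> T" and x: "x \<in> K" and g: "linear g" "\<And>v. v \<in> verts K \<Longrightarrow> affine_fun c g v = w v"
  shows "interp w x = affine_fun c g x"
proof -
  define K' where "K' = (SOME K. K \<in> T \<and> x \<in> K)"
  have K': "K' \<in> T" "x \<in> K'" using someI[of "\<lambda>K. K \<in> T \<and> x \<in> K"] K x unfolding K'_def by blast+
  note V = triangle_verts[OF simplex_T[OF K'(1)]]
  define u where "u = (SOME u. (\<forall>v\<in>verts K'. 0 \<le> u v) \<and> sum u (verts K') = 1 \<and> (\<Sum>v\<in>verts K'. u v *\<^sub>R v) = x)"
  have "x \<in> convex hull (verts K')" using K' V by simp
  then have "\<exists>u. (\<forall>v\<in>verts K'. 0 \<le> u v) \<and> sum u (verts K') = 1 \<and> (\<Sum>v\<in>verts K'. u v *\<^sub>R v) = x"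
    unfolding convex_hull_finite[OF V(1)] by blast
  from someI_ex[OF this] have u: "sum u (verts K') = 1" "(\<Sum>v\<in>verts K'. u v *\<^sub>R v) = x"
    unfolding u_def by blast+
  obtain c' g' where g': "linear g'" "\<And>v. v \<in> verts K' \<Longrightarrow> affine_fun c' g' v = w v"
    by (rule affine_interpolant[OF simplex_T[OF K'(1)], of w]) blast
  have "interp w x = (\<Sum>v\<in>verts K'. u v * w v)" by (simp add: interp_def K'_def u_def Let_def)
  also have "\<dots> = affine_fun c' g' x" using affine_fun_comb[OF g'(1) u(1), of c'] u(2) g'(2) by simp
  also have "\<dots> = affine_fun c g x"
  proof -
    let ?F = "K \<inter> K'" and ?E = "{x. affine_fun c' g' x = affine_fun c g x}"
    have "compact ?F" "convex ?F" using convex_T compact_T K K' by (auto intro: compact_Int convex_Int)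
    then have "?F = convex hull {v. v extreme_point_of ?F}" by (rule Krein_Milman_Minkowski)
    also have "\<dots> \<subseteq> ?E"
    proof (rule hull_minimal)
      show "{v. v extreme_point_of ?F} \<subseteq> ?E"
      proof
        fix v assume "v \<in> {v. v extreme_point_of ?F}"
        then have "v \<in> verts K" "v \<in> verts K'"
          using extreme_point_of_face[OF face_T[OF K K'(1)]] extreme_point_of_face[OF face_T'[OF K K'(1)]]
          by (auto simp: verts_def)
        then show "v \<in> ?E" using g(2) g'(2) by simp
      qed
      have "?E = {x. \<bar>affine_fun (c' - c) (\<lambda>x. g' x - g x) x - 0\<bar> \<le> 0}" by (auto simp: affine_fun_def)
      then show "convex ?E" using convex_affine_fun_band[OF linear_compose_sub[OF g'(1) g(1)], of "c' - c" 0 0] by (simp only:)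
    qed
    finally show ?thesis using K' x by blast
  qed
  finally show ?thesis .
qed

lemma interp_affine_on:
  assumes "K \<in> T"
  obtains c g where "linear g" "\<And>x. x \<in> K \<Longrightarrow> interp w x = affine_fun c g x"
    "\<And>v. v \<in> verts K \<Longrightarrow> affine_fun c g v = w v"
proof -
  obtain c g where g: "linear g" "\<And>v. v \<in> verts K \<Longrightarrow> affine_fun c g v = w v"
    by (rule affine_interpolant[OF simplex_T[OF assms], of w]) blast
  show thesis
  proof (rule that[OF g(1)])
    show "interp w x = affine_fun c g x" if "x \<in> K" for x by (rule interp_eq[OF assms that g])
  qed (rule g(2))
qed

lemma interp_add: "interp (\<lambda>v. w v + w' v) x = interp w x + interp w' x"
  by (simp add: interp_def Let_def sum.distrib distrib_left)

lemma interp_scale: "interp (\<lambda>v. a * w v) x = a * interp w x"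
  by (simp add: interp_def Let_def sum_distrib_left mult_ac)

lemma interp_continuous: "continuous_on (closure D) (interp w)"
proof -
  have "continuous_on (\<Union>K\<in>T. K) (interp w)"
  proof (rule continuous_on_closed_Union)
    fix K assume K: "K \<in> T"
    obtain c g where g: "linear g" "\<And>x. x \<in> K \<Longrightarrow> interp w x = affine_fun c g x"
      by (rule interp_affine_on[where w = w, OF K]) blast
    have "continuous_on K (affine_fun c g)" unfolding affine_fun_def[abs_def]
      by (intro continuous_intros linear_continuous_on_compose[OF continuous_on_id g(1), simplified])
    then show "continuous_on K (interp w)" using g(2) by (simp cong: continuous_on_cong)
  qed (auto intro: finite_T closed_T)
  then show ?thesis using Union_T by simp
qed

lemma interp_S1: "interp w \<in> S1 D T"
proof -
  have "\<exists>q\<in>polys 1. \<forall>x\<in>K. interp w x = q x" if K: "K \<in> T" for K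
    by (rule interp_affine_on[where w = w, OF K]) (use affine_fun_polys in blast)
  then show ?thesis using interp_continuous by (simp add: S1_def)
qed

lemma negligible_skeleton: "negligible (\<Union>K\<in>T. frontier K)"
  using finite_T convex_T negligible_convex_frontier by (intro negligible_Union) auto

lemma off_skeleton:
  assumes "x \<in> closure D" "x \<notin> (\<Union>K\<in>T. frontier K)"
  obtains K where "K \<in> T" "x \<in> interior K"
proof -
  obtain K where K: "K \<in> T" "x \<in> K" using assms Union_T by blast
  then have "x \<in> interior K" using assms closed_T[OF K(1)] by (auto simp: frontier_def)
  with K that show thesis by blast
qed

end

section \<open>The operator sCurl maps into the kernel of divdiv\<close>

lemma axis_norm [simp]: "norm (axis j (1::real) :: real^2) = 1"
  by (simp add: norm_axis_1)

lemma partial_deriv_eq: "(f has_derivative f') (at x) \<Longrightarrow> partial_deriv j f x = f' (axis j 1)"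
  using frechet_derivative_at[of f f' x] by (simp add: partial_deriv_def)

lemma partial_deriv_line:
  assumes "\<And>x. f differentiable (at x)"
  shows "((\<lambda>s. f (x + s *\<^sub>R axis i 1)) has_real_derivative partial_deriv i f (x + s *\<^sub>R axis i 1)) (at s)"
proof -
  let ?D = "frechet_derivative f (at (x + s *\<^sub>R axis i 1))"
  have f: "(f has_derivative ?D) (at (x + s *\<^sub>R axis i 1))"
    using assms frechet_derivative_works by blast
  have "((\<lambda>s. x + s *\<^sub>R axis i (1::real)) has_derivative (\<lambda>h. h *\<^sub>R axis i 1)) (at s)"
    by (auto intro!: derivative_eq_intros)
  from has_derivative_compose[OF this f]
  have "((\<lambda>s. f (x + s *\<^sub>R axis i 1)) has_derivative (\<lambda>h. ?D (h *\<^sub>R axis i 1))) (at s)" .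
  moreover have "?D (h *\<^sub>R axis i 1) = partial_deriv i f (x + s *\<^sub>R axis i 1) * h" for h
    using linear_scale[OF has_derivative_linear[OF f]] by (simp add: partial_deriv_def)
  ultimately show ?thesis by (simp add: has_field_derivative_def)
qed

lemma second_difference:
  assumes f: "\<And>x. f differentiable (at x)" and fi: "\<And>x. partial_deriv i f differentiable (at x)" and t: "0 < t"
  shows "\<exists>\<xi>. dist \<xi> x \<le> 2 * t \<and>
    f (x + t *\<^sub>R axis i 1 + t *\<^sub>R axis j 1) - f (x + t *\<^sub>R axis i 1) - f (x + t *\<^sub>R axis j 1) + f x
      = t\<^sup>2 * partial_deriv j (partial_deriv i f) \<xi>"
proof -
  let ?e = "axis i 1 :: real^2" let ?d = "axis j 1 :: real^2"
  let ?\<phi> = "\<lambda>s. f (x + t *\<^sub>R ?d + s *\<^sub>R ?e) - f (x + s *\<^sub>R ?e)"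
  have "\<exists>z. 0 < z \<and> z < t \<and> ?\<phi> t - ?\<phi> 0 = (t - 0) * (partial_deriv i f (x + t *\<^sub>R ?d + z *\<^sub>R ?e) - partial_deriv i f (x + z *\<^sub>R ?e))"
    by (rule MVT2[OF t]) (intro DERIV_diff partial_deriv_line f)
  then obtain z where z: "0 < z" "z < t"
    "?\<phi> t - ?\<phi> 0 = t * (partial_deriv i f (x + t *\<^sub>R ?d + z *\<^sub>R ?e) - partial_deriv i f (x + z *\<^sub>R ?e))" by auto
  let ?\<psi> = "\<lambda>s. partial_deriv i f (x + z *\<^sub>R ?e + s *\<^sub>R ?d)"
  have "\<exists>w. 0 < w \<and> w < t \<and> ?\<psi> t - ?\<psi> 0 = (t - 0) * partial_deriv j (partial_deriv i f) (x + z *\<^sub>R ?e + w *\<^sub>R ?d)"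
    by (rule MVT2[OF t]) (intro partial_deriv_line fi)
  then obtain w where w: "0 < w" "w < t"
    "?\<psi> t - ?\<psi> 0 = t * partial_deriv j (partial_deriv i f) (x + z *\<^sub>R ?e + w *\<^sub>R ?d)" by auto
  let ?\<xi> = "x + z *\<^sub>R ?e + w *\<^sub>R ?d"
  have "dist ?\<xi> x = norm (z *\<^sub>R ?e + w *\<^sub>R ?d)" by (simp add: dist_norm add.assoc)
  also have "\<dots> \<le> z + w" using norm_triangle_ineq[of "z *\<^sub>R ?e" "w *\<^sub>R ?d"] z w by simp
  finally have "dist ?\<xi> x \<le> 2 * t" using z w by simp
  moreover have "?\<phi> t - ?\<phi> 0 = t\<^sup>2 * partial_deriv j (partial_deriv i f) ?\<xi>"
    using z(3) w(3) by (simp add: power2_eq_square add_ac)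
  ultimately show ?thesis by (intro exI[of _ ?\<xi>]) (simp add: algebra_simps)
qed

text \<open>The second difference of \<open>f\<close> is symmetric in \<open>i\<close> and
  \<open>j\<close>, and by \<open>second_difference\<close> it approximates either of the mixed
  derivatives.\<close>

lemma partial_deriv_commute:
  assumes f: "\<And>x. f differentiable (at x)" and fi: "\<And>i x. partial_deriv i f differentiable (at x)"
    and c: "\<And>i j. continuous_on UNIV (partial_deriv i (partial_deriv j f))"
  shows "partial_deriv i (partial_deriv j f) x = partial_deriv j (partial_deriv i f) x"
proof -
  let ?a = "partial_deriv i (partial_deriv j f)" let ?b = "partial_deriv j (partial_deriv i f)"
  have "\<bar>?a x - ?b x\<bar> \<le> e" if "e > 0" for e
  proof -
    have e2: "e / 2 > 0" using that by simp
    obtain d1 where d1: "d1 > 0" "\<And>y. dist y x < d1 \<Longrightarrow> dist (?a y) (?a x) < e/2"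
      using c[of i j, unfolded continuous_on_iff, rule_format, OF UNIV_I e2, of x] by auto
    obtain d2 where d2: "d2 > 0" "\<And>y. dist y x < d2 \<Longrightarrow> dist (?b y) (?b x) < e/2"
      using c[of j i, unfolded continuous_on_iff, rule_format, OF UNIV_I e2, of x] by auto
    define t where "t = min d1 d2 / 3"
    have t: "t > 0" "2 * t < d1" "2 * t < d2" using d1 d2 by (auto simp: t_def)
    obtain y where y: "dist y x \<le> 2 * t" "f (x + t *\<^sub>R axis i 1 + t *\<^sub>R axis j 1) - f (x + t *\<^sub>R axis i 1) - f (x + t *\<^sub>R axis j 1) + f x
      = t\<^sup>2 * ?b y" using second_difference[OF f fi t(1), of x i j] by blast
    obtain z where z: "dist z x \<le> 2 * t" "f (x + t *\<^sub>R axis j 1 + t *\<^sub>R axis i 1) - f (x + t *\<^sub>R axis j 1) - f (x + t *\<^sub>R axis i 1) + f x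
      = t\<^sup>2 * ?a z" using second_difference[OF f fi t(1), of x j i] by blast
    have "f (x + t *\<^sub>R axis j 1 + t *\<^sub>R axis i 1) = f (x + t *\<^sub>R axis i 1 + t *\<^sub>R axis j 1)" by (simp add: add_ac)
    then have "t\<^sup>2 * ?b y = t\<^sup>2 * ?a z" using y(2) z(2) by linarith
    then have "?b y = ?a z" using t by simp
    moreover have "dist (?a z) (?a x) < e/2" using d1(2) z(1) t by simp
    moreover have "dist (?b y) (?b x) < e/2" using d2(2) y(1) t by simp
    ultimately show ?thesis unfolding dist_real_def by linarith
  qed
  then have "\<bar>?a x - ?b x\<bar> \<le> 0" by (rule field_le_epsilon[of _ 0, simplified])
  then show ?thesis by simp
qed

lemma partial_deriv_zero_outside:
  assumes "closed S" "\<And>x. x \<notin> S \<Longrightarrow> f x = 0" "x \<notin> S"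
  shows "partial_deriv j f x = 0"
proof -
  have "((\<lambda>_. 0) has_derivative (\<lambda>_. 0)) (at x)" by simp
  then have "(f has_derivative (\<lambda>_. 0)) (at x)"
    by (rule has_derivative_transform_within_open[of _ _ _ UNIV "- S"]) (use assms in auto)
  then show ?thesis by (simp add: partial_deriv_eq)
qed

definition C1_supp :: "(real^2) set \<Rightarrow> (real^2 \<Rightarrow> real) \<Rightarrow> bool" where
  "C1_supp S G \<longleftrightarrow> (\<forall>x. G differentiable (at x)) \<and> (\<forall>j. continuous_on UNIV (partial_deriv j G)) \<and> (\<forall>x. x \<notin> S \<longrightarrow> G x = 0)"

lemma bounded_of_compact_support:
  fixes f :: "real^2 \<Rightarrow> real"
  assumes "compact S" "continuous_on UNIV f" "\<And>x. x \<notin> S \<Longrightarrow> f x = 0"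
  obtains B where "0 \<le> B" "\<And>x. \<bar>f x\<bar> \<le> B"
proof -
  have "bounded (f ` S)"
    using assms(1) continuous_on_subset[OF assms(2)] by (intro compact_imp_bounded compact_continuous_image) auto
  then obtain B where B: "\<And>x. x \<in> S \<Longrightarrow> \<bar>f x\<bar> \<le> B" by (auto simp: bounded_iff)
  show thesis
  proof (rule that[of "max B 0"])
    show "\<bar>f x\<bar> \<le> max B 0" for x using B[of x] assms(3)[of x] by (cases "x \<in> S") auto
  qed simp
qed

lemma C1_supp_lipschitz:
  assumes S: "compact S" and G: "C1_supp S G"
  obtains M where "0 \<le> M" "\<And>x y. \<bar>G x - G y\<bar> \<le> M * dist x y"
proof -
  have diff: "\<And>x. G differentiable (at x)" and c: "\<And>j. continuous_on UNIV (partial_deriv j G)"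
    and z: "\<And>x. x \<notin> S \<Longrightarrow> G x = 0" using G by (auto simp: C1_supp_def)
  have "\<exists>B\<ge>0. \<forall>x. \<bar>partial_deriv j G x\<bar> \<le> B" for j
    by (rule bounded_of_compact_support[OF S c[of j] partial_deriv_zero_outside[OF compact_imp_closed[OF S] z]]) auto
  then obtain B where B: "\<And>j. 0 \<le> B j" "\<And>j x. \<bar>partial_deriv j G x\<bar> \<le> B j" by metis
  have der: "(G has_derivative frechet_derivative G (at x)) (at x)" for x
    using diff frechet_derivative_works by blast
  have on: "onorm (frechet_derivative G (at x)) \<le> B 1 + B 2" for x
  proof (rule onorm_le)
    fix h :: "real^2"
    let ?D = "frechet_derivative G (at x)"
    have lin: "linear ?D" using der has_derivative_linear by blast
    have "h = h$1 *\<^sub>R axis 1 1 + h$2 *\<^sub>R axis 2 1" by (simp add: vec_eq_iff forall_2 axis_def)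
    from arg_cong[OF this, of ?D]
    have "?D h = h$1 * partial_deriv 1 G x + h$2 * partial_deriv 2 G x"
      by (simp add: linear_add[OF lin] linear_scale[OF lin] partial_deriv_def)
    then have "norm (?D h) \<le> \<bar>h$1\<bar> * \<bar>partial_deriv 1 G x\<bar> + \<bar>h$2\<bar> * \<bar>partial_deriv 2 G x\<bar>"
      by (simp add: abs_triangle_ineq flip: abs_mult)
    also have "\<dots> \<le> norm h * B 1 + norm h * B 2"
      using B by (intro add_mono mult_mono) (auto simp: component_le_norm_cart)
    finally show "norm (?D h) \<le> (B 1 + B 2) * norm h" by (simp add: algebra_simps)
  qed
  show thesis
  proof (rule that[of "B 1 + B 2"])
    show "\<bar>G x - G y\<bar> \<le> (B 1 + B 2) * dist x y" for x y
      using differentiable_bound[OF convex_UNIV der on, of x y] by (simp add: dist_norm)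
  qed (use B in auto)
qed

lemma integrable_continuous_compact_support:
  fixes f :: "real^2 \<Rightarrow> real"
  assumes "compact S" "continuous_on UNIV f" "\<And>x. x \<notin> S \<Longrightarrow> f x = 0"
  shows "integrable lborel f"
proof -
  have "integrable lborel (\<lambda>x. indicator S x *\<^sub>R f x)"
    using assms(1) continuous_on_subset[OF assms(2)] by (intro borel_integrable_compact) auto
  moreover have "(\<lambda>x. indicator S x *\<^sub>R f x) = f"
    by (rule ext) (use assms(3) in \<open>auto simp: indicator_def\<close>)
  ultimately show ?thesis by simp
qed

lemma integral_shift:
  fixes f :: "real^2 \<Rightarrow> real"
  assumes "integrable lborel f"
  shows "integrable lborel (\<lambda>x. f (a + x))" "(\<integral>x. f (a + x) \<partial>lborel) = (\<integral>x. f x \<partial>lborel)"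
proof -
  have [measurable]: "f \<in> borel_measurable borel" using borel_measurable_integrable[OF assms] by simp
  have "integrable (distr lborel borel ((+) a)) f" using assms by (simp add: lborel_distr_plus)
  then show "integrable lborel (\<lambda>x. f (a + x))" by (subst (asm) integrable_distr_eq) auto
  have "(\<integral>x. f x \<partial>distr lborel borel ((+) a)) = (\<integral>x. f (a + x) \<partial>lborel)"
    by (subst integral_distr) auto
  then show "(\<integral>x. f (a + x) \<partial>lborel) = (\<integral>x. f x \<partial>lborel)" by (simp add: lborel_distr_plus)
qed

context mesh begin

lemma sets_D: "D \<in> sets lebesgue"
  using borel_open[OF open_D] by simp

text \<open>The elements cut the segment into finitely many closed pieces, on each of which the
  function is affine.\<close>

lemma interp_lipschitz_segment:
  obtains L where "0 \<le> L" "\<And>x y. closed_segment x y \<subseteq> closure D \<Longrightarrow> \<bar>interp w x - interp w y\<bar> \<le> L * dist x y"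
proof -
  have "\<exists>L\<ge>0. \<forall>x\<in>K. \<forall>y\<in>K. \<bar>interp w x - interp w y\<bar> \<le> L * dist x y" if K: "K \<in> T" for K
  proof -
    obtain c g where g: "linear g" "\<And>x. x \<in> K \<Longrightarrow> interp w x = affine_fun c g x"
      by (rule interp_affine_on[where w = w, OF K]) blast
    obtain B where B: "B > 0" "\<And>x. norm (g x) \<le> B * norm x" using linear_bounded_pos[OF g(1)] by blast
    have "\<bar>interp w x - interp w y\<bar> \<le> B * dist x y" if "x \<in> K" "y \<in> K" for x y
      using B(2)[of "x - y"] g(2) that by (simp add: affine_fun_diff[OF g(1)] dist_norm)
    then show ?thesis using B(1) by (intro exI[of _ B]) auto
  qed
  then obtain L where L: "\<And>K. K \<in> T \<Longrightarrow> 0 \<le> L K"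
    "\<And>K x y. K \<in> T \<Longrightarrow> x \<in> K \<Longrightarrow> y \<in> K \<Longrightarrow> \<bar>interp w x - interp w y\<bar> \<le> L K * dist x y"
    by metis
  define M where "M = (\<Sum>K\<in>T. L K)"
  have M0: "0 \<le> M" unfolding M_def using L(1) by (intro sum_nonneg) auto
  have LM: "L K \<le> M" if "K \<in> T" for K
    unfolding M_def using that L(1) finite_T by (intro member_le_sum) auto
  show thesis
  proof (rule that[OF M0])
    fix x y assume seg: "closed_segment x y \<subseteq> closure D"
    define \<sigma> where "\<sigma> = (\<lambda>t::real. x + t *\<^sub>R (y - x))"
    have d\<sigma>: "dist (\<sigma> s) (\<sigma> t) = \<bar>s - t\<bar> * dist x y" for s t
      by (simp add: \<sigma>_def dist_norm norm_minus_commute flip: scaleR_diff_left)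
    have c\<sigma>: "continuous_on UNIV \<sigma>" unfolding \<sigma>_def by (intro continuous_intros)
    have "(M * dist x y)-lipschitz_on {0..1} (\<lambda>t. interp w (\<sigma> t))"
    proof (rule lipschitz_on_closed_Union)
      fix K assume K: "K \<in> T"
      show "closed (\<sigma> -` K)" using c\<sigma> closed_T[OF K] by (simp add: continuous_on_closed_vimage)
      show "(M * dist x y)-lipschitz_on (\<sigma> -` K) (\<lambda>t. interp w (\<sigma> t))"
      proof (rule lipschitz_onI)
        fix s t assume "s \<in> \<sigma> -` K" "t \<in> \<sigma> -` K"
        then have "\<bar>interp w (\<sigma> s) - interp w (\<sigma> t)\<bar> \<le> L K * dist (\<sigma> s) (\<sigma> t)" using L(2)[OF K] by simp
        also have "\<dots> \<le> M * dist (\<sigma> s) (\<sigma> t)" using LM[OF K] by (intro mult_right_mono) auto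
        finally show "dist (interp w (\<sigma> s)) (interp w (\<sigma> t)) \<le> M * dist x y * dist s t"
          by (simp add: dist_real_def d\<sigma> mult_ac)
      qed (use M0 in auto)
    next
      show "{0..1} \<subseteq> (\<Union>K\<in>T. \<sigma> -` K)"
      proof
        fix t :: real assume "t \<in> {0..1}"
        then have "\<sigma> t \<in> closed_segment x y" unfolding \<sigma>_def closed_segment_def
          by (intro CollectI exI[of _ t]) (simp add: algebra_simps)
        then have "\<sigma> t \<in> \<Union>T" using seg Union_T by auto
        then show "t \<in> (\<Union>K\<in>T. \<sigma> -` K)" by auto
      qed
    qed (use finite_T M0 in auto)
    from lipschitz_onD[OF this, of 0 1]
    show "\<bar>interp w x - interp w y\<bar> \<le> M * dist x y" by (simp add: \<sigma>_def dist_real_def)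
  qed
qed

lemma interp_bounded:
  obtains B where "0 \<le> B" "\<And>x. x \<in> closure D \<Longrightarrow> \<bar>interp w x\<bar> \<le> B"
proof -
  have "bounded (interp w ` closure D)"
    using bounded_D by (intro compact_imp_bounded compact_continuous_image interp_continuous) (simp add: compact_closure)
  then obtain B where B: "\<And>x. x \<in> closure D \<Longrightarrow> \<bar>interp w x\<bar> \<le> B" by (auto simp: bounded_iff)
  show thesis by (rule that[of "max B 0"]) (use B in \<open>auto simp: le_max_iff_disj\<close>)
qed

text \<open>If one of two close points belongs to \<open>S\<close>, the segment between them lies in
  the domain, and \<open>interp_lipschitz_segment\<close> applies. Otherwise both products
  vanish.\<close>

lemma product_locally_lipschitz:
  assumes S: "compact S" "S \<subseteq> D" and G: "\<And>x. x \<notin> S \<Longrightarrow> G x = 0"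
    and lip: "0 \<le> M" "\<And>x y. \<bar>G x - G y\<bar> \<le> M * dist x y" and bd: "0 \<le> B" "\<And>x. \<bar>G x\<bar> \<le> B"
  obtains C \<delta> where "0 < \<delta>" "0 \<le> C"
    "\<And>x y. dist x y < \<delta> \<Longrightarrow> \<bar>interp w x * G x - interp w y * G y\<bar> \<le> C * dist x y"
proof -
  obtain \<delta> where \<delta>: "\<delta> > 0" "(\<Union>x\<in>S. ball x \<delta>) \<subseteq> D"
    by (rule compact_subset_open_imp_ball_epsilon_subset[OF S(1) open_D S(2)])
  obtain L where L: "0 \<le> L" "\<And>x y. closed_segment x y \<subseteq> closure D \<Longrightarrow> \<bar>interp w x - interp w y\<bar> \<le> L * dist x y"
    by (rule interp_lipschitz_segment[where w = w]) blast
  obtain U where U: "0 \<le> U" "\<And>x. x \<in> closure D \<Longrightarrow> \<bar>interp w x\<bar> \<le> U"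
    by (rule interp_bounded[where w = w]) blast
  have main: "\<bar>interp w x * G x - interp w y * G y\<bar> \<le> (L * B + U * M) * dist x y"
    if x: "x \<in> S" and d: "dist x y < \<delta>" for x y
  proof -
    have "closed_segment x y \<subseteq> ball x \<delta>" using d \<delta> by (intro closed_segment_subset) auto
    then have seg: "closed_segment x y \<subseteq> closure D" using \<delta>(2) x closure_subset by blast
    then have yD: "y \<in> closure D" by auto
    have "interp w x * G x - interp w y * G y = (interp w x - interp w y) * G x + interp w y * (G x - G y)"
      by (simp add: algebra_simps)
    also have "\<bar>\<dots>\<bar> \<le> \<bar>interp w x - interp w y\<bar> * \<bar>G x\<bar> + \<bar>interp w y\<bar> * \<bar>G x - G y\<bar>"
      by (simp add: abs_triangle_ineq flip: abs_mult)
    also have "\<dots> \<le> (L * dist x y) * B + U * (M * dist x y)"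
      using L(2)[OF seg] U(2)[OF yD] lip bd L(1) U(1) by (intro add_mono mult_mono) auto
    finally show ?thesis by (simp add: algebra_simps)
  qed
  show thesis
  proof (rule that[OF \<delta>(1), of "L * B + U * M"])
    show "0 \<le> L * B + U * M" using L U lip bd by simp
    fix x y :: "real^2" assume d: "dist x y < \<delta>"
    consider "x \<in> S" | "y \<in> S" | "x \<notin> S" "y \<notin> S" by blast
    then show "\<bar>interp w x * G x - interp w y * G y\<bar> \<le> (L * B + U * M) * dist x y"
    proof cases
      case 2
      then show ?thesis using main[of y x] d by (simp add: dist_commute abs_minus_commute)
    next
      case 3
      then show ?thesis using G L U lip bd by simp
    qed (use main d in auto)
  qed
qed

lemma interp_times_continuous:
  assumes S: "compact S" "S \<subseteq> D" and G: "\<And>x. x \<notin> S \<Longrightarrow> G x = 0" and c: "continuous_on UNIV G"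
  shows "continuous_on UNIV (\<lambda>x. interp w x * G x)"
proof -
  have "continuous_on (D \<union> - S) (\<lambda>x. interp w x * G x)"
  proof (rule continuous_on_open_Un)
    show "continuous_on D (\<lambda>x. interp w x * G x)"
      using continuous_on_subset[OF interp_continuous closure_subset] continuous_on_subset[OF c]
      by (intro continuous_on_mult) auto
    show "continuous_on (- S) (\<lambda>x. interp w x * G x)"
      by (rule continuous_on_eq[of _ "\<lambda>_. 0"]) (auto simp: G)
  qed (use open_D S in \<open>auto intro: compact_imp_closed simp: open_Compl\<close>)
  moreover have "D \<union> - S = UNIV" using S by auto
  ultimately show ?thesis by simp
qed

lemma interp_partial_deriv:
  assumes K: "K \<in> T" and g: "linear g" "\<And>x. x \<in> K \<Longrightarrow> interp w x = affine_fun c g x" and x: "x \<in> interior K"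
  shows "(interp w has_derivative g) (at x)" "partial_deriv j (interp w) x = g (axis j 1)"
proof -
  have "bounded_linear g" using g(1) by (simp add: linear_conv_bounded_linear)
  then have "(affine_fun c g has_derivative g) (at x)" unfolding affine_fun_def[abs_def]
    by (auto intro!: derivative_eq_intros bounded_linear_imp_has_derivative)
  then show "(interp w has_derivative g) (at x)"
    by (rule has_derivative_transform_within_open[of _ _ _ UNIV "interior K"])
      (use x g(2) in \<open>auto dest: subsetD[OF interior_subset]\<close>)
  then show "partial_deriv j (interp w) x = g (axis j 1)" by (rule partial_deriv_eq)
qed

lemma product_difference_quotient:
  assumes S: "compact S" "S \<subseteq> D" and G: "C1_supp S G" and x: "x \<notin> (\<Union>K\<in>T. frontier K)"
    and t: "t \<longlonglongrightarrow> 0" "\<And>n. t n > 0"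
  shows "(\<lambda>n. (interp w (t n *\<^sub>R axis j 1 + x) * G (t n *\<^sub>R axis j 1 + x) - interp w x * G x) / t n)
     \<longlonglongrightarrow> partial_deriv j (interp w) x * G x + interp w x * partial_deriv j G x"
proof -
  let ?e = "axis j 1 :: real^2"
  have Gz: "\<And>x. x \<notin> S \<Longrightarrow> G x = 0" and Gd: "\<And>x. G differentiable (at x)" using G by (auto simp: C1_supp_def)
  have "\<exists>D'. ((\<lambda>x. interp w x * G x) has_derivative D') (at x) \<and>
     D' ?e = partial_deriv j (interp w) x * G x + interp w x * partial_deriv j G x"
  proof (cases "x \<in> closure D")
    case True
    obtain K where K: "K \<in> T" "x \<in> interior K" by (rule off_skeleton[OF True x])
    obtain c g where g: "linear g" "\<And>x. x \<in> K \<Longrightarrow> interp w x = affine_fun c g x"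
      by (rule interp_affine_on[where w = w, OF K(1)]) blast
    note d = interp_partial_deriv[OF K(1) g K(2)]
    have "(G has_derivative frechet_derivative G (at x)) (at x)" using Gd frechet_derivative_works by blast
    from has_derivative_mult[OF d(1) this] show ?thesis
      by (intro exI conjI) (assumption, simp add: d(2) partial_deriv_def[of j G x])
  next
    case False
    then have xS: "x \<notin> S" using S closure_subset by blast
    have cl: "closed S" using S by (simp add: compact_imp_closed)
    have "((\<lambda>_. 0) has_derivative (\<lambda>_. 0)) (at x)" by simp
    then have "((\<lambda>x. interp w x * G x) has_derivative (\<lambda>_. 0)) (at x)"
      by (rule has_derivative_transform_within_open[of _ _ _ UNIV "- S"]) (use xS cl Gz in auto)
    then show ?thesis using xS Gz partial_deriv_zero_outside[OF cl Gz xS] by (intro exI conjI) auto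
  qed
  then obtain D' where D': "((\<lambda>x. interp w x * G x) has_derivative D') (at x)"
    "D' ?e = partial_deriv j (interp w) x * G x + interp w x * partial_deriv j G x" by blast
  have "((\<lambda>s. x + s *\<^sub>R ?e) has_derivative (\<lambda>h. h *\<^sub>R ?e)) (at (0::real))"
    by (auto intro!: derivative_eq_intros)
  then have "((\<lambda>s. interp w (x + s *\<^sub>R ?e) * G (x + s *\<^sub>R ?e)) has_derivative (\<lambda>h. D' (h *\<^sub>R ?e))) (at (0::real))"
    by (rule has_derivative_compose) (use D' in simp)
  moreover have "D' (h *\<^sub>R ?e) = D' ?e * h" for h
    using linear_scale[OF has_derivative_linear[OF D'(1)]] by simp
  ultimately have "((\<lambda>s. interp w (x + s *\<^sub>R ?e) * G (x + s *\<^sub>R ?e)) has_real_derivative D' ?e) (at 0)"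
    by (simp add: has_field_derivative_def)
  then have lim: "((\<lambda>s. (interp w (x + s *\<^sub>R ?e) * G (x + s *\<^sub>R ?e) - interp w x * G x) / s) \<longlongrightarrow> D' ?e) (at 0)"
    by (simp add: DERIV_def)
  have "filterlim t (at 0) sequentially"
    using t by (intro filterlim_atI) (auto simp: less_imp_neq[symmetric])
  from filterlim_compose[OF lim this] D'(2) show ?thesis by (simp add: add.commute)
qed

text \<open>The product of the two functions has compact support, so by translation invariance its
  difference quotients have integral zero. They are bounded, with uniformly bounded supports, and
  converge off the mesh skeleton, which is a null set. By dominated convergence the integral of the
  derivative of the product vanishes.\<close>

theorem interp_weak_derivative:
  assumes S: "compact S" "S \<subseteq> D" and G: "C1_supp S G"
  shows "integrable lebesgue (\<lambda>x. partial_deriv j (interp w) x * G x)"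
    and "(\<integral>x. partial_deriv j (interp w) x * G x \<partial>lebesgue) = - (\<integral>x. interp w x * partial_deriv j G x \<partial>lebesgue)"
proof -
  let ?e = "axis j 1 :: real^2"
  let ?\<phi> = "\<lambda>x. interp w x * G x"
  let ?lim = "\<lambda>x. partial_deriv j (interp w) x * G x + interp w x * partial_deriv j G x"
  have Gz: "\<And>x. x \<notin> S \<Longrightarrow> G x = 0" and Gd: "\<And>x. G differentiable (at x)"
    and Gc: "continuous_on UNIV (partial_deriv j G)" using G by (auto simp: C1_supp_def)
  have cG: "continuous_on UNIV G" using Gd by (simp add: differentiable_imp_continuous_within continuous_on_eq_continuous_within)
  have Gz': "partial_deriv j G x = 0" if "x \<notin> S" for x
    using partial_deriv_zero_outside[OF compact_imp_closed[OF S(1)] Gz that] .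
  obtain M where M: "0 \<le> M" "\<And>x y. \<bar>G x - G y\<bar> \<le> M * dist x y" by (rule C1_supp_lipschitz[OF S(1) G]) blast
  obtain B where B: "0 \<le> B" "\<And>x. \<bar>G x\<bar> \<le> B" by (rule bounded_of_compact_support[OF S(1) cG Gz]) auto
  obtain C \<delta> where C: "0 < \<delta>" "0 \<le> C"
    "\<And>x y. dist x y < \<delta> \<Longrightarrow> \<bar>?\<phi> x - ?\<phi> y\<bar> \<le> C * dist x y"
    by (rule product_locally_lipschitz[where w = w, OF S Gz M B]) blast+
  have c\<phi>: "continuous_on UNIV ?\<phi>" by (rule interp_times_continuous[OF S Gz cG])
  have int\<phi>: "integrable lborel ?\<phi>" by (rule integrable_continuous_compact_support[OF S(1) c\<phi>]) (simp add: Gz)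
  have cd: "continuous_on UNIV (\<lambda>x. interp w x * partial_deriv j G x)"
    by (rule interp_times_continuous[OF S Gz' Gc])
  have intd: "integrable lborel (\<lambda>x. interp w x * partial_deriv j G x)"
    by (rule integrable_continuous_compact_support[OF S(1) cd]) (simp add: Gz')
  define t where "t = (\<lambda>n. \<delta> / (real n + 2))"
  have t: "t n > 0" "t n < \<delta>" for n
  proof -
    have "0 < \<delta> * (real n + 1)" using C(1) by (intro mult_pos_pos) auto
    then show "t n > 0" "t n < \<delta>" using C(1) by (auto simp: t_def field_simps)
  qed
  have tlim: "t \<longlonglongrightarrow> 0" 
    using LIMSEQ_ignore_initial_segment[OF lim_const_over_n[of \<delta>], of 2] by (simp add: t_def add.commute)
  define \<psi> where "\<psi> = (\<lambda>n x. (?\<phi> (t n *\<^sub>R ?e + x) - ?\<phi> x) / t n)"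
  obtain R where R: "\<And>x. x \<in> S \<Longrightarrow> norm x \<le> R" using compact_imp_bounded[OF S(1)] by (auto simp: bounded_iff)
  let ?Q = "cball 0 (R + \<delta>) :: (real^2) set"
  have bound: "norm (\<psi> n x) \<le> C * indicator ?Q x" for n x
  proof (cases "x \<in> ?Q")
    case True
    have "\<bar>?\<phi> (t n *\<^sub>R ?e + x) - ?\<phi> x\<bar> \<le> C * dist (t n *\<^sub>R ?e + x) x"
      by (rule C(3)) (use t[of n] in \<open>simp add: dist_norm\<close>)
    then show ?thesis using True t[of n] by (simp add: \<psi>_def dist_norm abs_divide field_simps)
  next
    case False
    then have nx: "norm x > R + \<delta>" by simp
    then have "x \<notin> S" using R C(1) by fastforce
    moreover have "t n *\<^sub>R ?e + x \<notin> S"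
    proof
      assume "t n *\<^sub>R ?e + x \<in> S"
      then have "norm (t n *\<^sub>R ?e + x) \<le> R" by (rule R)
      moreover have "norm x \<le> norm (t n *\<^sub>R ?e + x) + t n"
        using norm_triangle_ineq4[of "t n *\<^sub>R ?e + x" "t n *\<^sub>R ?e"] t[of n] by simp
      ultimately show False using nx t[of n] by simp
    qed
    ultimately show ?thesis using False C by (simp add: \<psi>_def Gz)
  qed
  have m\<phi>: "?\<phi> \<in> borel_measurable borel" using c\<phi> by (rule borel_measurable_continuous_onI)
  have m\<psi>: "\<psi> n \<in> borel_measurable borel" for n
    unfolding \<psi>_def using m\<phi> by (intro borel_measurable_divide borel_measurable_diff measurable_compose[OF _ m\<phi>]) auto
  have int\<psi>: "(\<integral>x. \<psi> n x \<partial>lebesgue) = 0" for n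
  proof -
    have "(\<integral>x. \<psi> n x \<partial>lebesgue) = (\<integral>x. \<psi> n x \<partial>lborel)" using m\<psi> by (intro integral_completion) auto
    also have "\<dots> = ((\<integral>x. ?\<phi> (t n *\<^sub>R ?e + x) \<partial>lborel) - (\<integral>x. ?\<phi> x \<partial>lborel)) / t n"
      unfolding \<psi>_def using integral_shift(1)[OF int\<phi>] int\<phi> by simp
    also have "\<dots> = 0" using integral_shift(2)[OF int\<phi>, of "t n *\<^sub>R ?e"] by simp
    finally show ?thesis .
  qed
  have ae: "AE x in lebesgue. (\<lambda>n. \<psi> n x) \<longlonglongrightarrow> ?lim x"
  proof (rule AE_I')
    show "(\<Union>K\<in>T. frontier K) \<in> null_sets lebesgue"
      using negligible_skeleton by (simp add: negligible_iff_null_sets)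
    show "{x \<in> space lebesgue. \<not> (\<lambda>n. \<psi> n x) \<longlonglongrightarrow> ?lim x} \<subseteq> (\<Union>K\<in>T. frontier K)"
      using product_difference_quotient[OF S G _ tlim t(1), where w = w and j = j] unfolding \<psi>_def by blast
  qed
  have mlim: "?lim \<in> borel_measurable lebesgue"
  proof (rule borel_measurable_AE)
    show "(\<lambda>x. lim (\<lambda>n. \<psi> n x)) \<in> borel_measurable lebesgue"
      using m\<psi> by (intro borel_measurable_lim_metric measurable_completion) auto
    show "AE x in lebesgue. lim (\<lambda>n. \<psi> n x) = ?lim x" using ae by (auto intro: limI)
  qed
  have intQ: "integrable lebesgue (\<lambda>x. C * indicator ?Q x :: real)"
    using lmeasurable_cball[of "0 :: real^2" "R + \<delta>"]
    by (intro integrable_mult_right) (simp add: lmeasurable_iff_integrable)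
  have mpsi': "\<psi> n \<in> borel_measurable lebesgue" for n using m\<psi> by (intro measurable_completion) auto
  have bd: "AE x in lebesgue. norm (\<psi> n x) \<le> C * indicator ?Q x" for n using bound by simp
  have intlim: "integrable lebesgue ?lim"
    by (rule integrable_dominated_convergence[OF mlim mpsi' intQ ae bd])
  have "(\<lambda>n. \<integral>x. \<psi> n x \<partial>lebesgue) \<longlonglongrightarrow> (\<integral>x. ?lim x \<partial>lebesgue)"
    by (rule integral_dominated_convergence[OF mlim mpsi' intQ ae bd])
  then have zero: "(\<integral>x. ?lim x \<partial>lebesgue) = 0" unfolding int\<psi> by (simp add: LIMSEQ_const_iff)
  have intd': "integrable lebesgue (\<lambda>x. interp w x * partial_deriv j G x)"
    using intd borel_measurable_integrable[OF intd] by (subst integrable_completion) auto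
  have eq: "(\<lambda>x. partial_deriv j (interp w) x * G x) = (\<lambda>x. ?lim x - interp w x * partial_deriv j G x)" by auto
  show "integrable lebesgue (\<lambda>x. partial_deriv j (interp w) x * G x)"
    unfolding eq by (intro Bochner_Integration.integrable_diff intlim intd')
  show "(\<integral>x. partial_deriv j (interp w) x * G x \<partial>lebesgue) = - (\<integral>x. interp w x * partial_deriv j G x \<partial>lebesgue)"
    unfolding eq using zero by (subst Bochner_Integration.integral_diff[OF intlim intd']) simp
qed

lemma interp_rotated_gradient_orthogonal:
  assumes S: "compact S" "S \<subseteq> D" and F: "C1_supp S F" "\<And>j. C1_supp S (partial_deriv j F)"
  shows "(\<integral>x. partial_deriv 2 (interp w) x * partial_deriv 1 F x \<partial>lebesgue)
    = (\<integral>x. partial_deriv 1 (interp w) x * partial_deriv 2 F x \<partial>lebesgue)"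
proof -
  have "partial_deriv 2 (partial_deriv 1 F) x = partial_deriv 1 (partial_deriv 2 F) x" for x
    using F by (intro partial_deriv_commute) (auto simp: C1_supp_def)
  then show ?thesis
    by (simp add: interp_weak_derivative(2)[OF S F(2)])
qed

lemma test_function_C1_supp:
  assumes "test_function D f"
  shows "compact (closure {x. f x \<noteq> 0})" "closure {x. f x \<noteq> 0} \<subseteq> D"
    "C1_supp (closure {x. f x \<noteq> 0}) (foldr partial_deriv js f)"
proof -
  let ?S = "closure {x. f x \<noteq> 0}"
  have diff: "foldr partial_deriv js f differentiable (at x)" for js x
    using assms by (simp add: test_function_def differentiable_on_def)
  have "continuous_on UNIV (partial_deriv j (foldr partial_deriv js f))" for j
    using diff[of "j # js"] by (simp add: differentiable_imp_continuous_within continuous_on_eq_continuous_within)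
  moreover have "foldr partial_deriv js f x = 0" if "x \<notin> ?S" for x
    using that
  proof (induction js arbitrary: x)
    case Nil
    then show ?case using closure_subset[of "{x. f x \<noteq> 0}"] by auto
  next
    case (Cons j js)
    then show ?case using partial_deriv_zero_outside[of ?S "foldr partial_deriv js f" x j] by simp
  qed
  ultimately show "C1_supp ?S (foldr partial_deriv js f)" using diff by (simp add: C1_supp_def)
qed (use assms in \<open>auto simp: test_function_def\<close>)

text \<open>As the Hessian of a test function \<open>f\<close> is symmetric, its product with
  \<open>sCurl p\<close> equals that with \<open>Curl p\<close>. Row by row this is the product of
  the rotated gradient of \<open>p_i\<close> with the gradient of \<open>\<partial>_i f\<close>,
  whose integral vanishes by \<open>interp_rotated_gradient_orthogonal\<close>.\<close>

theorem sCurl_interp_divdiv_free: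
  assumes p: "\<And>y i. p y $ i = interp (W i) y"
  shows "has_divdiv (sCurl p) (\<lambda>_. 0) D"
  unfolding has_divdiv_def
proof (intro allI impI)
  fix f assume f: "test_function D f"
  define S where "S = closure {x. f x \<noteq> 0}"
  note t = test_function_C1_supp[OF f, folded S_def]
  note S = t(1,2)
  have C1: "C1_supp S f" "C1_supp S (partial_deriv i f)" "C1_supp S (partial_deriv j (partial_deriv i f))" for i j
    using t(3)[of "[]"] t(3)[of "[i]"] t(3)[of "[j, i]"] by simp_all
  let ?H = "\<lambda>i j. partial_deriv i (partial_deriv j f)"
  let ?p = "\<lambda>i j. partial_deriv j (interp (W i))"
  have sym: "?H 2 1 x = ?H 1 2 x" for x
    using C1(1,2) by (intro partial_deriv_commute) (auto simp: C1_supp_def)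
  have pd: "partial_deriv j (\<lambda>y. p y $ i) = ?p i j" for i j
    using p by (simp add: fun_eq_iff partial_deriv_def)
  have ip: "sCurl p x \<bullet> hessian f x
      = (?p 1 2 x * ?H 1 1 x - ?p 1 1 x * ?H 2 1 x) + (?p 2 2 x * ?H 1 2 x - ?p 2 1 x * ?H 2 2 x)" for x
    by (simp add: sCurl_def sym_part_def Curl_def hessian_def inner_vec_def sum_2 transpose_def pd sym field_simps)
  have i: "integrable lebesgue (\<lambda>x. ?p k j x * ?H l m x)" for k j l m
    by (rule interp_weak_derivative(1)[OF S C1(3)])
  have z: "indicator D x * (sCurl p x \<bullet> hessian f x) = sCurl p x \<bullet> hessian f x" for x
  proof (cases "x \<in> D")
    case False
    then have "x \<notin> S" using S by blast
    then have "?H l m x = 0" for l m using C1(3) by (simp add: C1_supp_def)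
    then show ?thesis unfolding ip by simp
  qed simp
  have "(\<integral>x. sCurl p x \<bullet> hessian f x \<partial>lebesgue_on D) = (\<integral>x. sCurl p x \<bullet> hessian f x \<partial>lebesgue)"
    using sets_D by (subst integral_restrict_space) (simp_all add: z)
  also have "\<dots> = ((\<integral>x. ?p 1 2 x * ?H 1 1 x \<partial>lebesgue) - (\<integral>x. ?p 1 1 x * ?H 2 1 x \<partial>lebesgue))
     + ((\<integral>x. ?p 2 2 x * ?H 1 2 x \<partial>lebesgue) - (\<integral>x. ?p 2 1 x * ?H 2 2 x \<partial>lebesgue))"
    unfolding ip by (simp only: Bochner_Integration.integral_add Bochner_Integration.integral_diff
        Bochner_Integration.integrable_diff i)
  also have "\<dots> = 0"
    using interp_rotated_gradient_orthogonal[OF S C1(2,3)] by simp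
  finally show "(\<integral>x. sCurl p x \<bullet> hessian f x \<partial>lebesgue_on D) = (\<integral>x. 0 * f x \<partial>lebesgue_on D)" by simp
qed

end

section \<open>Piecewise constant fields and a weighted Schur test\<close>

text \<open>The matrix \<open>Curl p\<close> on an element on which \<open>g i\<close> is the
  derivative of the component \<open>i\<close> of \<open>p\<close>.\<close>

definition curl_mat :: "(2 \<Rightarrow> real^2 \<Rightarrow> real) \<Rightarrow> real^2^2" where
  "curl_mat g = (\<chi> i j. if j = 1 then g i (axis 2 1) else - g i (axis 1 1))"

text \<open>Applied to the normal \<open>n = rot t\<close>, the matrix \<open>Curl p\<close> yields
  minus the derivative of \<open>p\<close> in direction \<open>t\<close>.\<close>

lemma curl_mat_nn:
  assumes "\<And>i. linear (g i)"
  shows "rot t \<bullet> (sym_part (curl_mat g) *v rot t) = - (rot t \<bullet> (\<chi> i. g i t))"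
  using linear_axis[OF assms, of 1 t] linear_axis[OF assms, of 2 t]
  by (simp add: rot_def sym_part_def curl_mat_def inner_vec_def sum_2 matrix_vector_mult_def transpose_def field_simps)

lemma norm_curl_mat_le:
  assumes "\<And>i j. \<bar>g i (axis j 1)\<bar> \<le> B"
  shows "norm (sym_part (curl_mat g)) \<le> 4 * B"
proof -
  let ?Q = "sym_part (curl_mat g)"
  have e: "\<bar>?Q $ i $ j\<bar> \<le> B" for i j
  proof -
    have c: "\<bar>curl_mat g $ i $ j\<bar> \<le> B" for i j using assms by (simp add: curl_mat_def)
    have "?Q $ i $ j = (curl_mat g $ i $ j + curl_mat g $ j $ i) / 2"
      by (simp add: sym_part_def transpose_def)
    then have "\<bar>?Q $ i $ j\<bar> = \<bar>curl_mat g $ i $ j + curl_mat g $ j $ i\<bar> / 2" by simp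
    also have "\<dots> \<le> (B + B) / 2"
      using abs_triangle_ineq[of "curl_mat g $ i $ j" "curl_mat g $ j $ i"] c[of i j] c[of j i] by simp
    finally show ?thesis by simp
  qed
  have "norm ?Q \<le> (\<Sum>i\<in>UNIV. norm (?Q $ i))" by (simp add: norm_vec_def L2_set_le_sum)
  also have "\<dots> \<le> (\<Sum>i\<in>UNIV. \<Sum>j\<in>UNIV. \<bar>?Q $ i $ j\<bar>)"
    by (intro sum_mono norm_le_l1_cart)
  also have "\<dots> \<le> (\<Sum>i\<in>(UNIV::2 set). \<Sum>j\<in>(UNIV::2 set). B)" by (intro sum_mono e)
  finally show ?thesis by (simp add: sum_2)
qed

lemma transpose_sym_part: "transpose (sym_part Q) = sym_part Q"
  by (simp add: sym_part_def transpose_def vec_eq_iff add.commute)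

lemma const_polys: "(\<lambda>_. a) \<in> polys k"
proof -
  define c where "c = (\<lambda>(i::nat) (j::nat). if i = 0 \<and> j = 0 then a else 0)"
  have fin: "finite {(i, j). i + j \<le> k}"
    by (rule finite_subset[of _ "{..k} \<times> {..k}"]) auto
  have "(\<Sum>(i, j)\<in>{(i, j). i + j \<le> k}. c i j * (x$1) ^ i * (x$2) ^ j) = a" for x :: "real^2"
  proof -
    have "(\<Sum>(i, j)\<in>{(i, j). i + j \<le> k}. c i j * (x$1) ^ i * (x$2) ^ j)
      = (\<Sum>p\<in>{(i, j). i + j \<le> k}. if p = (0, 0) then a else 0)"
      by (intro sum.cong) (auto simp: c_def split: if_splits)
    then show ?thesis using fin by simp
  qed
  then show ?thesis unfolding polys_def by (intro CollectI exI[of _ c]) simp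
qed

lemma const_RT: "(\<lambda>_. a) \<in> RT k"
proof -
  have "(\<lambda>_. a) = (\<lambda>x. a + 0 *\<^sub>R x)" by simp
  then show ?thesis unfolding RT_def
    by (intro CollectI exI[of _ "\<lambda>_. a"] exI[of _ "\<lambda>_. 0"]) (simp add: const_polys)
qed

text \<open>A constant matrix is the sum of \<open>e_i\<close> times its row \<open>i\<close>, and
  constants belong to all the spaces \<open>RT k\<close>.\<close>

lemma const_X_elem: "(\<lambda>_. sym_part Q) \<in> X_elem"
proof -
  define \<phi> where "\<phi> = (\<lambda>(l::nat) (x::real^2). if l = 0 then axis 1 1 else axis 2 1 :: real^2)" 
  define \<psi> where "\<psi> = (\<lambda>(l::nat) (x::real^2). if l = 0 then Q $ 1 else Q $ 2)"
  have "(\<lambda>x::real^2. Q) = (\<lambda>x. \<Sum>l<2. (\<lambda>_. 1) l *\<^sub>R outer_prod (\<phi> l x) (\<psi> l x))"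
    by (rule ext) (simp add: \<phi>_def \<psi>_def outer_prod_def vec_eq_iff forall_2 axis_def lessThan_Suc numeral_2_eq_2)
  moreover have "\<forall>l<2. \<phi> l \<in> RT 0 \<and> \<psi> l \<in> RT 1"
    using const_RT by (simp add: \<phi>_def \<psi>_def)
  ultimately have "(\<lambda>_. Q) \<in> tensor_span (RT 0) (RT 1)" unfolding tensor_span_def
    by (intro CollectI exI[of _ "2::nat"] exI[of _ "\<lambda>_. 1"] exI[of _ \<phi>] exI[of _ \<psi>]) simp
  then show ?thesis unfolding X_elem_def by (rule rev_image_eqI) simp
qed

lemma weighted_Cauchy_Schwarz:
  fixes l f \<rho> :: "'p \<Rightarrow> real"
  assumes "finite P" "\<And>p. p \<in> P \<Longrightarrow> 0 \<le> l p" "\<And>p. p \<in> P \<Longrightarrow> 0 < \<rho> p"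
  shows "(\<Sum>p\<in>P. l p * f p / \<rho> p)\<^sup>2
    \<le> (\<Sum>p\<in>P. l p * (f p)\<^sup>2 * \<rho> p powr (-4/3)) * (\<Sum>p\<in>P. l p * \<rho> p powr (-2/3))"
proof -
  define a where "a = (\<lambda>p. sqrt (l p) * f p * \<rho> p powr (-2/3))"
  define b where "b = (\<lambda>p. sqrt (l p) * \<rho> p powr (-1/3))"
  have ab: "l p * f p / \<rho> p = a p * b p" if "p \<in> P" for p
  proof -
    have "\<rho> p powr (-2/3) * \<rho> p powr (-1/3) = 1 / \<rho> p"
      using assms(3)[OF that] by (simp add: powr_add[symmetric] powr_minus_divide)
    then have "a p * b p = (sqrt (l p) * sqrt (l p)) * f p * (1 / \<rho> p)" by (simp add: a_def b_def mult_ac)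
    then show ?thesis using assms(2)[OF that] by simp
  qed
  have "(\<Sum>p\<in>P. l p * f p / \<rho> p)\<^sup>2 = (\<Sum>p\<in>P. a p * b p)\<^sup>2" using ab by simp
  also have "\<dots> \<le> (\<Sum>p\<in>P. (a p)\<^sup>2) * (\<Sum>p\<in>P. (b p)\<^sup>2)" by (rule Cauchy_Schwarz_ineq_sum)
  also have "(\<Sum>p\<in>P. (a p)\<^sup>2) = (\<Sum>p\<in>P. l p * (f p)\<^sup>2 * \<rho> p powr (-4/3))"
  proof (rule sum.cong[OF refl])
    fix p assume "p \<in> P"
    have "(\<rho> p powr (-2/3))\<^sup>2 = \<rho> p powr (-4/3)" by (simp add: power2_eq_square powr_add[symmetric])
    then show "(a p)\<^sup>2 = l p * (f p)\<^sup>2 * \<rho> p powr (-4/3)"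
      using assms(2)[OF \<open>p \<in> P\<close>] by (simp add: a_def power_mult_distrib)
  qed
  also have "(\<Sum>p\<in>P. (b p)\<^sup>2) = (\<Sum>p\<in>P. l p * \<rho> p powr (-2/3))"
  proof (rule sum.cong[OF refl])
    fix p assume "p \<in> P"
    have "(\<rho> p powr (-1/3))\<^sup>2 = \<rho> p powr (-2/3)" by (simp add: power2_eq_square powr_add[symmetric])
    then show "(b p)\<^sup>2 = l p * \<rho> p powr (-2/3)"
      using assms(2)[OF \<open>p \<in> P\<close>] by (simp add: b_def power_mult_distrib)
  qed
  finally show ?thesis .
qed

text \<open>A Schur test for the kernel \<open>1 / \<rho>\<close>, split as \<open>\<rho> powr
  (-2/3) * \<rho> powr (-1/3)\<close>. After squaring, the exponents are \<open>-4/3\<close> and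
  \<open>-2/3\<close>: the first is summable over the elements of a planar mesh, the second over the
  edges of a curve. An even split would lead to the exponent \<open>-1\<close> on the curve, and so
  to a logarithm of \<open>h\<close>.\<close>

lemma sum_squares_schur:
  fixes l f :: "'p \<Rightarrow> real" and \<rho> :: "'k \<Rightarrow> 'p \<Rightarrow> real"
  assumes P: "finite P" "\<And>p. p \<in> P \<Longrightarrow> 0 \<le> l p" "\<And>k p. k \<in> I \<Longrightarrow> p \<in> P \<Longrightarrow> 0 < \<rho> k p" and a: "0 \<le> a"
    and Cb: "\<And>k. k \<in> I \<Longrightarrow> (\<Sum>p\<in>P. l p * \<rho> k p powr (-2/3)) \<le> Cb"
    and Ca: "\<And>p. p \<in> P \<Longrightarrow> (\<Sum>k\<in>I. a * \<rho> k p powr (-4/3)) \<le> Ca" and Cb0: "0 \<le> Cb"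
  shows "(\<Sum>k\<in>I. a * (\<Sum>p\<in>P. l p * f p / \<rho> k p)\<^sup>2) \<le> Ca * Cb * (\<Sum>p\<in>P. l p * (f p)\<^sup>2)"
proof -
  have "(\<Sum>k\<in>I. a * (\<Sum>p\<in>P. l p * f p / \<rho> k p)\<^sup>2)
    \<le> (\<Sum>k\<in>I. a * ((\<Sum>p\<in>P. l p * (f p)\<^sup>2 * \<rho> k p powr (-4/3)) * Cb))"
  proof (intro sum_mono mult_left_mono a)
    fix k assume k: "k \<in> I"
    have "(\<Sum>p\<in>P. l p * f p / \<rho> k p)\<^sup>2 \<le> (\<Sum>p\<in>P. l p * (f p)\<^sup>2 * \<rho> k p powr (-4/3)) * (\<Sum>p\<in>P. l p * \<rho> k p powr (-2/3))"
      using P k by (intro weighted_Cauchy_Schwarz) auto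
    also have "\<dots> \<le> (\<Sum>p\<in>P. l p * (f p)\<^sup>2 * \<rho> k p powr (-4/3)) * Cb"
      using P(2) Cb[OF k] by (intro mult_left_mono sum_nonneg) auto
    finally show "(\<Sum>p\<in>P. l p * f p / \<rho> k p)\<^sup>2 \<le> (\<Sum>p\<in>P. l p * (f p)\<^sup>2 * \<rho> k p powr (-4/3)) * Cb" .
  qed
  also have "\<dots> = (\<Sum>k\<in>I. \<Sum>p\<in>P. (l p * (f p)\<^sup>2 * Cb) * (a * \<rho> k p powr (-4/3)))"
    by (simp add: sum_distrib_left sum_distrib_right mult_ac)
  also have "\<dots> = (\<Sum>p\<in>P. (l p * (f p)\<^sup>2 * Cb) * (\<Sum>k\<in>I. a * \<rho> k p powr (-4/3)))"
    by (subst sum.swap) (simp add: sum_distrib_left)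
  also have "\<dots> \<le> (\<Sum>p\<in>P. (l p * (f p)\<^sup>2 * Cb) * Ca)"
    using P(2) Cb0 Ca by (intro sum_mono mult_left_mono) auto
  also have "\<dots> = Ca * Cb * (\<Sum>p\<in>P. l p * (f p)\<^sup>2)"
    by (simp add: sum_distrib_left mult_ac)
  finally show ?thesis .
qed

context mesh begin

lemma AE_piecewise:
  fixes N :: "real^2 \<Rightarrow> 'b::real_normed_vector"
  assumes N: "\<And>K x. K \<in> T \<Longrightarrow> x \<in> interior K \<Longrightarrow> N x = A K"
  shows "AE x in lebesgue. indicator D x *\<^sub>R N x = indicator D x *\<^sub>R (\<Sum>K\<in>T. indicator (interior K) x *\<^sub>R A K)"
proof (rule AE_I')
  show "(\<Union>K\<in>T. frontier K) \<in> null_sets lebesgue"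
    using negligible_skeleton by (simp add: negligible_iff_null_sets)
  show "{x \<in> space lebesgue. \<not> indicator D x *\<^sub>R N x = indicator D x *\<^sub>R (\<Sum>K\<in>T. indicator (interior K) x *\<^sub>R A K)}
     \<subseteq> (\<Union>K\<in>T. frontier K)"
  proof (rule subsetI, rule ccontr)
    fix x assume x: "x \<in> {x \<in> space lebesgue. \<not> indicator D x *\<^sub>R N x = indicator D x *\<^sub>R (\<Sum>K\<in>T. indicator (interior K) x *\<^sub>R A K)}"
      "x \<notin> (\<Union>K\<in>T. frontier K)"
    have "x \<in> D" using x(1) by (cases "x \<in> D") auto
    then obtain K where K: "K \<in> T" "x \<in> interior K" using off_skeleton[OF _ x(2)] closure_subset by blast
    have "(\<Sum>K'\<in>T. indicator (interior K') x *\<^sub>R A K') = (\<Sum>K'\<in>T. if K' = K then A K' else 0)"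
      using K interior_disjoint by (intro sum.cong) (auto simp: indicator_def)
    also have "\<dots> = N x" using K finite_T N by simp
    finally show False using x by simp
  qed
qed

lemma piecewise_constant_L2:
  fixes N :: "real^2 \<Rightarrow> 'b::euclidean_space"
  assumes N: "\<And>K x. K \<in> T \<Longrightarrow> x \<in> interior K \<Longrightarrow> N x = A K"
  shows "N \<in> L2_on D"
    and "(\<integral>x. (norm (N x))\<^sup>2 \<partial>lebesgue_on D) \<le> (\<Sum>K\<in>T. measure lebesgue K * (norm (A K))\<^sup>2)"
proof -
  have DD: "D \<inter> space lebesgue \<in> sets lebesgue" using sets_D by simp
  have lm: "interior K \<in> lmeasurable" if "K \<in> T" for K
    using compact_T[OF that] by (intro lmeasurable_interior) (simp add: compact_imp_bounded)
  have m: "(\<lambda>x. indicator D x *\<^sub>R (\<Sum>K\<in>T. indicator (interior K) x *\<^sub>R A' K)) \<in> borel_measurable lebesgue"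
    for A' :: "(real^2) set \<Rightarrow> 'c::euclidean_space"
    using lm sets_D by (intro borel_measurable_scaleR borel_measurable_indicator borel_measurable_sum) auto
  have "(\<lambda>x. indicator D x *\<^sub>R N x) \<in> borel_measurable lebesgue"
  proof (rule borel_measurable_AE[OF m])
    show "AE x in lebesgue. indicator D x *\<^sub>R (\<Sum>K\<in>T. indicator (interior K) x *\<^sub>R A K) = indicator D x *\<^sub>R N x"
      using AE_piecewise[where N = N and A = A, OF N] by (auto elim!: eventually_mono)
  qed
  then have mN: "N \<in> borel_measurable (lebesgue_on D)"
    using borel_measurable_restrict_space_iff[OF DD] by blast
  let ?g = "\<lambda>x. \<Sum>K\<in>T. indicator (interior K) x *\<^sub>R (norm (A K))\<^sup>2"
  have ae: "AE x in lebesgue. indicator D x *\<^sub>R (norm (N x))\<^sup>2 = indicator D x *\<^sub>R ?g x"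
    by (rule AE_piecewise) (simp add: N)
  have ig: "integrable lebesgue (\<lambda>x. indicator (interior K) x *\<^sub>R (norm (A K))\<^sup>2)" if "K \<in> T" for K
    using lm[OF that] by (intro integrable_scaleR_left) (simp add: lmeasurable_iff_integrable)
  then have igs: "integrable lebesgue ?g" by (intro Bochner_Integration.integrable_sum) auto
  have g0: "0 \<le> ?g x" for x by (intro sum_nonneg) auto
  have igD: "integrable lebesgue (\<lambda>x. indicator D x *\<^sub>R ?g x)"
  proof (rule Bochner_Integration.integrable_bound[OF igs m])
    show "AE x in lebesgue. norm (indicator D x *\<^sub>R ?g x) \<le> norm (?g x)"
      using g0 by (auto simp: indicator_def)
  qed
  have mN2: "(\<lambda>x. indicator D x *\<^sub>R (norm (N x))\<^sup>2) \<in> borel_measurable lebesgue"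
    using borel_measurable_restrict_space_iff[OF DD, of "\<lambda>x. (norm (N x))\<^sup>2"] mN by (simp add: borel_measurable_norm borel_measurable_power)
  have iN: "integrable lebesgue (\<lambda>x. indicator D x *\<^sub>R (norm (N x))\<^sup>2)"
    using integrable_cong_AE[OF mN2 m ae] igD by simp
  then have iN': "integrable (lebesgue_on D) (\<lambda>x. (norm (N x))\<^sup>2)"
    using integrable_restrict_space[OF DD, of "\<lambda>x. (norm (N x))\<^sup>2"] by simp
  show "N \<in> L2_on D" using mN iN' by (simp add: L2_on_def)
  have "(\<integral>x. (norm (N x))\<^sup>2 \<partial>lebesgue_on D) = (\<integral>x. indicator D x *\<^sub>R (norm (N x))\<^sup>2 \<partial>lebesgue)"
    by (rule integral_restrict_space[OF DD])
  also have "\<dots> = (\<integral>x. indicator D x *\<^sub>R ?g x \<partial>lebesgue)"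
    by (rule integral_cong_AE[OF mN2 m ae])
  also have "\<dots> \<le> (\<integral>x. ?g x \<partial>lebesgue)"
    using g0 by (intro integral_mono igD igs) (auto simp: indicator_def)
  also have "\<dots> = (\<Sum>K\<in>T. measure lebesgue (interior K) * (norm (A K))\<^sup>2)"
    using ig lm by (subst Bochner_Integration.integral_sum) auto
  also have "\<dots> \<le> (\<Sum>K\<in>T. measure lebesgue K * (norm (A K))\<^sup>2)"
    using lm compact_T interior_subset by (intro sum_mono mult_right_mono measure_mono_fmeasurable) (auto intro: lmeasurable_compact)
  finally show "(\<integral>x. (norm (N x))\<^sup>2 \<partial>lebesgue_on D) \<le> (\<Sum>K\<in>T. measure lebesgue K * (norm (A K))\<^sup>2)" .
qed

lemma measure_element_le:
  assumes "K \<in> T" "diameter K \<le> h"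
  shows "measure lebesgue K \<le> 4 * h\<^sup>2"
proof -
  have "verts K \<noteq> {}" using triangle_verts(2)[OF simplex_T[OF assms(1)]] by force
  then obtain z where z: "z \<in> K" using verts_subset by blast
  have bd: "bounded K" using compact_T[OF assms(1)] by (simp add: compact_imp_bounded)
  have "K \<subseteq> cball z h" using diameter_bounded_bound[OF bd z] assms(2) by (fastforce simp: dist_commute)
  then have h0: "0 \<le> h" using z by auto
  have "measure lebesgue K \<le> measure lebesgue (cball z h)"
    using \<open>K \<subseteq> cball z h\<close> compact_T[OF assms(1)]
    by (intro measure_mono_fmeasurable) (auto intro: lmeasurable_compact fmeasurableD)
  also have "\<dots> = pi * h\<^sup>2" using content_cball[OF h0, of z] by (simp add: unit_ball_vol_2)
  also have "\<dots> \<le> 4 * h\<^sup>2" using pi_less_4 by (intro mult_right_mono) auto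
  finally show ?thesis .
qed

end

section \<open>Closing up the increments\<close>

text \<open>The operator is symmetric and positive definite with lower bound
  \<open>\<kappa>\<close>.\<close>

lemma coercive_solution:
  fixes l :: "nat \<Rightarrow> real" and t :: "nat \<Rightarrow> real^2"
  assumes "0 < \<kappa>" and co: "\<And>a. \<kappa> * (norm a)\<^sup>2 \<le> (\<Sum>j<m. l j * (t j \<bullet> a)\<^sup>2)"
  obtains sol where "linear sol" "\<And>b. (\<Sum>j<m. (l j * (t j \<bullet> sol b)) *\<^sub>R t j) = b" "\<And>b. \<kappa> * norm (sol b) \<le> norm b"
proof -
  define F where "F = (\<lambda>a. \<Sum>j<m. (l j * (t j \<bullet> a)) *\<^sub>R t j)"
  have lin: "linear F" unfolding F_def
    by (intro linear_compose_sum ballI linearI) (auto simp: inner_add_right algebra_simps)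
  have aF: "a \<bullet> F a = (\<Sum>j<m. l j * (t j \<bullet> a)\<^sup>2)" for a
    by (simp add: F_def inner_sum_right power2_eq_square inner_commute mult_ac)
  have low: "\<kappa> * norm a \<le> norm (F a)" for a
  proof (cases "a = 0")
    case False
    have "norm a * (\<kappa> * norm a) \<le> a \<bullet> F a" using co[of a] by (simp add: aF power2_eq_square mult_ac)
    also have "\<dots> \<le> norm a * norm (F a)" by (rule norm_cauchy_schwarz)
    finally show ?thesis using False by simp
  qed simp
  have inj: "inj F"
  proof (rule linear_injective_0[OF lin, THEN iffD2], intro allI impI)
    fix a assume "F a = 0"
    with low[of a] assms(1) show "a = 0" by (simp add: mult_le_0_iff)
  qed
  obtain sol where sol: "linear sol" "\<And>x. sol (F x) = x" "\<And>x. F (sol x) = x"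
    using linear_injective_isomorphism[OF lin inj] by blast
  show thesis
  proof (rule that[OF sol(1)])
    show "(\<Sum>j<m. (l j * (t j \<bullet> sol b)) *\<^sub>R t j) = b" for b using sol(3)[of b] by (simp add: F_def)
    show "\<kappa> * norm (sol b) \<le> norm b" for b using low[of "sol b"] sol(3) by simp
  qed
qed

context simple_loop begin

text \<open>On a line the loop would be a closed curve of real numbers, which takes intermediate
  values twice and cannot be simple. Two independent differences of points then span the
  plane.\<close>

lemma loop_not_in_line:
  obtains z1 z2 z3 k where "z1 \<in> path_image g" "z2 \<in> path_image g" "z3 \<in> path_image g" "0 < k"
    "\<And>a. k * norm a \<le> \<bar>(z2 - z1) \<bullet> a\<bar> + \<bar>(z3 - z1) \<bullet> a\<bar>"
proof -
  have lf: "\<And>x y. x \<in> {0..1} \<Longrightarrow> y \<in> {0..1} \<Longrightarrow> g x = g y \<Longrightarrow> x = y \<or> x = 0 \<and> y = 1 \<or> x = 1 \<and> y = 0"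
    using simple unfolding simple_path_def loop_free_def by blast
  have cg: "continuous_on {0..1} g" using lip by (rule lipschitz_on_continuous_on)
  define p where "p = g (1/2) - g 0"
  have p0: "p \<noteq> 0" using lf[of "1/2" 0] by (auto simp: p_def)
  have pp: "p \<bullet> p > 0" using p0 by simp
  have "\<exists>s\<in>{0..1}. (g s - g 0) \<bullet> rot p \<noteq> 0"
  proof (rule ccontr)
    assume "\<not> ?thesis"
    then have orth: "\<And>s. s \<in> {0..1} \<Longrightarrow> (g s - g 0) \<bullet> rot p = 0" by blast
    define \<phi> where "\<phi> = (\<lambda>s. (g s - g 0) \<bullet> p)"
    have det: "g s = g t" if "s \<in> {0..1}" "t \<in> {0..1}" "\<phi> s = \<phi> t" for s t
    proof -
      define u where "u = g s - g t"
      have 1: "u \<bullet> p = 0" using that(3) by (simp add: \<phi>_def u_def inner_diff_left)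
      have 2: "u \<bullet> rot p = 0" using orth[OF that(1)] orth[OF that(2)] by (simp add: u_def inner_diff_left)
      have e1: "u$1 * p$1 + u$2 * p$2 = 0" using 1 by (simp add: inner_vec_def sum_2)
      have e2: "u$2 * p$1 = u$1 * p$2" using 2 by (simp add: inner_vec_def sum_2 rot_def)
      have P: "p \<bullet> p = p$1 * p$1 + p$2 * p$2" by (simp add: inner_vec_def sum_2)
      have "u$1 * (p \<bullet> p) = p$1 * (u$1 * p$1 + u$2 * p$2) + p$2 * (u$1 * p$2 - u$2 * p$1)"
        unfolding P by (simp add: algebra_simps)
      moreover have "u$2 * (p \<bullet> p) = p$2 * (u$1 * p$1 + u$2 * p$2) + p$1 * (u$2 * p$1 - u$1 * p$2)"
        unfolding P by (simp add: algebra_simps)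
      ultimately have "u$1 = 0" "u$2 = 0" using e1 e2 pp by auto
      then have "u = 0" by (simp add: vec_eq_iff forall_2)
      then show ?thesis by (simp add: u_def)
    qed
    have c\<phi>: "continuous_on {0..1} \<phi>" unfolding \<phi>_def by (intro continuous_intros cg)
    have v: "\<phi> 0 = 0" "\<phi> 1 = 0" "\<phi> (1/2) = p \<bullet> p" by (simp_all add: \<phi>_def g01 p_def)
    obtain s where s: "0 \<le> s" "s \<le> 1/2" "\<phi> s = p \<bullet> p / 2"
      using IVT'[of \<phi> 0 "p \<bullet> p / 2" "1/2"] v pp continuous_on_subset[OF c\<phi>, of "{0..1/2}"] by auto
    obtain t where t: "1/2 \<le> t" "t \<le> 1" "\<phi> t = p \<bullet> p / 2"
      using IVT2'[of \<phi> 1 "p \<bullet> p / 2" "1/2"] v pp continuous_on_subset[OF c\<phi>, of "{1/2..1}"] by auto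
    have "g s = g t" using s t by (intro det) auto
    then have "s = t \<or> s = 0 \<and> t = 1 \<or> s = 1 \<and> t = 0" using lf[of s t] s t by auto
    moreover have "s \<noteq> 0" using s v pp by auto
    moreover have "s \<noteq> 1/2"
    proof
      assume "s = 1/2"
      with v(3) have "\<phi> s = p \<bullet> p" by (simp only:)
      with s(3) pp show False by simp
    qed
    ultimately show False using s t by auto
  qed
  then obtain s where s: "s \<in> {0..1}" "(g s - g 0) \<bullet> rot p \<noteq> 0" by blast
  define q where "q = g s - g 0"
  define F where "F = (\<lambda>a. vector [p \<bullet> a, q \<bullet> a] :: real^2)"
  have lin: "linear F" unfolding F_def
    by (intro linearI) (auto simp: vec_eq_iff forall_2 inner_add_right)
  have "inj F"
  proof (rule linear_injective_0[OF lin, THEN iffD2], intro allI impI)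
    fix a assume "F a = 0"
    then have 1: "p \<bullet> a = 0" "q \<bullet> a = 0" by (auto simp: F_def vec_eq_iff forall_2)
    have e1: "p$1 * a$1 + p$2 * a$2 = 0" "q$1 * a$1 + q$2 * a$2 = 0" using 1 by (auto simp: inner_vec_def sum_2)
    define d where "d = p$1 * q$2 - p$2 * q$1"
    have d: "d \<noteq> 0" using s(2) by (simp add: d_def q_def[symmetric] rot_def inner_vec_def sum_2 algebra_simps)
    have "a$1 * d = 0" using e1 by (unfold d_def, algebra)
    moreover have "a$2 * d = 0" using e1 by (unfold d_def, algebra)
    ultimately show "a = 0" using d by (simp add: vec_eq_iff forall_2)
  qed
  from linear_inj_bounded_below_pos[OF lin this]
  obtain k where k: "k > 0" "\<And>a. k * norm a \<le> norm (F a)" by blast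
  have "norm (F a) \<le> \<bar>p \<bullet> a\<bar> + \<bar>q \<bullet> a\<bar>" for a
    using norm_le_l1_cart[of "F a"] by (simp add: F_def sum_2)
  then have "k * norm a \<le> \<bar>(g (1/2) - g 0) \<bullet> a\<bar> + \<bar>(g s - g 0) \<bullet> a\<bar>" for a
    using k(2)[of a] by (simp add: p_def q_def order_trans)
  moreover have "g 0 \<in> path_image g" "g (1/2) \<in> path_image g" "g s \<in> path_image g"
    using s(1) by (auto simp: path_image_def)
  ultimately show thesis using that[of "g 0" "g (1/2)" "g s" k] k(1) by blast
qed

end

definition edge_dir :: "(nat \<Rightarrow> real^2) \<Rightarrow> nat \<Rightarrow> real^2" where
  "edge_dir v j = (v (Suc j) - v j) /\<^sub>R norm (v (Suc j) - v j)"

lemma edge_dir_scale: "dist (v j) (v (Suc j)) *\<^sub>R edge_dir v j = v (Suc j) - v j"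
  by (cases "v (Suc j) = v j") (auto simp: edge_dir_def dist_norm norm_minus_commute)

text \<open>The sum of \<open>\<bar>(v (Suc j) - v j) \<bullet> a\<bar>\<close> is at least the
  width of the polygon in direction \<open>a\<close>, and this is comparable to \<open>norm
  a\<close> because the polygon passes near the three points. The Cauchy-Schwarz inequality turns it
  into a lower bound for the quadratic form.\<close>

lemma polygon_coercive:
  fixes v :: "nat \<Rightarrow> real^2"
  assumes k: "k1 \<le> m" "k2 \<le> m" "k3 \<le> m" and c: "0 < c"
    and far: "\<And>a. c * norm a \<le> \<bar>(z2 - z1) \<bullet> a\<bar> + \<bar>(z3 - z1) \<bullet> a\<bar>"
    and near: "dist (v k1) z1 \<le> c / 8" "dist (v k2) z2 \<le> c / 8" "dist (v k3) z3 \<le> c / 8"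
    and len: "poly_len v m \<le> \<Lambda>" "0 < \<Lambda>"
  shows "c\<^sup>2 / (16 * \<Lambda>) * (norm a)\<^sup>2 \<le> (\<Sum>j<m. dist (v j) (v (Suc j)) * (edge_dir v j \<bullet> a)\<^sup>2)"
proof -
  define l where "l = (\<lambda>j. dist (v j) (v (Suc j)))"
  define x where "x = (\<lambda>j. \<bar>edge_dir v j \<bullet> a\<bar>)"
  define W where "W = (\<Sum>j<m. l j * x j)"
  define Q where "Q = (\<Sum>j<m. l j * (x j)\<^sup>2)"
  have l0: "0 \<le> l j" for j by (simp add: l_def)
  have step: "\<bar>(v (Suc j) - v j) \<bullet> a\<bar> = l j * x j" for j
  proof -
    have "(v (Suc j) - v j) \<bullet> a = l j * (edge_dir v j \<bullet> a)"
      using edge_dir_scale[of v j] by (metis inner_scaleR_left l_def)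
    then show ?thesis using l0 by (simp add: abs_mult x_def)
  qed
  have le1: "\<bar>(v k' - v k) \<bullet> a\<bar> \<le> W" if "k \<le> k'" "k' \<le> m" for k k'
  proof -
    have "v k' - v k = (\<Sum>j\<in>{k..<k'}. v (Suc j) - v j)" using sum_Suc_diff'[OF that(1), of v] by simp
    then have "\<bar>(v k' - v k) \<bullet> a\<bar> = \<bar>\<Sum>j\<in>{k..<k'}. (v (Suc j) - v j) \<bullet> a\<bar>" by (simp add: inner_sum_left)
    also have "\<dots> \<le> (\<Sum>j\<in>{k..<k'}. l j * x j)" unfolding step[symmetric] by (rule sum_abs)
    also have "\<dots> \<le> W" unfolding W_def using that l0 by (intro sum_mono2) (auto simp: x_def)
    finally show ?thesis .
  qed
  have le: "\<bar>(v k' - v k) \<bullet> a\<bar> \<le> W" if "k \<le> m" "k' \<le> m" for k k'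
    using le1[of k k'] le1[of k' k] that by (cases "k \<le> k'") (auto simp: inner_diff_left abs_minus_commute)
  have pert: "\<bar>(z' - z) \<bullet> a\<bar> \<le> W + c / 4 * norm a"
    if "k \<le> m" "k' \<le> m" "dist (v k) z \<le> c / 8" "dist (v k') z' \<le> c / 8" for k k' z z'
  proof -
    have "(z' - z) \<bullet> a = (v k' - v k) \<bullet> a + (z' - v k') \<bullet> a + (v k - z) \<bullet> a" by (simp add: inner_diff_left)
    moreover have "\<bar>(z' - v k') \<bullet> a\<bar> \<le> c / 8 * norm a"
      using Cauchy_Schwarz_ineq2[of "z' - v k'" a] that(4) mult_right_mono[of "norm (z' - v k')" "c/8" "norm a"]
      by (simp add: dist_norm norm_minus_commute)
    moreover have "\<bar>(v k - z) \<bullet> a\<bar> \<le> c / 8 * norm a"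
      using Cauchy_Schwarz_ineq2[of "v k - z" a] that(3) mult_right_mono[of "norm (v k - z)" "c/8" "norm a"]
      by (simp add: dist_norm)
    ultimately show ?thesis using le[OF that(1,2)] by linarith
  qed
  have "c * norm a \<le> (W + c / 4 * norm a) + (W + c / 4 * norm a)"
    using far[of a] pert[OF k(1,2) near(1,2)] pert[OF k(1,3) near(1,3)] by linarith
  then have "c * norm a / 4 \<le> W" by (simp add: field_simps)
  then have "(c * norm a / 4)\<^sup>2 \<le> W\<^sup>2" using c by (intro power_mono) auto
  also have "W\<^sup>2 \<le> (\<Sum>j<m. l j) * Q"
  proof -
    have "W\<^sup>2 = (\<Sum>j<m. sqrt (l j) * (sqrt (l j) * x j))\<^sup>2"
      using l0 by (simp add: W_def mult.assoc[symmetric])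
    also have "\<dots> \<le> (\<Sum>j<m. (sqrt (l j))\<^sup>2) * (\<Sum>j<m. (sqrt (l j) * x j)\<^sup>2)" by (rule Cauchy_Schwarz_ineq_sum)
    finally show ?thesis using l0 by (simp add: Q_def power_mult_distrib)
  qed
  also have "\<dots> \<le> \<Lambda> * Q" using len l0 by (intro mult_right_mono) (auto simp: Q_def poly_len_def l_def intro!: sum_nonneg)
  finally have "c\<^sup>2 * (norm a)\<^sup>2 / 16 \<le> \<Lambda> * Q" by (simp add: power_mult_distrib power_divide)
  then have "c\<^sup>2 / (16 * \<Lambda>) * (norm a)\<^sup>2 \<le> Q" using len(2) by (simp add: field_simps)
  then show ?thesis by (simp add: Q_def l_def x_def)
qed

section \<open>The field on a single mesh\<close>

lemma rot_norm [simp]: "norm (rot t) = norm t"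
  by (simp add: norm_eq_sqrt_inner rot_def inner_vec_def sum_2 add.commute)

lemma rot_rot: "rot (rot t) = - t"
  by (simp add: rot_def vec_eq_iff forall_2)

lemma rot_minus: "rot (- t) = - rot t"
  by (simp add: rot_def vec_eq_iff forall_2)

lemma rot_orthogonal: "rot t \<bullet> t = 0"
  by (simp add: rot_def inner_vec_def sum_2)

lemma frechet_derivative_const_on:
  assumes "open U" "y \<in> U" "\<And>z. z \<in> U \<Longrightarrow> f z = c"
  shows "frechet_derivative f (at y) = (\<lambda>_. 0)"
proof -
  have "((\<lambda>_. c) has_derivative (\<lambda>_. 0)) (at y)" by simp
  then have "(f has_derivative (\<lambda>_. 0)) (at y)"
    by (rule has_derivative_transform_within_open[of _ _ _ UNIV U]) (use assms in auto)
  then show ?thesis using frechet_derivative_at by force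
qed

lemma diameter_segment: "diameter (closed_segment a b) = dist a (b :: real^2)"
proof (rule antisym)
  show "diameter (closed_segment a b) \<le> dist a b"
  proof (rule diameter_le)
    fix x y assume x: "x \<in> closed_segment a b" and y: "y \<in> closed_segment a b"
    have "a \<in> cball x (dist a b)" "b \<in> cball x (dist a b)"
      using dist_in_closed_segment[OF x] by auto
    then have "closed_segment a b \<subseteq> cball x (dist a b)" by (intro closed_segment_subset) auto
    then show "norm (x - y) \<le> dist a b" using y by (auto simp: dist_norm)
  qed simp
  show "dist a b \<le> diameter (closed_segment a b)"
    by (intro diameter_bounded_bound) (auto simp: bounded_closed_segment)
qed

text \<open>The hypotheses on a single mesh in quantitative form. Its boundary consists of closed
  polygons with vertices \<open>v i 0, \<dots>, v i (m i) = v i 0\<close>, for \<open>i \<le>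
  H\<close>. The constant \<open>C_bound\<close> obtained below depends on \<open>H\<close>,
  \<open>c\<close>, \<open>A\<close>, \<open>\<Lambda>\<close>, \<open>\<kappa>\<close>,
  \<open>d\<close> and \<open>R\<close> only.\<close>

locale boundary_mesh = mesh D T for D T +
  fixes H :: nat and m :: "nat \<Rightarrow> nat" and v :: "nat \<Rightarrow> nat \<Rightarrow> real^2" and h c A \<Lambda> \<kappa> d R :: real
  assumes h: "0 < h" "h \<le> 1" and c: "0 < c" "c \<le> 1/2" and A: "1 \<le> A" and \<Lambda>: "0 < \<Lambda>" and \<kappa>: "0 < \<kappa>" and d: "0 < d"
    and inball: "\<And>K. K \<in> T \<Longrightarrow> \<exists>z. cball z (c * h) \<subseteq> K" and diam: "\<And>K. K \<in> T \<Longrightarrow> diameter K \<le> h"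
    and radius: "\<And>x. x \<in> closure D \<Longrightarrow> norm x \<le> R"
    and m: "\<And>i. i \<le> H \<Longrightarrow> 3 \<le> m i" and closed: "\<And>i. i \<le> H \<Longrightarrow> v i (m i) = v i 0"
    and inj: "\<And>i. i \<le> H \<Longrightarrow> inj_on (v i) {..<m i}"
    and edges: "bdry_edges D T = {closed_segment (v i j) (v i (Suc j)) |i j. i \<le> H \<and> j < m i}"
    and tangent: "\<And>i j. i \<le> H \<Longrightarrow> j < m i \<Longrightarrow> edge_tangent T (closed_segment (v i j) (v i (Suc j))) = edge_dir (v i) j"
    and chord: "\<And>i k l. i \<le> H \<Longrightarrow> k < l \<Longrightarrow> l < m i \<Longrightarrow>
       poly_len (v i) l - poly_len (v i) k \<le> A * dist (v i k) (v i l) \<or>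
       poly_len (v i) (m i) - (poly_len (v i) l - poly_len (v i) k) \<le> A * dist (v i k) (v i l)"
    and len: "\<And>i. i \<le> H \<Longrightarrow> poly_len (v i) (m i) \<le> \<Lambda>"
    and sep: "\<And>i i' j j'. i \<le> H \<Longrightarrow> i' \<le> H \<Longrightarrow> i \<noteq> i' \<Longrightarrow> j < m i \<Longrightarrow> j' < m i' \<Longrightarrow> d \<le> dist (v i j) (v i' j')"
    and coercive: "\<And>i a. i \<le> H \<Longrightarrow>
       \<kappa> * (norm a)\<^sup>2 \<le> (\<Sum>j<m i. dist (v i j) (v i (Suc j)) * (edge_dir (v i) j \<bullet> a)\<^sup>2)"
begin

abbreviation "seg i j \<equiv> closed_segment (v i j) (v i (Suc j))"
abbreviation "l i j \<equiv> dist (v i j) (v i (Suc j))"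
abbreviation "t i j \<equiv> edge_dir (v i) j"

lemma v_Suc_mod: "i \<le> H \<Longrightarrow> j < m i \<Longrightarrow> v i (Suc j) = v i (Suc j mod m i)"
  using closed[of i] by (cases "Suc j = m i") auto

lemma seg_in: "i \<le> H \<Longrightarrow> j < m i \<Longrightarrow> seg i j \<in> bdry_edges D T"
  using edges by blast

lemma seg_elem:
  assumes "i \<le> H" "j < m i"
  shows "adj_elem T (seg i j) \<in> T" "seg i j \<subseteq> adj_elem T (seg i j)"
    "v i j \<in> verts (adj_elem T (seg i j))" "v i (Suc j) \<in> verts (adj_elem T (seg i j))" "v i j \<noteq> v i (Suc j)"
    "v i j \<in> closure D"
proof -
  note adj = adj_elem_props[OF seg_in[OF assms]]
  show K: "adj_elem T (seg i j) \<in> T" by (rule adj(1))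
  show sub: "seg i j \<subseteq> adj_elem T (seg i j)" using adj(2) by (rule edge_of_imp_subset)
  obtain c0 where c0: "verts (adj_elem T (seg i j)) = {v i j, v i (Suc j), c0}" "v i j \<noteq> v i (Suc j)"
    by (rule edge_of_triangle[OF simplex_T[OF K] adj(2)])
  then show "v i j \<in> verts (adj_elem T (seg i j))" "v i (Suc j) \<in> verts (adj_elem T (seg i j))" "v i j \<noteq> v i (Suc j)"
    by auto
  show "v i j \<in> closure D" using sub K Union_T by auto
qed

lemma dist_elem_le:
  assumes "K \<in> T" "x \<in> K" "y \<in> K" shows "dist x y \<le> h"
  using diameter_bounded_bound[of K x y] diam[OF assms(1)] compact_imp_bounded[OF compact_T[OF assms(1)]] assms by fastforce

lemma seg_len: 
  assumes "i \<le> H" "j < m i"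
  shows "c * h \<le> l i j" "l i j \<le> h" "0 < l i j" "norm (t i j) = 1"
proof -
  note e = seg_elem[OF assms]
  obtain z where z: "cball z (c * h) \<subseteq> adj_elem T (seg i j)" using inball[OF e(1)] by blast
  have ch: "0 < c * h" using c h by simp
  have "2 * (c * h) \<le> l i j" by (rule edge_ge_inball[OF simplex_T[OF e(1)] ch z e(3,4,5)])
  then show "c * h \<le> l i j" using ch by simp
  show "l i j \<le> h" using e verts_subset by (intro dist_elem_le[OF e(1)]) auto
  show "0 < l i j" using e(5) by simp
  show "norm (t i j) = 1" using e(5) by (simp add: edge_dir_def)
qed

lemma polygon: "i \<le> H \<Longrightarrow> chord_arc_polygon (v i) (m i) A c h"
  using m[of i] closed chord seg_len c h A by unfold_locales (auto intro: chord)

lemma dist_le_2R: "x \<in> closure D \<Longrightarrow> y \<in> closure D \<Longrightarrow> dist x y \<le> 2 * R"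
  using radius[of x] radius[of y] norm_triangle_ineq4[of x y] by (simp add: dist_norm)

lemma R0: "0 \<le> R"
proof -
  have "v 0 0 \<in> closure D" using seg_elem(6)[of 0 0] m[of 0] by simp
  then show ?thesis using radius norm_ge_zero order_trans by blast
qed

lemma seg_inj:
  assumes "i \<le> H" "j < m i" "i' \<le> H" "j' < m i'" "seg i j = seg i' j'"
  shows "i = i' \<and> j = j'"
proof -
  have ends: "{v i j, v i (Suc j)} = {v i' j', v i' (Suc j')}"
    using assms(5) by (simp add: closed_segment_eq)
  have mm: "Suc j mod m i < m i" "Suc j' mod m i' < m i'" using m[OF assms(1)] m[OF assms(3)] by auto
  have ii: "i = i'"
  proof (rule ccontr)
    assume ne: "i \<noteq> i'"
    have "v i j = v i' j' \<or> v i j = v i' (Suc j' mod m i')"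
      using ends v_Suc_mod[OF assms(3,4)] by auto
    then show False using sep[OF assms(1,3) ne assms(2,4)] sep[OF assms(1,3) ne assms(2) mm(2)] d by auto
  qed
  have vi: "v i a = v i b \<longleftrightarrow> a = b" if "a < m i" "b < m i" for a b
    using inj[OF assms(1)] that by (auto simp: inj_on_eq_iff)
  have "j = j'"
  proof (rule ccontr)
    assume "j \<noteq> j'"
    then have "v i j = v i (Suc j' mod m i)" "v i (Suc j mod m i) = v i j'"
      using ends vi assms ii v_Suc_mod[OF assms(1,2)] v_Suc_mod[OF assms(3,4)] by (auto simp: doubleton_eq_iff)
    then have "j = Suc j' mod m i" "Suc j mod m i = j'" using vi mm assms ii by auto
    then show False using m[OF assms(1)] assms(2,4) ii \<open>j \<noteq> j'\<close> by (auto simp: mod_Suc split: if_splits)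
  qed
  with ii show ?thesis by simp
qed

definition edge_ix :: "(nat \<times> nat) set" where
  "edge_ix = (SIGMA i:{..H}. {..<m i})"

lemma edge_ix_iff: "(i, j) \<in> edge_ix \<longleftrightarrow> i \<le> H \<and> j < m i" and finite_edge_ix: "finite edge_ix"
  by (auto simp: edge_ix_def)

lemma sum_edge_ix: "(\<Sum>q\<in>edge_ix. F (fst q) (snd q)) = (\<Sum>i\<le>H. \<Sum>j<m i. F i j)"
  unfolding edge_ix_def by (subst sum.Sigma) (auto simp: case_prod_beta)

lemma sum_edges:
  "(\<Sum>e\<in>bdry_edges D T. diameter e * \<bar>\<mu> e\<bar>\<^sup>2) = (\<Sum>q\<in>edge_ix. l (fst q) (snd q) * (\<mu> (seg (fst q) (snd q)))\<^sup>2)"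
proof -
  have "bdry_edges D T = (\<lambda>q. seg (fst q) (snd q)) ` edge_ix"
  proof (intro equalityI subsetI)
    fix e assume "e \<in> bdry_edges D T"
    then obtain i j where "i \<le> H" "j < m i" "e = seg i j" using edges by blast
    then show "e \<in> (\<lambda>q. seg (fst q) (snd q)) ` edge_ix" by (intro image_eqI[of _ _ "(i, j)"]) (simp_all add: edge_ix_iff)
  next
    fix e assume "e \<in> (\<lambda>q. seg (fst q) (snd q)) ` edge_ix"
    then show "e \<in> bdry_edges D T" using seg_in by (auto simp: edge_ix_def simp del: closed_segment_eq)
  qed
  moreover have "inj_on (\<lambda>q. seg (fst q) (snd q)) edge_ix"
    using seg_inj by (intro inj_onI) (auto simp: edge_ix_iff prod_eq_iff)
  ultimately show ?thesis by (simp add: sum.reindex diameter_segment)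
qed

definition bd_verts :: "(real^2) set" where
  "bd_verts = (\<lambda>q. v (fst q) (snd q)) ` edge_ix"

lemma finite_bd_verts: "finite bd_verts" and bd_verts_nonempty: "bd_verts \<noteq> {}" and vertex_in_bd_verts: "i \<le> H \<Longrightarrow> j < m i \<Longrightarrow> v i j \<in> bd_verts"
proof -
  show "finite bd_verts" by (simp add: bd_verts_def finite_edge_ix)
  show vertex_in_bd_verts: "v i j \<in> bd_verts" if "i \<le> H" "j < m i" for i j
    using that unfolding bd_verts_def by (intro image_eqI[of _ _ "(i, j)"]) (auto simp: edge_ix_iff)
  show "bd_verts \<noteq> {}" using vertex_in_bd_verts[of 0 0] m[of 0] by auto
qed

text \<open>The sawtooth function of edge \<open>j\<close> on polygon \<open>i\<close>, as a
  function of boundary points, extended by zero to the other polygons.\<close>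

definition saw :: "nat \<Rightarrow> nat \<Rightarrow> real^2 \<Rightarrow> real" where
  "saw i j b = (if b \<in> v i ` {..<m i} then sawtooth (v i) (m i) j (the_inv_into {..<m i} (v i) b) else 0)"

lemma saw_same: "i \<le> H \<Longrightarrow> k < m i \<Longrightarrow> saw i j (v i k) = sawtooth (v i) (m i) j k"
  using inj[of i] by (simp add: saw_def the_inv_into_f_f)

lemma saw_other: "i \<le> H \<Longrightarrow> i' \<le> H \<Longrightarrow> i \<noteq> i' \<Longrightarrow> k < m i' \<Longrightarrow> saw i j (v i' k) = 0"
  using sep[of i i' _ k] d by (fastforce simp: saw_def)

definition steepness :: real where
  "steepness = chord_arc_polygon.saw_const A c + (4 * R + 1) / d"

lemma steepness_pos: "0 < steepness" and steepness_ge: "chord_arc_polygon.saw_const A c \<le> steepness" "(4 * R + 1) / d \<le> steepness"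
proof -
  have "0 < chord_arc_polygon.saw_const A c" using chord_arc_polygon.saw_const_ge(3)[OF polygon[of 0]] by simp
  moreover have "0 \<le> (4 * R + 1) / d" using R0 d by simp
  ultimately show "0 < steepness" "chord_arc_polygon.saw_const A c \<le> steepness" "(4 * R + 1) / d \<le> steepness" by (auto simp: steepness_def)
qed

text \<open>On polygon \<open>i\<close> this is \<open>sawtooth_diff\<close>. Vertices on different
  polygons have distance at least \<open>d\<close>, which the second summand of
  \<open>steepness\<close> takes into account.\<close>

lemma saw_diff:
  assumes ij: "i \<le> H" "j < m i" and ab: "a \<in> bd_verts" "b \<in> bd_verts"
  shows "saw i j a \<le> saw i j b + steepness * (dist a b / (dist a b + dist b (v i j) + h))"
proof -
  obtain i1 k where a: "i1 \<le> H" "k < m i1" "a = v i1 k" using ab(1) by (auto simp: bd_verts_def edge_ix_iff)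
  obtain i2 n where b: "i2 \<le> H" "n < m i2" "b = v i2 n" using ab(2) by (auto simp: bd_verts_def edge_ix_iff)
  let ?q = "dist a b / (dist a b + dist b (v i j) + h)"
  have q0: "0 \<le> ?q" using h by simp
  show ?thesis
  proof (cases "i1 = i \<and> i2 = i")
    case True
    have "\<bar>saw i j a - saw i j b\<bar> \<le> chord_arc_polygon.saw_const A c * ?q"
      using chord_arc_polygon.sawtooth_diff[OF polygon[OF ij(1)], of k n j] True a b ij saw_same by simp
    also have "\<dots> \<le> steepness * ?q" using steepness_ge q0 by (intro mult_right_mono) auto
    finally show ?thesis by linarith
  next
    case False
    show ?thesis
    proof (cases "i1 = i2")
      case True
      have "0 \<le> steepness * ?q" using steepness_pos q0 by (intro mult_nonneg_nonneg) auto
      moreover have "saw i j a = 0" "saw i j b = 0" using True False a b saw_other[OF ij(1)] by auto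
      ultimately show ?thesis by linarith
    next
      case ne: False
      have s: "\<bar>saw i j x\<bar> \<le> 1" if xB: "x \<in> bd_verts" for x
      proof -
        obtain i' k' where x: "i' \<le> H" "k' < m i'" "x = v i' k'" using xB by (auto simp: bd_verts_def edge_ix_iff)
        show ?thesis
          using chord_arc_polygon.sawtooth_bound[OF polygon[OF ij(1)], of k' j] x saw_same[OF ij(1)] saw_other[OF ij(1) x(1)]
          by (cases "i' = i") auto
      qed
      have "saw i j a - saw i j b \<le> 1"
      proof -
        have "saw i j a = 0 \<or> saw i j b = 0" using ne a b saw_other[OF ij(1)] by metis
        then show ?thesis using s[OF ab(1)] s[OF ab(2)] by auto
      qed
      also have "1 \<le> steepness * ?q"
      proof -
        have dab: "d \<le> dist a b" using sep[OF a(1) b(1) ne a(2) b(2)] a b by simp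
        have cl: "a \<in> closure D" "b \<in> closure D" "v i j \<in> closure D" using seg_elem(6) a b ij by auto
        have "dist a b + dist b (v i j) + h \<le> 4 * R + 1"
          using dist_le_2R[OF cl(1,2)] dist_le_2R[OF cl(2,3)] h by simp
        also have "\<dots> = (4 * R + 1) / d * d" using d by simp
        also have "\<dots> \<le> steepness * dist a b" using steepness_ge(2) dab d steepness_pos by (intro mult_mono) auto
        finally have "dist a b + dist b (v i j) + h \<le> steepness * dist a b" .
        moreover have "0 < dist a b + dist b (v i j) + h" using h by (simp add: add_nonneg_pos)
        ultimately show ?thesis by (simp add: pos_le_divide_eq)
      qed
      finally show ?thesis by linarith
    qed
  qed
qed

definition \<Theta> :: "nat \<Rightarrow> nat \<Rightarrow> real^2 \<Rightarrow> real" where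
  "\<Theta> i j = cone_ext steepness h bd_verts (saw i j) (v i j)"

lemma \<Theta>_vertex: "i \<le> H \<Longrightarrow> j < m i \<Longrightarrow> a \<in> bd_verts \<Longrightarrow> \<Theta> i j a = saw i j a"
  unfolding \<Theta>_def by (rule cone_ext_eq) (use finite_bd_verts h saw_diff in auto)

lemma \<Theta>_diff:
  assumes "i \<le> H" "j < m i"
  shows "\<Theta> i j x' - \<Theta> i j x \<le> steepness * (dist x x' / (dist x (v i j) + h))"
  using cone_ext_diff[OF finite_bd_verts bd_verts_nonempty h(1), of steepness "saw i j" "v i j" x' x] steepness_pos by (simp add: \<Theta>_def)

lemma \<Theta>_step:
  assumes "i \<le> H" "j < m i" "i' \<le> H" "k < m i'"
  shows "\<Theta> i j (v i' (Suc k)) - \<Theta> i j (v i' k)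
    = (if i' = i then (if k = j then 1 else 0) - l i k / poly_len (v i) (m i) else 0)"
proof -
  have k': "Suc k mod m i' < m i'" using assms by (simp add: mod_less_divisor)
  show ?thesis
    using assms k' v_Suc_mod[OF assms(3,4)] vertex_in_bd_verts
      chord_arc_polygon.sawtooth_Suc[OF polygon[OF assms(1)], of k j]
    by (cases "i' = i") (simp_all add: \<Theta>_vertex saw_same saw_other)
qed

text \<open>Solution operator of the linear system by which the increments on polygon
  \<open>i\<close> are made to sum to zero.\<close>

definition sol :: "nat \<Rightarrow> real^2 \<Rightarrow> real^2" where
  "sol i = (SOME s. linear s \<and> (\<forall>b. (\<Sum>j<m i. (l i j * (t i j \<bullet> s b)) *\<^sub>R t i j) = b) \<and> (\<forall>b. \<kappa> * norm (s b) \<le> norm b))"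

lemma sol:
  assumes "i \<le> H"
  shows "linear (sol i)" "(\<Sum>j<m i. (l i j * (t i j \<bullet> sol i b)) *\<^sub>R t i j) = b" "\<kappa> * norm (sol i b) \<le> norm b"
proof -
  have "\<exists>s. linear s \<and> (\<forall>b. (\<Sum>j<m i. (l i j * (t i j \<bullet> s b)) *\<^sub>R t i j) = b) \<and> (\<forall>b. \<kappa> * norm (s b) \<le> norm b)"
    by (rule coercive_solution[OF \<kappa> coercive[OF assms]]) blast
  from someI_ex[OF this, folded sol_def]
  show "linear (sol i)" "(\<Sum>j<m i. (l i j * (t i j \<bullet> sol i b)) *\<^sub>R t i j) = b" "\<kappa> * norm (sol i b) \<le> norm b"
    by blast+
qed

definition normal_load :: "((real^2) set \<Rightarrow> real) \<Rightarrow> nat \<Rightarrow> real^2" where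
  "normal_load \<mu> i = (\<Sum>j<m i. (l i j * \<mu> (seg i j)) *\<^sub>R rot (t i j))"

text \<open>The increment of the field along an edge with length \<open>l\<close>, tangent
  \<open>t\<close> and normal \<open>n = rot t\<close>: its normal part \<open>- l * \<mu>\<close>
  is what the trace condition prescribes, and its tangential part is chosen such that the increments
  along each polygon sum to zero.\<close>

definition incr :: "((real^2) set \<Rightarrow> real) \<Rightarrow> nat \<Rightarrow> nat \<Rightarrow> real^2" where
  "incr \<mu> i j = (l i j * (t i j \<bullet> sol i (normal_load \<mu> i))) *\<^sub>R t i j - (l i j * \<mu> (seg i j)) *\<^sub>R rot (t i j)"

definition slope :: "((real^2) set \<Rightarrow> real) \<Rightarrow> nat \<Rightarrow> nat \<Rightarrow> real" where
  "slope \<mu> i j = \<bar>\<mu> (seg i j)\<bar> + norm (sol i (normal_load \<mu> i))"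

lemma sum_incr: "i \<le> H \<Longrightarrow> (\<Sum>j<m i. incr \<mu> i j) = 0"
  by (simp add: incr_def sum_subtractf sol(2)) (simp add: normal_load_def)

lemma norm_incr:
  assumes "i \<le> H" "j < m i" shows "norm (incr \<mu> i j) \<le> l i j * slope \<mu> i j"
proof -
  let ?a = "sol i (normal_load \<mu> i)"
  have "norm (incr \<mu> i j) \<le> norm ((l i j * (t i j \<bullet> ?a)) *\<^sub>R t i j) + norm ((l i j * \<mu> (seg i j)) *\<^sub>R rot (t i j))"
    unfolding incr_def by (rule norm_triangle_ineq4)
  also have "\<dots> = l i j * (\<bar>t i j \<bullet> ?a\<bar> + \<bar>\<mu> (seg i j)\<bar>)"
    using seg_len(4)[OF assms] by (simp add: abs_mult algebra_simps)
  also have "\<dots> \<le> l i j * slope \<mu> i j"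
    using Cauchy_Schwarz_ineq2[of "t i j" ?a] seg_len(4)[OF assms]
    by (intro mult_left_mono) (auto simp: slope_def)
  finally show ?thesis .
qed

lemma sum_slope_squares:
  assumes "i \<le> H"
  shows "(\<Sum>j<m i. l i j * (slope \<mu> i j)\<^sup>2) \<le> (2 + 2 * \<Lambda>\<^sup>2 / \<kappa>\<^sup>2) * (\<Sum>j<m i. l i j * (\<mu> (seg i j))\<^sup>2)"
proof -
  let ?a = "sol i (normal_load \<mu> i)"
  let ?S = "\<Sum>j<m i. l i j * (\<mu> (seg i j))\<^sup>2"
  have S0: "0 \<le> ?S" by (intro sum_nonneg) auto
  have "norm (normal_load \<mu> i) \<le> (\<Sum>j<m i. l i j * \<bar>\<mu> (seg i j)\<bar>)"
    unfolding normal_load_def by (rule order_trans[OF norm_sum sum_mono]) (use seg_len assms in \<open>auto simp: abs_mult\<close>)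
  then have "(norm (normal_load \<mu> i))\<^sup>2 \<le> (\<Sum>j<m i. l i j * \<bar>\<mu> (seg i j)\<bar>)\<^sup>2" by (intro power_mono) auto
  also have "\<dots> = (\<Sum>j<m i. sqrt (l i j) * (sqrt (l i j) * \<bar>\<mu> (seg i j)\<bar>))\<^sup>2" by (simp add: mult.assoc[symmetric])
  also have "\<dots> \<le> (\<Sum>j<m i. (sqrt (l i j))\<^sup>2) * (\<Sum>j<m i. (sqrt (l i j) * \<bar>\<mu> (seg i j)\<bar>)\<^sup>2)"
    by (rule Cauchy_Schwarz_ineq_sum)
  also have "\<dots> = poly_len (v i) (m i) * ?S" by (simp add: power_mult_distrib poly_len_def)
  also have "\<dots> \<le> \<Lambda> * ?S" using len[OF assms] S0 by (rule mult_right_mono)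
  finally have b: "(norm (normal_load \<mu> i))\<^sup>2 \<le> \<Lambda> * ?S" .
  have "(\<kappa> * norm ?a)\<^sup>2 \<le> (norm (normal_load \<mu> i))\<^sup>2" using sol(3)[OF assms] \<kappa> by (intro power_mono) auto
  with b have "\<kappa>\<^sup>2 * (norm ?a)\<^sup>2 \<le> \<Lambda> * ?S" by (simp add: power_mult_distrib)
  then have a: "(norm ?a)\<^sup>2 \<le> \<Lambda> * ?S / \<kappa>\<^sup>2" using \<kappa> by (simp add: field_simps)
  have "(\<Sum>j<m i. l i j * (slope \<mu> i j)\<^sup>2) \<le> (\<Sum>j<m i. l i j * (2 * (\<mu> (seg i j))\<^sup>2 + 2 * (norm ?a)\<^sup>2))"
  proof (intro sum_mono mult_left_mono)
    fix j
    have "0 \<le> (\<bar>\<mu> (seg i j)\<bar> - norm ?a)\<^sup>2" by simp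
    then show "(slope \<mu> i j)\<^sup>2 \<le> 2 * (\<mu> (seg i j))\<^sup>2 + 2 * (norm ?a)\<^sup>2"
      by (simp add: slope_def power2_eq_square algebra_simps)
  qed auto
  also have "\<dots> = 2 * ?S + 2 * (norm ?a)\<^sup>2 * poly_len (v i) (m i)"
    by (simp add: poly_len_def distrib_left sum.distrib sum_distrib_left sum_distrib_right mult_ac)
  also have "\<dots> \<le> 2 * ?S + 2 * (\<Lambda> * ?S / \<kappa>\<^sup>2) * \<Lambda>"
    using a len[OF assms] \<Lambda> S0 by (intro add_left_mono mult_mono) (auto simp: poly_len_nonneg)
  also have "\<dots> = (2 + 2 * \<Lambda>\<^sup>2 / \<kappa>\<^sup>2) * ?S" by (simp add: algebra_simps power2_eq_square)
  finally show ?thesis .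
qed

definition vert_val :: "((real^2) set \<Rightarrow> real) \<Rightarrow> real^2 \<Rightarrow> real^2" where
  "vert_val \<mu> x = (\<Sum>q\<in>edge_ix. \<Theta> (fst q) (snd q) x *\<^sub>R incr \<mu> (fst q) (snd q))"

text \<open>The term of \<open>sawtooth_Suc\<close> common to all edges cancels because the
  increments sum to zero.\<close>

lemma vert_val_step:
  assumes "i \<le> H" "k < m i"
  shows "vert_val \<mu> (v i (Suc k)) - vert_val \<mu> (v i k) = incr \<mu> i k"
proof -
  have "vert_val \<mu> (v i (Suc k)) - vert_val \<mu> (v i k)
     = (\<Sum>q\<in>edge_ix. (\<Theta> (fst q) (snd q) (v i (Suc k)) - \<Theta> (fst q) (snd q) (v i k)) *\<^sub>R incr \<mu> (fst q) (snd q))"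
    by (simp add: vert_val_def scaleR_diff_left sum_subtractf)
  also have "\<dots> = (\<Sum>i'\<le>H. \<Sum>j<m i'. (\<Theta> i' j (v i (Suc k)) - \<Theta> i' j (v i k)) *\<^sub>R incr \<mu> i' j)"
    by (rule sum_edge_ix)
  also have "\<dots> = (\<Sum>i'\<le>H. if i' = i then (\<Sum>j<m i. ((if k = j then 1 else 0) - l i k / poly_len (v i) (m i)) *\<^sub>R incr \<mu> i j) else 0)"
    using assms by (intro sum.cong refl) (auto simp: \<Theta>_step intro!: sum.cong sum.neutral)
  also have "\<dots> = (\<Sum>j<m i. ((if k = j then 1 else 0) - l i k / poly_len (v i) (m i)) *\<^sub>R incr \<mu> i j)"
    using assms by simp
  also have "\<dots> = (\<Sum>j<m i. if k = j then incr \<mu> i j else 0) - (l i k / poly_len (v i) (m i)) *\<^sub>R (\<Sum>j<m i. incr \<mu> i j)"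
    by (simp add: scaleR_diff_left sum_subtractf scaleR_sum_right if_distrib[of "\<lambda>x. x *\<^sub>R _"] cong: if_cong)
  also have "\<dots> = incr \<mu> i k" using assms by (simp add: sum_incr)
  finally show ?thesis .
qed

definition ext_field :: "((real^2) set \<Rightarrow> real) \<Rightarrow> real^2 \<Rightarrow> real^2" where
  "ext_field \<mu> x = (\<chi> i. interp (\<lambda>y. vert_val \<mu> y $ i) x)"

lemma ext_field_component: "ext_field \<mu> x $ i = interp (\<lambda>y. vert_val \<mu> y $ i) x"
  by (simp add: ext_field_def)

lemma incr_add: "i \<le> H \<Longrightarrow> incr (\<lambda>e. \<mu> e + \<nu> e) i j = incr \<mu> i j + incr \<nu> i j"
proof -
  assume i: "i \<le> H"
  have "normal_load (\<lambda>e. \<mu> e + \<nu> e) i = normal_load \<mu> i + normal_load \<nu> i"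
    by (simp add: normal_load_def distrib_left scaleR_add_left sum.distrib)
  then show ?thesis by (simp add: incr_def linear_add[OF sol(1)[OF i]] inner_add_right algebra_simps)
qed

lemma incr_scale: "i \<le> H \<Longrightarrow> incr (\<lambda>e. a * \<mu> e) i j = a *\<^sub>R incr \<mu> i j"
proof -
  assume i: "i \<le> H"
  have "normal_load (\<lambda>e. a * \<mu> e) i = a *\<^sub>R normal_load \<mu> i"
    by (simp add: normal_load_def scaleR_sum_right mult_ac)
  then show ?thesis by (simp add: incr_def linear_scale[OF sol(1)[OF i]] algebra_simps)
qed

text \<open>The interpolation, the superposition and the solution operator \<open>sol\<close> are
  all linear.\<close>

lemma ext_field_linear: "linear_on_edge_data E X ext_field"
proof -
  have "vert_val (\<lambda>e. \<mu> e + \<nu> e) x = vert_val \<mu> x + vert_val \<nu> x" for \<mu> \<nu> x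
    unfolding vert_val_def sum.distrib[symmetric]
    by (rule sum.cong) (auto simp: edge_ix_def incr_add scaleR_add_right)
  moreover have "vert_val (\<lambda>e. a * \<mu> e) x = a *\<^sub>R vert_val \<mu> x" for a \<mu> x
    unfolding vert_val_def scaleR_sum_right
    by (rule sum.cong) (auto simp: edge_ix_def incr_scale)
  ultimately show ?thesis
    unfolding linear_on_edge_data_def by (simp add: vec_eq_iff ext_field_component interp_add interp_scale)
qed

lemma ext_field_S1: "ext_field \<mu> \<in> S1_vec D T"
  using interp_S1 by (simp add: S1_vec_def ext_field_component)

lemma ext_field_element:
  assumes K: "K \<in> T"
  obtains g where "\<And>i. linear (g i)" "\<And>x. x \<in> interior K \<Longrightarrow> sCurl (ext_field \<mu>) x = sym_part (curl_mat g)"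
    "\<And>i a b. a \<in> verts K \<Longrightarrow> b \<in> verts K \<Longrightarrow> g i (a - b) = vert_val \<mu> a $ i - vert_val \<mu> b $ i"
proof -
  have "\<exists>c g. linear g \<and> (\<forall>x\<in>K. interp (\<lambda>y. vert_val \<mu> y $ i) x = affine_fun c g x)
     \<and> (\<forall>a\<in>verts K. affine_fun c g a = vert_val \<mu> a $ i)" for i
    by (rule interp_affine_on[where w = "\<lambda>y. vert_val \<mu> y $ i", OF K]) blast
  then obtain c g where g: "\<And>i. linear (g i)" "\<And>i x. x \<in> K \<Longrightarrow> interp (\<lambda>y. vert_val \<mu> y $ i) x = affine_fun (c i) (g i) x"
    "\<And>i a. a \<in> verts K \<Longrightarrow> affine_fun (c i) (g i) a = vert_val \<mu> a $ i" by metis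
  have pd: "partial_deriv j (\<lambda>y. ext_field \<mu> y $ i) x = g i (axis j 1)" if "x \<in> interior K" for i j x
    using interp_partial_deriv(2)[OF K g(1) g(2) that] by (simp add: ext_field_component)
  show thesis
  proof (rule that[OF g(1)])
    show "sCurl (ext_field \<mu>) x = sym_part (curl_mat g)" if "x \<in> interior K" for x
      using pd[OF that] by (simp add: sCurl_def Curl_def curl_mat_def cong: if_cong)
    show "g i (a - b) = vert_val \<mu> a $ i - vert_val \<mu> b $ i" if "a \<in> verts K" "b \<in> verts K" for i a b
      using affine_fun_diff[OF g(1)[of i], of "c i" a b] g(3) that by simp
  qed
qed

lemma ext_field_ker_X: "sCurl (ext_field \<mu>) \<in> X_space D T \<inter> ker_divdiv D"
proof -
  have dd: "has_divdiv (sCurl (ext_field \<mu>)) (\<lambda>_. 0) D"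
    by (rule sCurl_interp_divdiv_free) (rule ext_field_component)
  have "\<forall>K\<in>T. \<exists>Q. \<forall>x\<in>interior K. sCurl (ext_field \<mu>) x = sym_part Q"
  proof
    fix K assume K: "K \<in> T"
    show "\<exists>Q. \<forall>x\<in>interior K. sCurl (ext_field \<mu>) x = sym_part Q"
      by (rule ext_field_element[OF K, where \<mu> = \<mu>]) blast
  qed
  then obtain Q where Q: "\<And>K x. K \<in> T \<Longrightarrow> x \<in> interior K \<Longrightarrow> sCurl (ext_field \<mu>) x = sym_part (Q K)" by metis
  have L2: "sCurl (ext_field \<mu>) \<in> L2_on D" by (rule piecewise_constant_L2(1)[OF Q])
  have "(\<lambda>_. 0 :: real) \<in> L2_on D" by (simp add: L2_on_def)
  then have "sCurl (ext_field \<mu>) \<in> H_divdiv D" using dd L2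
    unfolding H_divdiv_def by (auto simp: sCurl_def transpose_sym_part)
  moreover have "\<forall>K\<in>T. \<exists>Q\<in>X_elem. \<forall>x\<in>interior K. sCurl (ext_field \<mu>) x = Q x"
    using Q const_X_elem by meson
  ultimately show ?thesis using dd by (simp add: X_space_def ker_divdiv_def)
qed

text \<open>Every point of a triangle is a limit of interior points, so the limit in the definition
  of the trace is a proper one.\<close>

lemma elem_trace_const:
  assumes K: "adj_elem T e \<in> T" and x: "x \<in> adj_elem T e" and f: "\<And>y. y \<in> interior (adj_elem T e) \<Longrightarrow> f y = a"
  shows "elem_trace T e f x = a"
proof -
  let ?K = "adj_elem T e"
  obtain z where "cball z (c * h) \<subseteq> ?K" using inball[OF K] by blast
  then have "z \<in> interior ?K" using c h by (intro interiorI[of "ball z (c * h)"]) (auto simp: subset_iff)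
  then have "closure (interior ?K) = closure ?K" using convex_closure_interior[OF convex_T[OF K]] by blast
  then have "x \<in> closure (interior ?K)" using x closed_T[OF K] by simp
  then have "x islimpt interior ?K"
    using interior_limit_point[of x "interior ?K"] by (auto simp: closure_def)
  then have nt: "at x within interior ?K \<noteq> bot" by (simp add: trivial_limit_within)
  have "eventually (\<lambda>y. f y = a) (at x within interior ?K)"
    by (simp add: eventually_at_filter f)
  then have "(f \<longlongrightarrow> a) (at x within interior ?K)" by (rule tendsto_eventually)
  then show ?thesis unfolding elem_trace_def using tendsto_Lim[OF nt] by blast
qed

lemma edge_normal_eq: "i \<le> H \<Longrightarrow> j < m i \<Longrightarrow> edge_normal T (seg i j) = rot (t i j)"
proof -
  assume "i \<le> H" "j < m i"
  then have "t i j = - rot (edge_normal T (seg i j))" using tangent by (simp add: edge_tangent_def)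
  then show ?thesis by (simp add: rot_minus rot_rot)
qed

text \<open>By \<open>curl_mat_nn\<close> the normal component of the increment, divided by the
  length of the edge, is minus the trace. The other trace vanishes because \<open>sCurl\<close> is
  constant on the element.\<close>

lemma ext_field_traces:
  assumes ij: "i \<le> H" "j < m i" and x: "x \<in> seg i j"
  shows "trace_nn T (seg i j) (sCurl (ext_field \<mu>)) x = \<mu> (seg i j)" "trace_qn T (seg i j) (sCurl (ext_field \<mu>)) x = 0"
proof -
  note e = seg_elem[OF ij]
  let ?K = "adj_elem T (seg i j)"
  obtain g where g: "\<And>i. linear (g i)" "\<And>x. x \<in> interior ?K \<Longrightarrow> sCurl (ext_field \<mu>) x = sym_part (curl_mat g)"
    "\<And>i a b. a \<in> verts ?K \<Longrightarrow> b \<in> verts ?K \<Longrightarrow> g i (a - b) = vert_val \<mu> a $ i - vert_val \<mu> b $ i"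
    by (rule ext_field_element[OF e(1), where \<mu> = \<mu>]) blast
  have xK: "x \<in> ?K" using x e(2) by blast
  have "l i j *\<^sub>R (\<chi> k. g k (t i j)) = (\<chi> k. g k (v i (Suc j) - v i j))"
  proof -
    have "l i j * g k (t i j) = g k (v i (Suc j) - v i j)" for k
      using linear_scale[OF g(1), of k "l i j" "t i j"] by (simp add: edge_dir_scale)
    then show ?thesis by (simp add: vec_eq_iff)
  qed
  also have "\<dots> = incr \<mu> i j"
    using vert_val_step[OF ij, of \<mu>] g(3)[OF e(4,3)] by (simp add: vec_eq_iff)
  finally have gi: "l i j *\<^sub>R (\<chi> k. g k (t i j)) = incr \<mu> i j" .
  have "l i j * (rot (t i j) \<bullet> (\<chi> k. g k (t i j))) = rot (t i j) \<bullet> incr \<mu> i j"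
    by (simp add: gi[symmetric])
  also have "\<dots> = - (l i j * \<mu> (seg i j))"
    using seg_len(4)[OF ij] rot_norm[of "t i j"] by (simp add: incr_def inner_diff_right rot_orthogonal norm_eq_sqrt_inner)
  finally have nn: "rot (t i j) \<bullet> (\<chi> k. g k (t i j)) = - \<mu> (seg i j)"
    using seg_len(3)[OF ij] by (metis less_irrefl mult_cancel_left mult_minus_right)
  show "trace_nn T (seg i j) (sCurl (ext_field \<mu>)) x = \<mu> (seg i j)"
    unfolding trace_nn_def
    by (rule elem_trace_const[OF e(1) xK]) (simp add: g(2) edge_normal_eq[OF ij] curl_mat_nn[OF g(1)] nn)
  show "trace_qn T (seg i j) (sCurl (ext_field \<mu>)) x = 0"
    unfolding trace_qn_def Let_def
  proof (rule elem_trace_const[OF e(1) xK])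
    fix y assume y: "y \<in> interior ?K"
    have "row_div (sCurl (ext_field \<mu>)) y = 0"
      using frechet_derivative_const_on[OF open_interior y, of "\<lambda>z. sCurl (ext_field \<mu>) z $ _ $ _"] g(2)
      by (simp add: row_div_def partial_deriv_def vec_eq_iff)
    moreover have "frechet_derivative (\<lambda>z. edge_normal T (seg i j) \<bullet> (sCurl (ext_field \<mu>) z *v edge_tangent T (seg i j))) (at y) = (\<lambda>_. 0)"
      by (rule frechet_derivative_const_on[OF open_interior y]) (simp add: g(2))
    ultimately show "edge_normal T (seg i j) \<bullet> row_div (sCurl (ext_field \<mu>)) y
       + frechet_derivative (\<lambda>z. edge_normal T (seg i j) \<bullet> (sCurl (ext_field \<mu>) z *v edge_tangent T (seg i j))) (at y) (edge_tangent T (seg i j)) = 0"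
      by simp
  qed
qed

definition centre :: "(real^2) set \<Rightarrow> real^2" where
  "centre K = (SOME z. cball z (c * h) \<subseteq> K)"

lemma centre: "K \<in> T \<Longrightarrow> cball (centre K) (c * h) \<subseteq> K"
  unfolding centre_def using someI_ex[OF inball] .

lemma centre_in: "K \<in> T \<Longrightarrow> centre K \<in> K"
  using centre[of K] c h by (auto simp: subset_iff)

definition \<rho> :: "(real^2) set \<Rightarrow> nat \<times> nat \<Rightarrow> real" where
  "\<rho> K q = dist (centre K) (v (fst q) (snd q)) + h"

lemma \<rho>_pos: "0 < \<rho> K q" using h by (simp add: \<rho>_def add_nonneg_pos)

text \<open>The discrete form of the bound of the gradient at \<open>x\<close> by the integral of
  \<open>slope / \<bar>x - y\<bar>\<close> over boundary points \<open>y\<close>.\<close>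

lemma vert_val_diff:
  assumes K: "K \<in> T" and ab: "a \<in> verts K" "b \<in> verts K"
  shows "\<bar>vert_val \<mu> a $ i - vert_val \<mu> b $ i\<bar>
     \<le> 2 * steepness * h * (\<Sum>q\<in>edge_ix. l (fst q) (snd q) * slope \<mu> (fst q) (snd q) / \<rho> K q)"
proof -
  have abK: "a \<in> K" "b \<in> K" using ab verts_subset by auto
  have dab: "dist a b \<le> h" by (rule dist_elem_le[OF K abK])
  have \<Theta>: "\<bar>\<Theta> (fst q) (snd q) a - \<Theta> (fst q) (snd q) b\<bar> \<le> 2 * steepness * h / \<rho> K q" if q: "q \<in> edge_ix" for q
  proof -
    obtain i' j where ij: "q = (i', j)" "i' \<le> H" "j < m i'" using q by (cases q) (auto simp: edge_ix_iff)
    have 1: "steepness * (dist x x' / (dist x (v i' j) + h)) \<le> 2 * steepness * h / \<rho> K q" if "x \<in> K" "x' \<in> K" for x x'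
    proof -
      have "\<rho> K q \<le> 2 * (dist x (v i' j) + h)"
        using dist_triangle[of "centre K" "v i' j" x] dist_elem_le[OF K centre_in[OF K] that(1)] zero_le_dist[of x "v i' j"]
        unfolding \<rho>_def ij fst_conv snd_conv distrib_left by linarith
      then have "dist x x' / (dist x (v i' j) + h) \<le> h / (\<rho> K q / 2)"
        using dist_elem_le[OF K that] \<rho>_pos[of K q] h(1) by (intro frac_le) auto
      then have "steepness * (dist x x' / (dist x (v i' j) + h)) \<le> steepness * (h / (\<rho> K q / 2))"
        using steepness_pos by (intro mult_left_mono) auto
      then show ?thesis by (simp add: mult_ac)
    qed
    show ?thesis
      using \<Theta>_diff[OF ij(2,3), of a b] \<Theta>_diff[OF ij(2,3), of b a] 1[OF abK] 1[OF abK(2,1)] ij(1) by auto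
  qed
  have "\<bar>vert_val \<mu> a $ i - vert_val \<mu> b $ i\<bar> \<le> norm (vert_val \<mu> a - vert_val \<mu> b)"
    using component_le_norm_cart[of "vert_val \<mu> a - vert_val \<mu> b" i] by simp
  also have "vert_val \<mu> a - vert_val \<mu> b
     = (\<Sum>q\<in>edge_ix. (\<Theta> (fst q) (snd q) a - \<Theta> (fst q) (snd q) b) *\<^sub>R incr \<mu> (fst q) (snd q))"
    by (simp add: vert_val_def scaleR_diff_left sum_subtractf)
  also have "norm \<dots> \<le> (\<Sum>q\<in>edge_ix. (2 * steepness * h / \<rho> K q) * (l (fst q) (snd q) * slope \<mu> (fst q) (snd q)))"
  proof (rule order_trans[OF norm_sum sum_mono])
    fix q assume q: "q \<in> edge_ix"
    then have ij: "fst q \<le> H" "snd q < m (fst q)" by (auto simp: edge_ix_def)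
    show "norm ((\<Theta> (fst q) (snd q) a - \<Theta> (fst q) (snd q) b) *\<^sub>R incr \<mu> (fst q) (snd q))
      \<le> (2 * steepness * h / \<rho> K q) * (l (fst q) (snd q) * slope \<mu> (fst q) (snd q))"
      using mult_mono[OF \<Theta>[OF q] norm_incr[OF ij, of \<mu>]] steepness_pos h \<rho>_pos[of K q] by simp
  qed
  also have "\<dots> = 2 * steepness * h * (\<Sum>q\<in>edge_ix. l (fst q) (snd q) * slope \<mu> (fst q) (snd q) / \<rho> K q)"
    by (simp add: sum_distrib_left)
  finally show ?thesis .
qed

definition S_area :: real where "S_area = 36 * (2 * R + 3) powr (2/3)"

definition S_edge :: real where "S_edge = real (Suc H) * (12 * (2 * A / c) powr (2/3) * (\<Lambda> / c) powr (1/3))"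

definition C_bound :: real where
  "C_bound = 64 * steepness\<^sup>2 / c ^ 4 * S_area * S_edge * (2 + 2 * \<Lambda>\<^sup>2 / \<kappa>\<^sup>2)"

lemma area_sum: "q \<in> edge_ix \<Longrightarrow> (\<Sum>K\<in>T. (c * h)\<^sup>2 * \<rho> K q powr (-4/3)) \<le> S_area"
proof -
  assume q: "q \<in> edge_ix"
  have ch: "0 < c * h" "2 * (c * h) \<le> h" "c * h \<le> 1" using c h by (auto intro: mult_le_one)
  have "(\<Sum>K\<in>T. (c * h)\<^sup>2 * (dist (centre K) (v (fst q) (snd q)) + h) powr (-4/3)) \<le> 36 * (2 * R + 3 * (c * h)) powr (2/3)"
  proof (rule sum_separated_points[OF finite_T ch(1,2)])
    show "2 * (c * h) \<le> dist (centre K) (centre K')" if "K \<in> T" "K' \<in> T" "K \<noteq> K'" for K K'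
      using inballs_separated[OF that centre[OF that(1)] centre[OF that(2)]] .
    show "dist (centre K) (v (fst q) (snd q)) \<le> 2 * R" if "K \<in> T" for K
    proof (rule dist_le_2R)
      show "centre K \<in> closure D" using centre_in[OF that] that Union_T by blast
      show "v (fst q) (snd q) \<in> closure D" using q by (intro seg_elem(6)) (auto simp: edge_ix_def)
    qed
  qed
  also have "\<dots> \<le> S_area" unfolding S_area_def using ch R0 by (intro mult_left_mono powr_mono2) auto
  finally show ?thesis by (simp add: \<rho>_def)
qed

lemma edge_sum: "(\<Sum>q\<in>edge_ix. l (fst q) (snd q) * \<rho> K q powr (-2/3)) \<le> S_edge"
proof -
  have "(\<Sum>q\<in>edge_ix. l (fst q) (snd q) * \<rho> K q powr (-2/3))
    = (\<Sum>i\<le>H. \<Sum>j<m i. l i j * (dist (centre K) (v i j) + h) powr (-2/3))"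
    unfolding \<rho>_def by (rule sum_edge_ix)
  also have "\<dots> \<le> (\<Sum>i\<le>H. 12 * (2 * A / c) powr (2/3) * (\<Lambda> / c) powr (1/3))"
  proof (rule sum_mono)
    fix i assume "i \<in> {..H}"
    then have i: "i \<le> H" by simp
    have "(\<Sum>j<m i. l i j * (dist (centre K) (v i j) + h) powr (-2/3))
       \<le> (\<Sum>j<m i. h * (dist (centre K) (v i j) + h) powr (-2/3))"
      using seg_len(2)[OF i] by (intro sum_mono mult_right_mono) auto
    also have "\<dots> \<le> 12 * (2 * A / c) powr (2/3) * (poly_len (v i) (m i) / c) powr (1/3)"
      by (rule chord_arc_polygon.sum_inverse_dist[OF polygon[OF i]])
    also have "\<dots> \<le> 12 * (2 * A / c) powr (2/3) * (\<Lambda> / c) powr (1/3)"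
      using len[OF i] c poly_len_nonneg[of "v i" "m i"]
      by (intro mult_left_mono powr_mono2) (auto intro: divide_right_mono)
    finally show "(\<Sum>j<m i. l i j * (dist (centre K) (v i j) + h) powr (-2/3))
      \<le> 12 * (2 * A / c) powr (2/3) * (\<Lambda> / c) powr (1/3)" .
  qed
  also have "\<dots> = S_edge" by (simp add: S_edge_def)
  finally show ?thesis .
qed

text \<open>On an element the gradient is at most \<open>steepness / c\<close> times a sum of
  \<open>l * slope / \<rho>\<close> over the boundary edges. By \<open>sum_squares_schur\<close> the
  square sum of these is controlled by that of the slopes, hence by that of
  \<open>\<mu>\<close>.\<close>

theorem ext_field_L2_bound:
  "L2_norm_on D (sCurl (ext_field \<mu>)) \<le> sqrt C_bound * sqrt (\<Sum>e\<in>bdry_edges D T. diameter e * \<bar>\<mu> e\<bar>\<^sup>2)"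
proof -
  \<comment> \<open>The bound for the gradient on \<open>K\<close>, up to the factor \<open>steepness / c\<close>.\<close>
  define b where "b = (\<lambda>K. \<Sum>q\<in>edge_ix. l (fst q) (snd q) * slope \<mu> (fst q) (snd q) / \<rho> K q)"
  have "\<forall>K\<in>T. \<exists>Q. (\<forall>x\<in>interior K. sCurl (ext_field \<mu>) x = Q) \<and> norm Q \<le> 4 * (steepness / c * b K)"
  proof
    fix K assume K: "K \<in> T"
    obtain g where g: "\<And>i. linear (g i)" "\<And>x. x \<in> interior K \<Longrightarrow> sCurl (ext_field \<mu>) x = sym_part (curl_mat g)"
      "\<And>i a b. a \<in> verts K \<Longrightarrow> b \<in> verts K \<Longrightarrow> g i (a - b) = vert_val \<mu> a $ i - vert_val \<mu> b $ i"
      by (rule ext_field_element[OF K, where \<mu> = \<mu>]) blast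
    have ch: "0 < c * h" using c h by simp
    have "\<bar>g i (axis j 1)\<bar> \<le> steepness / c * b K" for i j
    proof -
      have "2 * (c * h) * \<bar>g i (axis j 1)\<bar> \<le> 2 * steepness * h * b K"
      proof (rule affine_fun_gradient[OF simplex_T[OF K] g(1) ch centre[OF K]])
        show "\<bar>affine_fun 0 (g i) a - affine_fun 0 (g i) b'\<bar> \<le> 2 * steepness * h * b K" if "a \<in> verts K" "b' \<in> verts K" for a b'
          unfolding affine_fun_diff[OF g(1)] g(3)[OF that] b_def by (rule vert_val_diff[OF K that])
      qed simp
      then have "(2 * h) * (c * \<bar>g i (axis j 1)\<bar>) \<le> (2 * h) * (steepness * b K)" by (simp add: mult_ac)
      then have "c * \<bar>g i (axis j 1)\<bar> \<le> steepness * b K" using h by simp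
      then show ?thesis using c by (simp add: field_simps)
    qed
    then have "norm (sym_part (curl_mat g)) \<le> 4 * (steepness / c * b K)" by (rule norm_curl_mat_le)
    then show "\<exists>Q. (\<forall>x\<in>interior K. sCurl (ext_field \<mu>) x = Q) \<and> norm Q \<le> 4 * (steepness / c * b K)" using g(2) by blast
  qed
  then obtain Q where Q: "\<And>K x. K \<in> T \<Longrightarrow> x \<in> interior K \<Longrightarrow> sCurl (ext_field \<mu>) x = Q K"
    "\<And>K. K \<in> T \<Longrightarrow> norm (Q K) \<le> 4 * (steepness / c * b K)" by metis
  have "(\<integral>x. (norm (sCurl (ext_field \<mu>) x))\<^sup>2 \<partial>lebesgue_on D) \<le> (\<Sum>K\<in>T. measure lebesgue K * (norm (Q K))\<^sup>2)"
    by (rule piecewise_constant_L2(2)[OF Q(1)])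
  also have "\<dots> \<le> (\<Sum>K\<in>T. (4 * h\<^sup>2) * (4 * (steepness / c * b K))\<^sup>2)"
    using measure_element_le diam Q(2) by (intro sum_mono mult_mono power_mono) auto
  also have "\<dots> = 64 * steepness\<^sup>2 / c ^ 4 * (\<Sum>K\<in>T. (c * h)\<^sup>2 * (b K)\<^sup>2)"
    using c by (simp add: sum_distrib_left power_mult_distrib power_divide field_simps power4_eq_xxxx power2_eq_square)
  also have "\<dots> \<le> 64 * steepness\<^sup>2 / c ^ 4 * (S_area * S_edge * (\<Sum>q\<in>edge_ix. l (fst q) (snd q) * (slope \<mu> (fst q) (snd q))\<^sup>2))"
  proof (rule mult_left_mono)
    show "(\<Sum>K\<in>T. (c * h)\<^sup>2 * (b K)\<^sup>2) \<le> S_area * S_edge * (\<Sum>q\<in>edge_ix. l (fst q) (snd q) * (slope \<mu> (fst q) (snd q))\<^sup>2)"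
      unfolding b_def using finite_edge_ix \<rho>_pos edge_sum area_sum
      by (intro sum_squares_schur) (auto simp: S_edge_def)
  qed simp
  also have "\<dots> \<le> 64 * steepness\<^sup>2 / c ^ 4 * (S_area * S_edge * ((2 + 2 * \<Lambda>\<^sup>2 / \<kappa>\<^sup>2) * (\<Sum>q\<in>edge_ix. l (fst q) (snd q) * (\<mu> (seg (fst q) (snd q)))\<^sup>2)))"
  proof (intro mult_left_mono)
    have "(\<Sum>q\<in>edge_ix. l (fst q) (snd q) * (slope \<mu> (fst q) (snd q))\<^sup>2) = (\<Sum>i\<le>H. \<Sum>j<m i. l i j * (slope \<mu> i j)\<^sup>2)"
      by (rule sum_edge_ix)
    also have "\<dots> \<le> (\<Sum>i\<le>H. (2 + 2 * \<Lambda>\<^sup>2 / \<kappa>\<^sup>2) * (\<Sum>j<m i. l i j * (\<mu> (seg i j))\<^sup>2))"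
      by (intro sum_mono sum_slope_squares) auto
    also have "\<dots> = (2 + 2 * \<Lambda>\<^sup>2 / \<kappa>\<^sup>2) * (\<Sum>q\<in>edge_ix. l (fst q) (snd q) * (\<mu> (seg (fst q) (snd q)))\<^sup>2)"
      by (simp add: sum_distrib_left[symmetric] sum_edge_ix[of "\<lambda>i j. l i j * (\<mu> (seg i j))\<^sup>2"])
    finally show "(\<Sum>q\<in>edge_ix. l (fst q) (snd q) * (slope \<mu> (fst q) (snd q))\<^sup>2)
       \<le> (2 + 2 * \<Lambda>\<^sup>2 / \<kappa>\<^sup>2) * (\<Sum>q\<in>edge_ix. l (fst q) (snd q) * (\<mu> (seg (fst q) (snd q)))\<^sup>2)" .
  qed (auto simp: S_area_def S_edge_def)
  also have "\<dots> = C_bound * (\<Sum>e\<in>bdry_edges D T. diameter e * \<bar>\<mu> e\<bar>\<^sup>2)"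
    by (simp only: C_bound_def sum_edges mult_ac)
  finally have "sqrt (\<integral>x. (norm (sCurl (ext_field \<mu>) x))\<^sup>2 \<partial>lebesgue_on D)
     \<le> sqrt (C_bound * (\<Sum>e\<in>bdry_edges D T. diameter e * \<bar>\<mu> e\<bar>\<^sup>2))" by (rule real_sqrt_le_mono)
  then show ?thesis by (simp add: L2_norm_on_def real_sqrt_mult)
qed

end

section \<open>Constants independent of the mesh size\<close>

lemma finite_uniform_bound:
  fixes Q :: "'i \<Rightarrow> real \<Rightarrow> bool"
  assumes "finite I" "\<And>i. i \<in> I \<Longrightarrow> \<exists>C. \<forall>C'\<ge>C. Q i C'"
  shows "\<exists>C. \<forall>C'\<ge>C. \<forall>i\<in>I. Q i C'"
  using assms
proof (induction I rule: finite_induct)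
  case (insert i I)
  obtain C1 where "\<forall>C'\<ge>C1. \<forall>i\<in>I. Q i C'" using insert by blast
  moreover obtain C2 where "\<forall>C'\<ge>C2. Q i C'" using insert by blast
  ultimately have "\<forall>C'\<ge>max C1 C2. \<forall>j\<in>insert i I. Q j C'" by auto
  then show ?case by blast
qed auto

lemma hausdorff_dist_nearby:
  assumes A: "compact A" and B: "compact B" "B \<noteq> {}" and less: "hausdorff_dist A B < \<epsilon>" and a: "a \<in> A"
  shows "\<exists>b\<in>B. dist a b < \<epsilon>"
proof -
  have "bounded ((\<lambda>a. infdist a B) ` A)"
    by (intro compact_imp_bounded compact_continuous_image A continuous_intros)
  then have "bdd_above ((\<lambda>a. infdist a B) ` A)" by (rule bounded_imp_bdd_above)
  then have "infdist a B \<le> (SUP a\<in>A. infdist a B)" using a by (intro cSUP_upper) auto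
  then have "infdist a B < \<epsilon>" using less by (simp add: hausdorff_dist_def)
  moreover obtain b where "b \<in> B" "infdist a B = dist a b"
    using infdist_attains_inf[of B a] B by (auto intro: compact_imp_closed)
  ultimately show ?thesis by auto
qed

lemma hausdorff_dist_commute: "hausdorff_dist A B = hausdorff_dist B A"
  by (simp add: hausdorff_dist_def max.commute)

text \<open>The norm has no local maximum in an open set, so its maximum over the closure is
  attained at the boundary.\<close>

lemma norm_le_of_frontier:
  fixes D :: "(real^2) set"
  assumes D: "open D" "bounded D" "D \<noteq> {}" and fr: "\<And>b. b \<in> frontier D \<Longrightarrow> norm b \<le> R" and x: "x \<in> closure D"
  shows "norm x \<le> R"
proof -
  have "compact (closure D)" using D by (simp add: compact_closure)
  then obtain y where y: "y \<in> closure D" "\<And>z. z \<in> closure D \<Longrightarrow> norm z \<le> norm y"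
    using continuous_attains_sup[of "closure D" norm] D by (auto intro: continuous_intros)
  have "y \<notin> D"
  proof
    assume "y \<in> D"
    then obtain e where e: "e > 0" "ball y e \<subseteq> D" using D(1) by (auto simp: open_contains_ball)
    define u where "u = (if y = 0 then axis 1 1 else y /\<^sub>R norm y)"
    have u: "norm u = 1" by (simp add: u_def)
    have yu: "y = norm y *\<^sub>R u" by (simp add: u_def)
    have "y + (e/2) *\<^sub>R u \<in> ball y e" using e u by (simp add: dist_norm)
    then have "norm (y + (e/2) *\<^sub>R u) \<le> norm y" using e closure_subset y by blast
    moreover have "y + (e/2) *\<^sub>R u = (norm y + e/2) *\<^sub>R u" by (subst yu) (simp add: algebra_simps)
    then have "norm (y + (e/2) *\<^sub>R u) = norm y + e/2" using u e by simp
    ultimately show False using e by simp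
  qed
  then have "y \<in> frontier D" using y D by (simp add: frontier_def interior_open)
  then show ?thesis using fr y(2)[OF x] by force
qed

text \<open>Shape regularity bounds the inscribed ball in terms of the diameter of the element, and
  quasi-uniformity compares the latter with \<open>h\<close>.\<close>

lemma uniform_inball:
  assumes sr: "uniformly_shape_regular J Th" and qu: "quasi_uniform J Th" and size: "\<forall>h\<in>J. mesh_size (Th h) = h"
    and J: "J \<subseteq> {0<..}" and tri: "\<And>h K. h \<in> J \<Longrightarrow> K \<in> Th h \<Longrightarrow> 2 simplex K"
  obtains c where "0 < c" "c \<le> 1/2" "\<And>h K. h \<in> J \<Longrightarrow> K \<in> Th h \<Longrightarrow> \<exists>z. cball z (c * h) \<subseteq> K"
proof -
  obtain \<sigma> where \<sigma>: "\<And>h K. h \<in> J \<Longrightarrow> K \<in> Th h \<Longrightarrow> diameter K \<le> \<sigma> * inball_diameter K"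
    using sr by (auto simp: uniformly_shape_regular_def)
  obtain \<tau> where \<tau>: "\<And>h K. h \<in> J \<Longrightarrow> K \<in> Th h \<Longrightarrow> mesh_size (Th h) \<le> \<tau> * diameter K"
    using qu by (auto simp: quasi_uniform_def)
  define s where "s = max \<sigma> 1"
  define t where "t = max \<tau> 1"
  have st: "s \<ge> 1" "t \<ge> 1" "s > 0" "t > 0" by (auto simp: s_def t_def)
  define c where "c = 1 / (4 * s * t)"
  have st1: "1 \<le> s * t" using st mult_mono[of 1 s 1 t] by simp
  have c: "0 < c" "c \<le> 1/2" using st st1 by (auto simp: c_def divide_simps)
  have "\<exists>z. cball z (c * h) \<subseteq> K" if h: "h \<in> J" and K: "K \<in> Th h" for h K
  proof -
    have h0: "0 < h" using h J by auto
    let ?S = "{2 * r | r. 0 \<le> r \<and> (\<exists>x. cball x r \<subseteq> K)}"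
    have bK: "bounded K" using compact_simplex[OF tri[OF h K]] by (rule compact_imp_bounded)
    have "verts K \<noteq> {}" using triangle_verts(2)[OF tri[OF h K]] by force
    then obtain x where "x \<in> K" using verts_subset by blast
    then have zero: "0 \<in> ?S" by (intro CollectI exI[of _ 0]) auto
    have ub: "y \<le> diameter K" if y: "y \<in> ?S" for y
    proof -
      obtain r x where r: "y = 2 * r" "0 \<le> r" "cball x r \<subseteq> K" using y by blast
      have "x + r *\<^sub>R axis 1 1 \<in> cball x r" "x - r *\<^sub>R axis 1 1 \<in> cball x r" using r by (auto simp: dist_norm)
      then have "dist (x + r *\<^sub>R axis 1 1) (x - r *\<^sub>R axis 1 1) \<le> diameter K"
        using r(3) by (intro diameter_bounded_bound[OF bK]) auto
      moreover have "dist (x + r *\<^sub>R axis 1 1) (x - r *\<^sub>R axis 1 1) = 2 * r"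
      proof -
        have "(x + r *\<^sub>R axis 1 1) - (x - r *\<^sub>R axis 1 1) = (2 * r) *\<^sub>R axis 1 1" by (simp add: scaleR_2[symmetric])
        then show ?thesis using r by (simp add: dist_norm)
      qed
      ultimately show ?thesis using r by simp
    qed
    have bdd: "bdd_above ?S" using ub by (intro bdd_aboveI) auto
    have in0: "0 \<le> inball_diameter K" unfolding inball_diameter_def using zero bdd by (intro cSup_upper) auto
    have "h \<le> \<tau> * diameter K" using \<tau>[OF h K] size h by simp
    also have "\<dots> \<le> t * diameter K" using bK by (intro mult_right_mono) (auto simp: t_def diameter_ge_0)
    also have "\<dots> \<le> t * (s * inball_diameter K)"
    proof (rule mult_left_mono)
      have "\<sigma> * inball_diameter K \<le> s * inball_diameter K" using in0 by (intro mult_right_mono) (auto simp: s_def)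
      then show "diameter K \<le> s * inball_diameter K" using \<sigma>[OF h K] by linarith
    qed (use st in auto)
    finally have "h / (s * t) \<le> inball_diameter K" using st by (simp add: field_simps)
    moreover have "2 * (c * h) < h / (s * t)" using st h0 by (simp add: c_def field_simps)
    ultimately have "2 * (c * h) < Sup ?S" unfolding inball_diameter_def by simp
    then obtain y where "y \<in> ?S" "2 * (c * h) < y" using less_cSup_iff[of ?S] zero bdd by blast
    then obtain r x where "cball x r \<subseteq> K" "c * h < r" by auto
    then have "cball x (c * h) \<subseteq> K" by (meson less_imp_le order_trans subset_cball)
    then show ?thesis by blast
  qed
  with c that show thesis by blast
qed

context simple_loop begin

text \<open>The parameters of the vertices are continued to a second turn. Then the two arcs between
  vertices \<open>k\<close> and \<open>l\<close> run from index \<open>k\<close> to \<open>l\<close>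
  and from \<open>l\<close> to \<open>k + m\<close>.\<close>

lemma loop_polygon:
  fixes s :: "nat \<Rightarrow> real"
  assumes m: "3 \<le> m" and s: "strict_mono_on {..<m} s" "s ` {..<m} \<subseteq> {0..<1}"
  defines "v \<equiv> \<lambda>j. g (s (j mod m))"
  shows "inj_on v {..<m}" "v ` {..<m} \<subseteq> path_image g" "poly_len v m \<le> \<Lambda>"
    and "\<lbrakk>\<And>s t. 0 \<le> s \<Longrightarrow> s \<le> 1 \<Longrightarrow> s < t \<Longrightarrow> t < s + 1 \<Longrightarrow>
        arc_le (wrap g) (A * dist (wrap g s) (wrap g t)) s t \<or>
        arc_le (wrap g) (A * dist (wrap g s) (wrap g t)) t (s + 1); k < l; l < m\<rbrakk>
      \<Longrightarrow> poly_len v l - poly_len v k \<le> A * dist (v k) (v l) \<or>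
          poly_len v m - (poly_len v l - poly_len v k) \<le> A * dist (v k) (v l)"
proof -
  have rng: "0 \<le> s j" "s j < 1" if "j < m" for j using s(2) that by auto
  have sm: "s j < s k" if "j < k" "k < m" for j k using s(1) that by (auto simp: monotone_on_def)
  define S where "S = (\<lambda>j. if j < m then s j else s (j - m) + 1)"
  have vS: "v j = wrap g (S j)" if "j < 2 * m" for j
  proof (cases "j < m")
    case True then show ?thesis using rng[of j] by (simp add: v_def S_def wrap_def)
  next
    case False
    then have j: "j - m < m" "j mod m = j - m" using that by (auto simp: mod_if)
    then have "v j = wrap g (s (j - m))" using rng[of "j - m"] by (simp add: v_def wrap_def)
    also have "\<dots> = wrap g (s (j - m) + 1)" using rng[OF j(1)] by (intro wrap_shift[symmetric]) auto
    finally show ?thesis using False by (simp add: S_def)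
  qed
  have Sm: "S i \<le> S (Suc i)" if "Suc i < 2 * m" for i
  proof -
    consider "Suc i < m" | "Suc i = m" | "m \<le> i" by linarith
    then show ?thesis
    proof cases
      case 1 then show ?thesis using sm[of i "Suc i"] by (simp add: S_def)
    next
      case 2 then show ?thesis using rng[of i] rng[of 0] m by (simp add: S_def)
    next
      case 3
      then have "Suc (i - m) < m" using that by arith
      then show ?thesis using sm[of "i - m" "Suc (i - m)"] 3 by (simp add: S_def Suc_diff_le)
    qed
  qed
  have arc: "(\<Sum>i\<in>{k..<l}. dist (v i) (v (Suc i))) \<le> B" if "arc_le (wrap g) B (S k) (S l)" "k \<le> l" "l < 2 * m" for k l B
  proof -
    have "(\<Sum>i\<in>{k..<l}. dist (v i) (v (Suc i))) = (\<Sum>i\<in>{k..<l}. dist (wrap g (S i)) (wrap g (S (Suc i))))"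
      using vS that by (intro sum.cong) auto
    also have "\<dots> \<le> B"
    proof (rule that(1)[unfolded arc_le_def, rule_format, OF that(2) _ refl refl])
      show "S i \<le> S (Suc i)" if "k \<le> i \<and> i < l" for i using Sm[of i] that \<open>l < 2 * m\<close> by simp
    qed
    finally show ?thesis .
  qed
  show "inj_on v {..<m}"
  proof (rule inj_onI)
    fix j k assume jk: "j \<in> {..<m}" "k \<in> {..<m}" "v j = v k"
    then have "s j = s k" using rng[of j] rng[of k] by (intro wrap_inj) (auto simp: v_def wrap_def)
    then show "j = k" using sm[of j k] sm[of k j] jk by (metis lessThan_iff less_irrefl linorder_neqE_nat)
  qed
  show "v ` {..<m} \<subseteq> path_image g"
  proof (rule image_subsetI)
    fix j assume "j \<in> {..<m}"
    then show "v j \<in> path_image g" using rng[of j] unfolding v_def path_image_def by (intro imageI) auto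
  qed
  have S0m: "S m = S 0 + 1" using m by (simp add: S_def)
  have "\<Lambda>-lipschitz_on {S 0..S m} (wrap g)"
    using wrap_lipschitz rng[of 0] m S0m by (rule_tac lipschitz_on_subset) (auto simp: S_def)
  from arc[OF arc_le_lipschitz[OF this]] m S0m show "poly_len v m \<le> \<Lambda>"
    by (simp add: poly_len_def lessThan_atLeast0)
  assume ca: "\<And>s t. 0 \<le> s \<Longrightarrow> s \<le> 1 \<Longrightarrow> s < t \<Longrightarrow> t < s + 1 \<Longrightarrow>
        arc_le (wrap g) (A * dist (wrap g s) (wrap g t)) s t \<or>
        arc_le (wrap g) (A * dist (wrap g s) (wrap g t)) t (s + 1)" and kl: "k < l" "l < m"
  have Skl: "S k = s k" "S l = s l" "S (k + m) = S k + 1" using kl by (auto simp: S_def)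
  have per: "poly_len v (k + m) = poly_len v m + poly_len v k"
  proof -
    have "poly_len v (m + k) - poly_len v m = (\<Sum>i\<in>{m..<m + k}. dist (v i) (v (Suc i)))" by (rule poly_len_diff) simp
    also have "\<dots> = (\<Sum>i<k. dist (v (m + i)) (v (Suc (m + i))))"
      by (simp add: sum.shift_bounds_nat_ivl[of _ 0 m k, simplified] lessThan_atLeast0 add.commute)
    also have "\<dots> = poly_len v k" unfolding poly_len_def v_def
      by (intro sum.cong) (auto simp: mod_Suc)
    finally show ?thesis by (simp add: add.commute)
  qed
  from ca[of "S k" "S l"] kl rng[of k] rng[of l] sm[OF kl]
  have "arc_le (wrap g) (A * dist (v k) (v l)) (S k) (S l) \<or> arc_le (wrap g) (A * dist (v k) (v l)) (S l) (S (k + m))"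
    unfolding Skl(3) using vS[of k] vS[of l] Skl by auto
  then show "poly_len v l - poly_len v k \<le> A * dist (v k) (v l) \<or>
          poly_len v m - (poly_len v l - poly_len v k) \<le> A * dist (v k) (v l)"
  proof
    assume "arc_le (wrap g) (A * dist (v k) (v l)) (S k) (S l)"
    from arc[OF this] kl show ?thesis by (simp add: poly_len_diff)
  next
    assume "arc_le (wrap g) (A * dist (v k) (v l)) (S l) (S (k + m))"
    from arc[OF this] kl have "poly_len v (k + m) - poly_len v l \<le> A * dist (v k) (v l)"
      by (simp add: poly_len_diff)
    then show ?thesis using per by linarith
  qed
qed

end

lemma (in mesh) bdry_edges_in_components:
  assumes bij: "bij_betw G {0..H} (components (frontier D))"
  shows "bdry_edges D T = (\<Union>i\<in>{0..H}. {e \<in> bdry_edges D T. e \<subseteq> G i})"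
proof -
  have "\<exists>i\<in>{0..H}. e \<subseteq> G i" if e: "e \<in> bdry_edges D T" for e
  proof -
    obtain K where K: "K \<in> T" "e edge_of K" "e \<subseteq> frontier D" using e by (auto simp: bdry_edges_def)
    obtain a b where ab: "e = closed_segment a b" by (rule edge_is_segment[OF K(1,2)])
    then have "connected e" "e \<noteq> {}" by (auto simp: connected_segment)
    then obtain C where C: "C \<in> components (frontier D)" "e \<subseteq> C"
      using exists_component_superset[OF K(3)] K(3) by blast
    then have "C \<in> G ` {0..H}" using bij by (simp add: bij_betw_def)
    then show ?thesis using C(2) by blast
  qed
  then show ?thesis by auto
qed

lemma (in mesh) bdry_vertex_near_frontier:
  assumes bij: "bij_betw G {0..H} (components (frontier D))" and b: "b \<in> frontier D"
    and diam: "\<And>K. K \<in> T \<Longrightarrow> diameter K \<le> h"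
  obtains i w where "i \<le> H" "w \<in> bdry_vertices D T \<inter> G i" "dist b w \<le> h"
proof -
  obtain K w where K: "K \<in> T" "b \<in> K" "w \<in> verts K" "w \<in> frontier D" by (rule boundary_vertex_near[OF b])
  have wB: "w \<in> bdry_vertices D T" using K by (auto simp: bdry_vertices_def verts_def)
  obtain C where C: "C \<in> components (frontier D)" "w \<in> C" using K(4) Union_components[of "frontier D"] by blast
  then have "C \<in> G ` {0..H}" using bij by (simp add: bij_betw_def)
  then obtain i where i: "i \<in> {0..H}" "w \<in> G i" using C(2) by blast
  have "w \<in> K" using K(3) verts_subset by blast
  then have "dist b w \<le> h"
    using diameter_bounded_bound[of K b w] K compact_imp_bounded[OF compact_T[OF K(1)]] diam[OF K(1)] by fastforce
  with that i wB show thesis by auto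
qed

theorem lemma4p3:
  fixes \<Omega> :: "(real^2) set" and H :: nat
    and \<Gamma> :: "nat \<Rightarrow> (real^2) set" and \<gamma> :: "nat \<Rightarrow> real \<Rightarrow> real^2"
    and J :: "real set"
    and \<Omega>h :: "real \<Rightarrow> (real^2) set" and \<Gamma>h :: "real \<Rightarrow> nat \<Rightarrow> (real^2) set"
    and Th :: "real \<Rightarrow> (real^2) set set"
  assumes "lipschitz_domain \<Omega>"
    and "bij_betw \<Gamma> {0..H} (components (frontier \<Omega>))"
    and "\<forall>i\<in>{0..H}. right_oriented_param \<Omega> (\<Gamma> i) (\<gamma> i)"
    and "J \<subseteq> {0<..}" and "0 islimpt J"
    and "\<forall>h\<in>J. polygonal_lipschitz_domain (\<Omega>h h)"
    and "\<forall>h\<in>J. bij_betw (\<Gamma>h h) {0..H} (components (frontier (\<Omega>h h)))"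
    and "\<forall>h\<in>J. conforming_triangulation (Th h) (\<Omega>h h)"
    and "\<forall>h\<in>J. mesh_size (Th h) = h"
    and "uniformly_shape_regular J Th" and "quasi_uniform J Th"
    and "((\<lambda>h. hausdorff_dist (frontier (\<Omega>h h)) (frontier \<Omega>)) \<longlongrightarrow> 0) (at 0 within J)"
    and "\<forall>h\<in>J. \<forall>i\<in>{0..H}. same_cyclic_order (\<Omega>h h) (Th h) (\<Gamma>h h i) (\<gamma> i)"
  shows "\<exists>h0>0. \<exists>C. \<forall>h\<in>J. h \<le> h0 \<longrightarrow>
    (\<exists>p :: ((real^2) set \<Rightarrow> real) \<Rightarrow> real^2 \<Rightarrow> real^2.
       (\<forall>\<mu>\<in>edge_data (bdry_edges (\<Omega>h h) (Th h)).
          p \<mu> \<in> S1_vec (\<Omega>h h) (Th h) \<and>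
          sCurl (p \<mu>) \<in> X_space (\<Omega>h h) (Th h) \<inter> ker_divdiv (\<Omega>h h) \<and>
          (\<forall>e\<in>bdry_edges (\<Omega>h h) (Th h). \<forall>x\<in>e.
             trace_nn (Th h) e (sCurl (p \<mu>)) x = \<mu> e \<and>
             trace_qn (Th h) e (sCurl (p \<mu>)) x = 0) \<and>
          L2_norm_on (\<Omega>h h) (sCurl (p \<mu>))
            \<le> C * sqrt (\<Sum>e\<in>bdry_edges (\<Omega>h h) (Th h). diameter e * \<bar>\<mu> e\<bar>\<^sup>2)) \<and>
       linear_on_edge_data (bdry_edges (\<Omega>h h) (Th h)) (closure (\<Omega>h h)) p)"
proof -
  have domain: "open \<Omega>" "bounded \<Omega>" "\<Omega> \<noteq> {}" using assms(1) by (auto simp: lipschitz_domain_def)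
  have fr_cpt: "compact (frontier \<Omega>)" using domain by (simp add: compact_frontier_bounded)
  have comp: "\<Gamma> i \<in> components (frontier \<Omega>)" if "i \<le> H" for i
    using assms(2) that by (auto simp: bij_betw_def)
  have param: "simple_path (\<gamma> i)" "pathfinish (\<gamma> i) = pathstart (\<gamma> i)" "path_image (\<gamma> i) = \<Gamma> i"
    "\<exists>L. L-lipschitz_on {0..1} (\<gamma> i)" if "i \<le> H" for i
    using assms(3) that by (auto simp: right_oriented_param_def)
  have "\<exists>\<Lambda>. \<forall>\<Lambda>'\<ge>\<Lambda>. \<forall>i\<in>{0..H}. \<Lambda>'-lipschitz_on {0..1} (\<gamma> i)"
  proof (rule finite_uniform_bound)
    fix i assume "i \<in> {0..H}"
    then obtain L where "L-lipschitz_on {0..1} (\<gamma> i)" using param(4)[of i] by auto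
    then show "\<exists>\<Lambda>. \<forall>\<Lambda>'\<ge>\<Lambda>. \<Lambda>'-lipschitz_on {0..1} (\<gamma> i)" by (blast intro: lipschitz_on_le)
  qed simp
  then obtain \<Lambda>0 where \<Lambda>0: "\<And>\<Lambda>'. \<Lambda>0 \<le> \<Lambda>' \<Longrightarrow> \<forall>i\<in>{0..H}. \<Lambda>'-lipschitz_on {0..1} (\<gamma> i)" by blast
  define \<Lambda> where "\<Lambda> = max \<Lambda>0 1"
  have \<Lambda>: "0 < \<Lambda>" by (simp add: \<Lambda>_def)
  have loop: "simple_loop (\<gamma> i) \<Lambda>" if "i \<le> H" for i
    using param[OF that] \<Lambda>0[of \<Lambda>] that by unfold_locales (auto simp: \<Lambda>_def)

  let ?arc = "\<lambda>A i s t. arc_le (wrap (\<gamma> i)) (A * dist (wrap (\<gamma> i) s) (wrap (\<gamma> i) t)) s t \<or>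
     arc_le (wrap (\<gamma> i)) (A * dist (wrap (\<gamma> i) s) (wrap (\<gamma> i) t)) t (s + 1)"
  have "\<exists>A. \<forall>A'\<ge>A. \<forall>i\<in>{0..H}. \<forall>s t. 0 \<le> s \<longrightarrow> s \<le> 1 \<longrightarrow> s < t \<longrightarrow> t < s + 1 \<longrightarrow> ?arc A' i s t"
  proof (rule finite_uniform_bound)
    fix i assume "i \<in> {0..H}"
    then have i: "i \<le> H" by simp
    obtain A where A: "\<forall>s t. 0 \<le> s \<longrightarrow> s \<le> 1 \<longrightarrow> s < t \<longrightarrow> t < s + 1 \<longrightarrow> ?arc A i s t"
      using simple_loop.chord_arc[OF loop[OF i] assms(1)] comp[OF i] param(3)[OF i] by auto
    have "?arc A' i s t" if "A \<le> A'" "?arc A i s t" for A' s t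
      using that(2) arc_le_mono mult_right_mono[OF that(1) zero_le_dist] by blast
    then show "\<exists>A. \<forall>A'\<ge>A. \<forall>s t. 0 \<le> s \<longrightarrow> s \<le> 1 \<longrightarrow> s < t \<longrightarrow> t < s + 1 \<longrightarrow> ?arc A' i s t"
      using A by (intro exI[of _ A]) blast
  qed simp
  then obtain A0 where A0: "\<And>A'. A0 \<le> A' \<Longrightarrow> \<forall>i\<in>{0..H}. \<forall>s t. 0 \<le> s \<longrightarrow> s \<le> 1 \<longrightarrow> s < t \<longrightarrow> t < s + 1 \<longrightarrow> ?arc A' i s t"
    by blast
  define A where "A = max A0 1"
  have A: "1 \<le> A" by (simp add: A_def)
  have arcA: "?arc A i s t" if "i \<le> H" "0 \<le> s" "s \<le> 1" "s < t" "t < s + 1" for i s t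
    using A0[of A] that by (simp add: A_def)

  have cptG: "compact (\<Gamma> i)" if "i \<le> H" for i
    using param(1,3)[OF that] by (metis compact_path_image simple_path_imp_path)
  have "\<exists>N. \<forall>N'\<ge>N. \<forall>q\<in>{0..H} \<times> {0..H}. fst q \<noteq> snd q \<longrightarrow> (\<forall>x\<in>\<Gamma> (fst q). \<forall>y\<in>\<Gamma> (snd q). 1 \<le> N' * dist x y)"
  proof (rule finite_uniform_bound)
    fix q assume q: "q \<in> {0..H} \<times> {0..H}"
    show "\<exists>N. \<forall>N'\<ge>N. fst q \<noteq> snd q \<longrightarrow> (\<forall>x\<in>\<Gamma> (fst q). \<forall>y\<in>\<Gamma> (snd q). 1 \<le> N' * dist x y)"
    proof (cases "fst q = snd q")
      case False
      have le: "fst q \<le> H" "snd q \<le> H" using q by auto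
      have "\<Gamma> (fst q) \<noteq> \<Gamma> (snd q)" using assms(2) le False by (auto simp: bij_betw_def inj_on_def)
      then have "\<Gamma> (fst q) \<inter> \<Gamma> (snd q) = {}" using components_eq[OF comp[OF le(1)] comp[OF le(2)]] by blast
      then obtain d where d: "0 < d" "\<And>x y. x \<in> \<Gamma> (fst q) \<Longrightarrow> y \<in> \<Gamma> (snd q) \<Longrightarrow> d \<le> dist x y"
        using separate_compact_closed[OF cptG[OF le(1)] compact_imp_closed[OF cptG[OF le(2)]]] by blast
      have "1 \<le> N' * dist x y" if "1 / d \<le> N'" "x \<in> \<Gamma> (fst q)" "y \<in> \<Gamma> (snd q)" for N' x y
      proof -
        have "1 = 1 / d * d" using d by simp
        also have "\<dots> \<le> N' * dist x y" using that d by (intro mult_mono) (auto intro: order_trans[of _ "1 / d"])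
        finally show ?thesis .
      qed
      then show ?thesis by blast
    qed auto
  qed simp
  then obtain N0 where N0: "\<And>N'. N0 \<le> N' \<Longrightarrow> \<forall>q\<in>{0..H} \<times> {0..H}. fst q \<noteq> snd q \<longrightarrow> (\<forall>x\<in>\<Gamma> (fst q). \<forall>y\<in>\<Gamma> (snd q). 1 \<le> N' * dist x y)"
    by blast
  define d where "d = 1 / max N0 1"
  have d: "0 < d" by (simp add: d_def)
  have sep: "d \<le> dist x y" if "i \<le> H" "i' \<le> H" "i \<noteq> i'" "x \<in> \<Gamma> i" "y \<in> \<Gamma> i'" for i i' x y
  proof -
    have "1 \<le> max N0 1 * dist x y" using N0[of "max N0 1"] that by force
    then show ?thesis by (simp add: d_def field_simps max_def split: if_splits)
  qed

  have "\<forall>i\<in>{0..H}. \<exists>z1 z2 z3 k. z1 \<in> \<Gamma> i \<and> z2 \<in> \<Gamma> i \<and> z3 \<in> \<Gamma> i \<and> 0 < k \<and>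
    (\<forall>a. k * norm a \<le> \<bar>(z2 - z1) \<bullet> a\<bar> + \<bar>(z3 - z1) \<bullet> a\<bar>)"
  proof
    fix i assume "i \<in> {0..H}"
    then have i: "i \<le> H" by simp
    show "\<exists>z1 z2 z3 k. z1 \<in> \<Gamma> i \<and> z2 \<in> \<Gamma> i \<and> z3 \<in> \<Gamma> i \<and> 0 < k \<and>
      (\<forall>a. k * norm a \<le> \<bar>(z2 - z1) \<bullet> a\<bar> + \<bar>(z3 - z1) \<bullet> a\<bar>)"
      by (rule simple_loop.loop_not_in_line[OF loop[OF i]]) (unfold param(3)[OF i], blast)
  qed
  then obtain z1 z2 z3 k' where z: "\<And>i. i \<le> H \<Longrightarrow> z1 i \<in> \<Gamma> i" "\<And>i. i \<le> H \<Longrightarrow> z2 i \<in> \<Gamma> i" "\<And>i. i \<le> H \<Longrightarrow> z3 i \<in> \<Gamma> i"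
    and k': "\<And>i. i \<le> H \<Longrightarrow> 0 < k' i"
    "\<And>i a. i \<le> H \<Longrightarrow> k' i * norm a \<le> \<bar>(z2 i - z1 i) \<bullet> a\<bar> + \<bar>(z3 i - z1 i) \<bullet> a\<bar>"
    by (simp add: Ball_def) metis
  \<comment> \<open>One constant for all components.\<close>
  define k where "k = Min (k' ` {0..H})"
  have kpos: "0 < k" using k'(1) by (simp add: k_def)
  have kfar: "k * norm a \<le> \<bar>(z2 i - z1 i) \<bullet> a\<bar> + \<bar>(z3 i - z1 i) \<bullet> a\<bar>" if "i \<le> H" for i a
  proof -
    have "k \<le> k' i" using that by (simp add: k_def)
    then have "k * norm a \<le> k' i * norm a" by (intro mult_right_mono) auto
    then show ?thesis using k'(2)[OF that, of a] by linarith
  qed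
  define \<kappa> where "\<kappa> = k\<^sup>2 / (16 * \<Lambda>)"
  have \<kappa>: "0 < \<kappa>" using kpos \<Lambda> by (simp add: \<kappa>_def)

  obtain R0 where R0: "\<And>x. x \<in> frontier \<Omega> \<Longrightarrow> norm x \<le> R0"
    using compact_imp_bounded[OF fr_cpt] by (auto simp: bounded_iff)
  define R where "R = R0 + 1"
  have tri: "2 simplex K" if "h \<in> J" "K \<in> Th h" for h K
    using assms(8) that by (auto simp: conforming_triangulation_def)
  obtain c where c: "0 < c" "c \<le> 1/2" and inball: "\<And>h K. h \<in> J \<Longrightarrow> K \<in> Th h \<Longrightarrow> \<exists>z. cball z (c * h) \<subseteq> K"
  proof (rule uniform_inball[OF assms(10,11,9,4)])
    show "2 simplex K" if "h \<in> J" "K \<in> Th h" for h K by (rule tri[OF that])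
  qed (rule that)
  \<comment> \<open>With \<open>h \<le> \<epsilon>\<close>, a point of the boundary of \<open>\<Omega>\<close> has a boundary vertex of the mesh within \<open>2 * \<epsilon>\<close>. The bounds by \<open>k\<close> and \<open>d\<close> make this close enough for \<open>polygon_coercive\<close> and ensure that the vertex is on the same component.\<close>
  define \<epsilon> where "\<epsilon> = min 1 (min (k / 16) (d / 4))"
  have \<epsilon>: "0 < \<epsilon>" "\<epsilon> \<le> 1" "2 * \<epsilon> \<le> k / 8" "2 * \<epsilon> < d" using kpos d by (auto simp: \<epsilon>_def min_def)
  have "\<forall>\<^sub>F h in at 0 within J. dist (hausdorff_dist (frontier (\<Omega>h h)) (frontier \<Omega>)) 0 < \<epsilon>"
    using tendstoD[OF assms(12) \<epsilon>(1)] .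
  then obtain \<delta> where \<delta>: "0 < \<delta>" "\<And>h. h \<in> J \<Longrightarrow> h \<noteq> 0 \<Longrightarrow> dist h 0 < \<delta> \<Longrightarrow>
      dist (hausdorff_dist (frontier (\<Omega>h h)) (frontier \<Omega>)) 0 < \<epsilon>"
    unfolding eventually_at by blast
  define h0 where "h0 = min \<epsilon> (\<delta> / 2)"
  have h0: "0 < h0" using \<epsilon> \<delta> by (simp add: h0_def)

  show ?thesis
  proof (rule exI[of _ h0], rule conjI[OF h0], rule exI[of _ "sqrt (boundary_mesh.C_bound H c A \<Lambda> \<kappa> d R)"], intro ballI impI)
    fix h assume hJ: "h \<in> J" and hh0: "h \<le> h0"
    have h: "0 < h" "h \<le> \<epsilon>" "h \<le> 1" using hJ assms(4) hh0 \<epsilon> by (auto simp: h0_def)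
    let ?D = "\<Omega>h h" let ?T = "Th h"
    have haus: "hausdorff_dist (frontier ?D) (frontier \<Omega>) < \<epsilon>"
      using \<delta>(2)[OF hJ] h hh0 \<delta>(1) by (auto simp: h0_def dist_real_def)
    interpret mesh ?D ?T
      using assms(6,8) hJ by unfold_locales (auto simp: polygonal_lipschitz_domain_def)
    have D_ne: "?D \<noteq> {}" using D by (simp add: lipschitz_domain_def)
    have Dfr: "compact (frontier ?D)" using bounded_D by (simp add: compact_frontier_bounded)
    have Dfr_ne: "frontier ?D \<noteq> {}"
      using D_ne bounded_D not_bounded_UNIV by (auto simp: frontier_eq_empty)
    have frne: "frontier \<Omega> \<noteq> {}" using domain not_bounded_UNIV by (auto simp: frontier_eq_empty)
    have diam: "diameter K \<le> h" if "K \<in> ?T" for K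
    proof -
      have "diameter K \<le> mesh_size ?T" unfolding mesh_size_def using finite_T that by (intro Max_ge) auto
      then show ?thesis using assms(9) hJ by simp
    qed
    \<comment> \<open>The boundary of the mesh is within distance one of that of \<open>\<Omega>\<close>, so the meshes are uniformly bounded.\<close>
    have radius: "norm x \<le> R" if "x \<in> closure ?D" for x
    proof (rule norm_le_of_frontier[OF open_D bounded_D D_ne _ that])
      fix b assume "b \<in> frontier ?D"
      then obtain a where "a \<in> frontier \<Omega>" "dist b a < \<epsilon>"
        using hausdorff_dist_nearby[OF Dfr fr_cpt frne haus] by blast
      then show "norm b \<le> R" using R0[of a] \<epsilon>(2) norm_triangle_sub[of b a] by (simp add: R_def dist_norm)
    qed

    define order where "order i m s \<longleftrightarrow> 3 \<le> m \<and> strict_mono_on {..<m} s \<and> s ` {..<m} \<subseteq> {0..<1} \<and>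
      bdry_vertices ?D ?T \<inter> \<Gamma>h h i = (\<lambda>j. \<gamma> i (s (j mod m))) ` {..<m} \<and>
      {e \<in> bdry_edges ?D ?T. e \<subseteq> \<Gamma>h h i}
         = {closed_segment (\<gamma> i (s (j mod m))) (\<gamma> i (s (Suc j mod m))) | j. j < m} \<and>
      (\<forall>j<m. edge_tangent ?T (closed_segment (\<gamma> i (s (j mod m))) (\<gamma> i (s (Suc j mod m))))
         = (\<gamma> i (s (Suc j mod m)) - \<gamma> i (s (j mod m))) /\<^sub>R norm (\<gamma> i (s (Suc j mod m)) - \<gamma> i (s (j mod m))))"
      for i m and s :: "nat \<Rightarrow> real"
    have "\<exists>m s. order i m s" if "i \<le> H" for i
      using assms(13)[rule_format, OF hJ, of i] that unfolding same_cyclic_order_def Let_def order_def by simp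
    then obtain m s where "\<And>i. i \<le> H \<Longrightarrow> order i (m i) (s i)" by metis
    note ord = this[unfolded order_def]
    define v where "v = (\<lambda>i j. \<gamma> i (s i (j mod m i)))"
    have m3: "3 \<le> m i" if "i \<le> H" for i using ord[OF that] by blast
    have verts: "bdry_vertices ?D ?T \<inter> \<Gamma>h h i = v i ` {..<m i}" if "i \<le> H" for i
      using ord[OF that] unfolding v_def by blast
    have edges: "{e \<in> bdry_edges ?D ?T. e \<subseteq> \<Gamma>h h i} = {closed_segment (v i j) (v i (Suc j)) | j. j < m i}" if "i \<le> H" for i
      using ord[OF that] unfolding v_def by blast
    have tangent: "edge_tangent ?T (closed_segment (v i j) (v i (Suc j))) = edge_dir (v i) j" if "i \<le> H" "j < m i" for i j
      using ord[OF that(1)] that(2) unfolding v_def edge_dir_def by blast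
    have poly: "inj_on (v i) {..<m i}" "v i ` {..<m i} \<subseteq> \<Gamma> i" "poly_len (v i) (m i) \<le> \<Lambda>" if "i \<le> H" for i
      using simple_loop.loop_polygon(1,2,3)[OF loop[OF that], of "m i" "s i"] ord[OF that] param(3)[OF that]
      unfolding v_def by auto
    have chord: "poly_len (v i) l - poly_len (v i) k \<le> A * dist (v i k) (v i l) \<or>
       poly_len (v i) (m i) - (poly_len (v i) l - poly_len (v i) k) \<le> A * dist (v i k) (v i l)"
      if "i \<le> H" "k < l" "l < m i" for i k l
      unfolding v_def
      by (rule simple_loop.loop_polygon(4)[OF loop[OF that(1)]])
        (use ord[OF that(1)] arcA[OF that(1)] that in auto)
    have near: "\<exists>j<m i. dist (v i j) z \<le> k / 8" if i: "i \<le> H" and zG: "z \<in> \<Gamma> i" for i z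
    proof -
      have "z \<in> frontier \<Omega>" using zG comp[OF i] in_components_subset by blast
      then obtain b where b: "b \<in> frontier ?D" "dist z b < \<epsilon>"
        using hausdorff_dist_nearby[OF fr_cpt Dfr Dfr_ne] haus hausdorff_dist_commute by metis
      obtain i' w where w: "i' \<le> H" "w \<in> bdry_vertices ?D ?T \<inter> \<Gamma>h h i'" "dist b w \<le> h"
        by (rule bdry_vertex_near_frontier[OF assms(7)[rule_format, OF hJ] b(1) diam])
      have zw: "dist z w < 2 * \<epsilon>" using dist_triangle[of z w b] b(2) w(3) h(2) by simp
      obtain j where j: "j < m i'" "w = v i' j" using w(2) verts[OF w(1)] by auto
      have "w \<in> \<Gamma> i'" using poly(2)[OF w(1)] j by auto
      then have "i' = i" using sep[OF i w(1) _ zG] zw \<epsilon>(4) by force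
      then show ?thesis using j zw \<epsilon>(3) by (intro exI[of _ j]) (simp add: dist_commute)
    qed
    have coercive: "\<kappa> * (norm a)\<^sup>2 \<le> (\<Sum>j<m i. dist (v i j) (v i (Suc j)) * (edge_dir (v i) j \<bullet> a)\<^sup>2)"
      if i: "i \<le> H" for i a
    proof -
      obtain j1 j2 j3 where "j1 < m i" "dist (v i j1) (z1 i) \<le> k / 8" "j2 < m i" "dist (v i j2) (z2 i) \<le> k / 8"
        "j3 < m i" "dist (v i j3) (z3 i) \<le> k / 8"
        using near[OF i z(1)[OF i]] near[OF i z(2)[OF i]] near[OF i z(3)[OF i]] by blast
      then show ?thesis unfolding \<kappa>_def
        by (intro polygon_coercive[OF _ _ _ kpos kfar[OF i] _ _ _ poly(3)[OF i] \<Lambda>]) auto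
    qed
    interpret bm: boundary_mesh ?D ?T H m v h c A \<Lambda> \<kappa> d R
    proof unfold_locales
      have "bdry_edges ?D ?T = (\<Union>i\<in>{0..H}. {closed_segment (v i j) (v i (Suc j)) | j. j < m i})"
        using bdry_edges_in_components[OF assms(7)[rule_format, OF hJ]] edges by simp
      also have "\<dots> = {closed_segment (v i j) (v i (Suc j)) |i j. i \<le> H \<and> j < m i}"
        by (simp only: set_eq_iff UN_iff mem_Collect_eq Bex_def atLeastAtMost_iff le0 simp_thms) blast
      finally show "bdry_edges ?D ?T = {closed_segment (v i j) (v i (Suc j)) |i j. i \<le> H \<and> j < m i}" .
      show "d \<le> dist (v i j) (v i' j')" if "i \<le> H" "i' \<le> H" "i \<noteq> i'" "j < m i" "j' < m i'" for i i' j j'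
        using poly(2)[OF that(1)] poly(2)[OF that(2)] that(4,5) by (intro sep[OF that(1,2,3)]) blast+
      show "v i (m i) = v i 0" for i by (simp add: v_def)
    qed (use h c A \<Lambda> \<kappa> d inball[OF hJ] diam radius m3 poly tangent chord coercive in \<open>auto simp only:\<close>)
    show "\<exists>p :: ((real^2) set \<Rightarrow> real) \<Rightarrow> real^2 \<Rightarrow> real^2.
       (\<forall>\<mu>\<in>edge_data (bdry_edges ?D ?T).
          p \<mu> \<in> S1_vec ?D ?T \<and>
          sCurl (p \<mu>) \<in> X_space ?D ?T \<inter> ker_divdiv ?D \<and>
          (\<forall>e\<in>bdry_edges ?D ?T. \<forall>x\<in>e.
             trace_nn ?T e (sCurl (p \<mu>)) x = \<mu> e \<and>
             trace_qn ?T e (sCurl (p \<mu>)) x = 0) \<and>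
          L2_norm_on ?D (sCurl (p \<mu>))
            \<le> sqrt (boundary_mesh.C_bound H c A \<Lambda> \<kappa> d R) * sqrt (\<Sum>e\<in>bdry_edges ?D ?T. diameter e * \<bar>\<mu> e\<bar>\<^sup>2)) \<and>
       linear_on_edge_data (bdry_edges ?D ?T) (closure ?D) p"
    proof (intro exI[of _ bm.ext_field] conjI ballI)
      fix \<mu> e x assume "e \<in> bdry_edges ?D ?T" and x: "x \<in> e"
      then obtain i j where ij: "i \<le> H" "j < m i" "e = closed_segment (v i j) (v i (Suc j))" using bm.edges by blast
      show "trace_nn ?T e (sCurl (bm.ext_field \<mu>)) x = \<mu> e" "trace_qn ?T e (sCurl (bm.ext_field \<mu>)) x = 0"
        using bm.ext_field_traces[OF ij(1,2)] x unfolding ij(3) by blast+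
    next
      fix \<mu>
      show "bm.ext_field \<mu> \<in> S1_vec ?D ?T" by (rule bm.ext_field_S1)
      show "sCurl (bm.ext_field \<mu>) \<in> X_space ?D ?T \<inter> ker_divdiv ?D" by (rule bm.ext_field_ker_X)
      show "L2_norm_on ?D (sCurl (bm.ext_field \<mu>))
        \<le> sqrt (boundary_mesh.C_bound H c A \<Lambda> \<kappa> d R) * sqrt (\<Sum>e\<in>bdry_edges ?D ?T. diameter e * \<bar>\<mu> e\<bar>\<^sup>2)"
        by (rule bm.ext_field_L2_bound)
      show "linear_on_edge_data (bdry_edges ?D ?T) (closure ?D) bm.ext_field" by (rule bm.ext_field_linear)
    qed
  qed
qed

end
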